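(* Let $(X_0,X_1,\dots,X_N)$ be a recursively compounded process (defined in the context), with $X_n$ taking values in $\mathbb{R}^{d_n}$, and let $x_n\in\mathbb{R}^{d_n}$ for all $n=0,1,\dots,N$. Then $$\hat f_{X_1,\dots,X_N\,\vert\,X_0=x_0}(x_1,\dots,x_N)=\prod_{n=1}^N \hat f_{X_n\,\vert\,X_0=x_0,\dots,X_{n-1}=x_{n-1}}(x_n),$$ where the left-hand side is the multivariate saddlepoint approximation for the conditional joint distribution of $(X_1,\dots,X_N)$ given $X_0=x_0$, evaluated at $(x_1,\dots,x_N)$, and the $n$-th factor on the right-hand side is the saddlepoint approximation for the conditional distribution of $X_n$ given $X_0=x_0,\dots,X_{n-1}=x_{n-1}$, i.e. $\hat f_{Q_n(x_0,\dots,x_{n-1})}(x_n)$. Part of the assertion is that the two sides have the same domain: if one side is undefined (because a corresponding saddlepoint does not exist or because a determinant in the denominator vanishes), then so is the other, and vice versa.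
   Context: Vector conventions: random vectors $X\in\mathbb{R}^d$ are column vectors and generating-function arguments $s$ are row vectors of dimension $d$, so $sX$ is a scalar. $M_X(s)=\mathbb{E}(e^{sX})$ is the moment generating function (MGF) and $K_X(s)=\log M_X(s)$ the cumulant generating function (CGF), with domain the set of $s$ where $M_X(s)<\infty$. $K_X'(s)$ (a column vector) and $K_X''(s)$ denote the gradient and the Hessian matrix, defined in the interior of the domain. For several vectors, $M_{X_1,\dots,X_N}(s_1,\dots,s_N)=\mathbb{E}(e^{s_1X_1+\dots+s_NX_N})$ and $K_{X_1,\dots,X_N}=\log M_{X_1,\dots,X_N}$, i.e. the MGF and CGF of the concatenated vector. Saddlepoint approximation: for $x\in\mathbb{R}^d$, a saddlepoint is a solution $\hat s$ (in the interior of the domain of $K_X$) of the saddlepoint equation $K_X'(\hat s)=x$. If it exists and $\det K_X''(\hat s)\ne0$, define $$\hat f_X(x)=\frac{\exp(K_X(\hat s)-\hat s x)}{\sqrt{\det(2\pi K_X''(\hat s))}};$$ otherwise $\hat f_X(x)$ is undefined. The saddlepoint approximation for $(X_1,\dots,X_N)$ at $(x_1,\dots,x_N)$ is the same formula applied to the concatenated vectors. The saddlepoint approximation of a conditional distribution uses the CGF of that conditional distribution. A product is undefined if any of its factors is undefined. Recursively compounded process: $(X_0,\dots,X_N)$, with $X_n\in\mathbb{R}^{d_n}$ having entries $X_{n,i}$, is recursively compounded if for each $n=1,\dots,N$ the conditional distribution of $X_n$ given $X_0,\dots,X_{n-1}$ is the same as $Q_n(X_0,\dots,X_{n-1})$,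 where $$Q_n(x_0,\dots,x_{n-1})=\xi_n+\sum_{m=0}^{n-1}\sum_{i=1}^{d_m}Z_{n,m,i}(x_{m,i}),$$ where $\xi_n$ is a random variable and the $Z_{n,m,i}(t)$ are processes, all with values in $\mathbb{R}^{d_n}$ and all independent of each other and of $X_0,\dots,X_{n-1}$, and where for each $m<n$ and $i\le d_m$ one or more of the following holds: (1) $X_{m,i}$ takes values in $\mathbb{Z}_+=\{0,1,2,\dots\}$ and $Z_{n,m,i}(t)=\sum_{j=1}^tY_{n,m,i,j}$ for $t\in\mathbb{Z}_+$, where $Y_{n,m,i,j}$, $j\in\mathbb{N}$, are i.i.d. with values in $\mathbb{R}^{d_n}$, independent of everything else; (2) $X_{m,i}$ takes values in $[0,\infty)$ and $(Z_{n,m,i}(t))_{t\in[0,\infty)}$ is a Lévy process with values in $\mathbb{R}^{d_n}$, independent of everything else; (3) $X_{m,i}$ has arbitrary values and $Z_{n,m,i}(t)=ct$ for some constant $c\in\mathbb{R}^{d_n}$. Empty sums are $0$. Conditioning on $X_0=x_0$ means replacing $X_0$ by the constant $x_0$ and constructing $X_1,\dots,X_N$ by the same recursion; $x_0$ is such that this again gives a recursively compounded process with the same $Q_n$. The CGF of $Q_n(x_0,\dots,x_{n-1})$ is $$K_{Q_n(x_0,\dots,x_{n-1})}(s_n)=K_{\xi_n}(s_n)+\sum_{m=0}^{n-1}\sum_{i=1}^{d_m}x_{m,i}K_{Z_{n,m,i}(1)}(s_n),$$ and this formula is taken as the meaning of $K_{Q_n(x_0,\dots,x_{n-1})}$ in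 the saddlepoint approximation also when some $x_{m,i}$ with $m\geq 1$ is not in the index set of $Z_{n,m,i}$. *)

theory Defs
  imports "HOL-Probability.Probability"
begin

text \<open>
  A vector of \<open>\<real>\<^sup>d\<close> is an element of \<open>{..<d} \<rightarrow>\<^sub>E UNIV\<close>, so that dimensions can be indexed by a natural
  number. More generally \<open>\<real>\<^sup>I\<close>, for a finite index set \<open>I\<close>, is \<open>I \<rightarrow>\<^sub>E UNIV\<close>, with the topology
  \<^term>\<open>powertop_real I\<close> and the sigma-algebra \<open>\<Pi>\<^sub>M i\<in>I. borel\<close>.
\<close>

abbreviation vec_space :: "'i set \<Rightarrow> ('i \<Rightarrow> real) set" where
  "vec_space I \<equiv> I \<rightarrow>\<^sub>E UNIV"

abbreviation vec_algebra :: "'i set \<Rightarrow> ('i \<Rightarrow> real) measure" where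
  "vec_algebra I \<equiv> \<Pi>\<^sub>M i\<in>I. borel"

definition vec_sum :: "'i set \<Rightarrow> 'k set \<Rightarrow> ('k \<Rightarrow> 'i \<Rightarrow> real) \<Rightarrow> 'i \<Rightarrow> real" where
  "vec_sum I J v = (\<lambda>i\<in>I. \<Sum>j\<in>J. v j i)"

definition vec_diff :: "'i set \<Rightarrow> ('i \<Rightarrow> real) \<Rightarrow> ('i \<Rightarrow> real) \<Rightarrow> 'i \<Rightarrow> real" where
  "vec_diff I v w = (\<lambda>i\<in>I. v i - w i)"


section \<open>Generating functions and the saddlepoint approximation\<close>

definition mgf :: "'w measure \<Rightarrow> 'i set \<Rightarrow> ('w \<Rightarrow> 'i \<Rightarrow> real) \<Rightarrow> ('i \<Rightarrow> real) \<Rightarrow> ennreal" where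
  "mgf M I V s = (\<integral>\<^sup>+\<omega>. ennreal (exp (\<Sum>i\<in>I. s i * V \<omega> i)) \<partial>M)"

definition cgf :: "'w measure \<Rightarrow> 'i set \<Rightarrow> ('w \<Rightarrow> 'i \<Rightarrow> real) \<Rightarrow> ('i \<Rightarrow> real) \<Rightarrow> ereal" where
  "cgf M I V s = (if mgf M I V s < \<infinity> then ereal (ln (enn2real (mgf M I V s))) else \<infinity>)"

text \<open>
  The functions \<open>K\<close> below are extended real valued. The value \<open>-\<infinity>\<close> does not occur for the CGF of
  a random vector, but it can occur in \<open>cgf_step\<close> below, where coefficients may be negative; such
  points are not in the domain either.
\<close>

definition cgf_domain :: "'i set \<Rightarrow> (('i \<Rightarrow> real) \<Rightarrow> ereal) \<Rightarrow> ('i \<Rightarrow> real) set" where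
  "cgf_domain I K = {s \<in> vec_space I. \<bar>K s\<bar> \<noteq> \<infinity>}"

definition partial_deriv :: "'i \<Rightarrow> (('i \<Rightarrow> real) \<Rightarrow> real) \<Rightarrow> ('i \<Rightarrow> real) \<Rightarrow> real" where
  "partial_deriv i f s = deriv (\<lambda>t. f (s(i := t))) (s i)"

definition gradient :: "(('i \<Rightarrow> real) \<Rightarrow> ereal) \<Rightarrow> ('i \<Rightarrow> real) \<Rightarrow> 'i \<Rightarrow> real" where
  "gradient K s = (\<lambda>i. partial_deriv i (\<lambda>r. real_of_ereal (K r)) s)"

definition hessian :: "(('i \<Rightarrow> real) \<Rightarrow> ereal) \<Rightarrow> ('i \<Rightarrow> real) \<Rightarrow> 'i \<Rightarrow> 'i \<Rightarrow> real" where
  "hessian K s = (\<lambda>i j. partial_deriv i (partial_deriv j (\<lambda>r. real_of_ereal (K r))) s)"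

text \<open>The determinant of a matrix whose rows and columns are indexed by the finite set \<open>I\<close>.\<close>

definition det_on :: "'i set \<Rightarrow> ('i \<Rightarrow> 'i \<Rightarrow> real) \<Rightarrow> real" where
  "det_on I A = (\<Sum>p | p permutes I. of_int (sign p) * (\<Prod>i\<in>I. A i (p i)))"

lemma det_on_UNIV: "det_on UNIV (\<lambda>i j. A $ i $ j) = det A"
  by (simp add: det_on_def det_def)

definition saddlepoint ::
    "'i set \<Rightarrow> (('i \<Rightarrow> real) \<Rightarrow> ereal) \<Rightarrow> ('i \<Rightarrow> real) \<Rightarrow> ('i \<Rightarrow> real) \<Rightarrow> bool" where
  "saddlepoint I K x s \<longleftrightarrow>
     s \<in> powertop_real I interior_of (cgf_domain I K) \<and> (\<forall>i\<in>I. gradient K s i = x i)"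

text \<open>
  \<^const>\<open>None\<close> stands for \<open>undefined\<close>. A saddlepoint with nonsingular Hessian is unique when \<open>K\<close> is
  convex, so the choice below is then immaterial.
\<close>

definition saddlepoint_approx ::
    "'i set \<Rightarrow> (('i \<Rightarrow> real) \<Rightarrow> ereal) \<Rightarrow> ('i \<Rightarrow> real) \<Rightarrow> real option" where
  "saddlepoint_approx I K x =
     (if \<exists>s. saddlepoint I K x s \<and> det_on I (hessian K s) \<noteq> 0
      then let s = (SOME s. saddlepoint I K x s \<and> det_on I (hessian K s) \<noteq> 0)
           in Some (exp (real_of_ereal (K s) - (\<Sum>i\<in>I. s i * x i))
                    / sqrt (det_on I (\<lambda>i j. 2 * pi * hessian K s i j)))
      else None)"

definition prod_option :: "('k \<Rightarrow> real option) \<Rightarrow> 'k set \<Rightarrow> real option" where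
  "prod_option f A = (if \<forall>n\<in>A. f n \<noteq> None then Some (\<Prod>n\<in>A. the (f n)) else None)"


section \<open>Random walks, Levy processes and linear drifts\<close>

text \<open>
  A process with values in \<open>\<real>\<^sup>I\<close> is a function of a real time parameter; only times in its index set
  (\<open>\<nat>\<close>, \<open>{0..}\<close> or \<open>UNIV\<close>) are relevant.
\<close>

definition random_walk :: "'u measure \<Rightarrow> 'i set \<Rightarrow> (real \<Rightarrow> 'u \<Rightarrow> 'i \<Rightarrow> real) \<Rightarrow> bool" where
  "random_walk P I Z \<longleftrightarrow>
     (\<exists>Y :: nat \<Rightarrow> 'u \<Rightarrow> 'i \<Rightarrow> real.
        prob_space.indep_vars P (\<lambda>_. vec_algebra I) Y {1..} \<and>
        (\<forall>j\<ge>1. distr P (vec_algebra I) (Y j) = distr P (vec_algebra I) (Y 1)) \<and>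
        (\<forall>t::nat. \<forall>u\<in>space P. Z (real t) u = vec_sum I {1..t} (\<lambda>j. Y j u)))"

text \<open>
  Independence of increments is stated for infinite increasing sequences of times; this covers
  finite ones, which can be continued as constant sequences.
\<close>

definition levy_process :: "'u measure \<Rightarrow> 'i set \<Rightarrow> (real \<Rightarrow> 'u \<Rightarrow> 'i \<Rightarrow> real) \<Rightarrow> bool" where
  "levy_process P I Z \<longleftrightarrow>
     (\<forall>t\<ge>0. Z t \<in> P \<rightarrow>\<^sub>M vec_algebra I) \<and>
     (AE u in P. \<forall>i\<in>I. Z 0 u i = 0) \<and>
     (\<forall>\<tau> :: nat \<Rightarrow> real. mono \<tau> \<and> 0 \<le> \<tau> 0 \<longrightarrow>
        prob_space.indep_vars P (\<lambda>_. vec_algebra I)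
          (\<lambda>j u. vec_diff I (Z (\<tau> (Suc j)) u) (Z (\<tau> j) u)) UNIV) \<and>
     (\<forall>r t. 0 \<le> r \<and> r \<le> t \<longrightarrow>
        distr P (vec_algebra I) (\<lambda>u. vec_diff I (Z t u) (Z r u))
        = distr P (vec_algebra I) (Z (t - r))) \<and>
     (\<forall>r\<ge>0. \<forall>\<epsilon>>0.
        ((\<lambda>t. measure P {u \<in> space P. \<exists>i\<in>I. \<bar>Z t u i - Z r u i\<bar> > \<epsilon>}) \<longlongrightarrow> 0) (at r within {0..}))"

definition linear_drift :: "'u measure \<Rightarrow> 'i set \<Rightarrow> (real \<Rightarrow> 'u \<Rightarrow> 'i \<Rightarrow> real) \<Rightarrow> bool" where
  "linear_drift P I Z \<longleftrightarrow>
     (\<exists>c\<in>vec_space I. \<forall>t. \<forall>u\<in>space P. Z t u = (\<lambda>i\<in>I. t * c i))"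

definition compounding_process ::
    "'u measure \<Rightarrow> 'i set \<Rightarrow> real set \<Rightarrow> (real \<Rightarrow> 'u \<Rightarrow> 'i \<Rightarrow> real) \<Rightarrow> bool" where
  "compounding_process P I T Z \<longleftrightarrow>
     T = \<nat> \<and> random_walk P I Z \<or>
     T = {0..} \<and> levy_process P I Z \<or>
     T = UNIV \<and> linear_drift P I Z"

definition generated_events ::
    "'u measure \<Rightarrow> 'b measure \<Rightarrow> 't set \<Rightarrow> ('t \<Rightarrow> 'u \<Rightarrow> 'b) \<Rightarrow> 'u set set" where
  "generated_events P S T Z =
     sigma_sets (space P) {Z t -` B \<inter> space P |t B. t \<in> T \<and> B \<in> sets S}"


section \<open>Recursively compounded processes\<close>

text \<open>
  \<open>d n\<close> is the dimension of the \<open>n\<close>-th vector and \<open>T n m i\<close> is the index set of the process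
  \<open>Z n m i\<close>. The variables \<open>\<xi> n\<close> and \<open>Z n m i t\<close> live on a probability space \<open>P\<close> of their own, and
  \<open>compound_map d \<xi> Z n y\<close> is the random vector \<open>Q\<^sub>n(y\<^sub>0, \<dots>, y\<^sub>n\<^sub>-\<^sub>1)\<close>.
\<close>

definition compound_map ::
    "(nat \<Rightarrow> nat) \<Rightarrow> (nat \<Rightarrow> 'u \<Rightarrow> nat \<Rightarrow> real) \<Rightarrow> (nat \<Rightarrow> nat \<Rightarrow> nat \<Rightarrow> real \<Rightarrow> 'u \<Rightarrow> nat \<Rightarrow> real) \<Rightarrow>
     nat \<Rightarrow> (nat \<Rightarrow> nat \<Rightarrow> real) \<Rightarrow> 'u \<Rightarrow> nat \<Rightarrow> real" where
  "compound_map d \<xi> Z n y u =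
     (\<lambda>k\<in>{..<d n}. \<xi> n u k + (\<Sum>m<n. \<Sum>i<d m. Z n m i (y m i) u k))"

definition compounding_noise ::
    "nat \<Rightarrow> (nat \<Rightarrow> nat) \<Rightarrow> 'u measure \<Rightarrow> (nat \<Rightarrow> 'u \<Rightarrow> nat \<Rightarrow> real) \<Rightarrow>
     (nat \<Rightarrow> nat \<Rightarrow> nat \<Rightarrow> real \<Rightarrow> 'u \<Rightarrow> nat \<Rightarrow> real) \<Rightarrow> (nat \<Rightarrow> nat \<Rightarrow> nat \<Rightarrow> real set) \<Rightarrow> bool" where
  "compounding_noise N d P \<xi> Z T \<longleftrightarrow>
     prob_space P \<and>
     (\<forall>n\<in>{1..N}.
        \<xi> n \<in> P \<rightarrow>\<^sub>M vec_algebra {..<d n} \<and>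
        (\<forall>m<n. \<forall>i<d m. compounding_process P {..<d n} (T n m i) (Z n m i)) \<and>
        prob_space.indep_sets P
          (\<lambda>k. case k of
                 None \<Rightarrow> generated_events P (vec_algebra {..<d n}) {()} (\<lambda>_. \<xi> n)
               | Some (m, i) \<Rightarrow> generated_events P (vec_algebra {..<d n}) (T n m i) (Z n m i))
          (insert None (Some ` (SIGMA m:{..<n}. {..<d m}))))"

text \<open>\<open>\<kappa> y\<close> is the conditional distribution of \<open>V\<close> given \<open>Y = y\<close>.\<close>

definition conditional_distribution ::
    "'w measure \<Rightarrow> 'a measure \<Rightarrow> ('w \<Rightarrow> 'a) \<Rightarrow> 'b measure \<Rightarrow> ('w \<Rightarrow> 'b) \<Rightarrow> ('a \<Rightarrow> 'b measure) \<Rightarrow> bool" where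
  "conditional_distribution M A Y B V \<kappa> \<longleftrightarrow>
     Y \<in> M \<rightarrow>\<^sub>M A \<and> V \<in> M \<rightarrow>\<^sub>M B \<and>
     (\<lambda>\<omega>. \<kappa> (Y \<omega>)) \<in> M \<rightarrow>\<^sub>M prob_algebra B \<and>
     (\<forall>C\<in>sets A. \<forall>D\<in>sets B.
        emeasure M {\<omega> \<in> space M. Y \<omega> \<in> C \<and> V \<omega> \<in> D}
        = (\<integral>\<^sup>+\<omega>. indicator C (Y \<omega>) * emeasure (\<kappa> (Y \<omega>)) D \<partial>M))"

text \<open>
  The noise being independent of \<open>X 0, \<dots>, X (n - 1)\<close>, the conditional distribution of
  \<open>Q\<^sub>n(X\<^sub>0, \<dots>, X\<^sub>n\<^sub>-\<^sub>1)\<close> at \<open>y\<close> is the distribution under \<open>P\<close> of \<open>Q\<^sub>n(y)\<close> with \<open>y\<close> held fixed.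
\<close>

definition recursively_compounded ::
    "nat \<Rightarrow> (nat \<Rightarrow> nat) \<Rightarrow> 'u measure \<Rightarrow> (nat \<Rightarrow> 'u \<Rightarrow> nat \<Rightarrow> real) \<Rightarrow>
     (nat \<Rightarrow> nat \<Rightarrow> nat \<Rightarrow> real \<Rightarrow> 'u \<Rightarrow> nat \<Rightarrow> real) \<Rightarrow> (nat \<Rightarrow> nat \<Rightarrow> nat \<Rightarrow> real set) \<Rightarrow>
     'w measure \<Rightarrow> (nat \<Rightarrow> 'w \<Rightarrow> nat \<Rightarrow> real) \<Rightarrow> bool" where
  "recursively_compounded N d P \<xi> Z T M X \<longleftrightarrow>
     compounding_noise N d P \<xi> Z T \<and>
     prob_space M \<and>
     (\<forall>n\<le>N. X n \<in> M \<rightarrow>\<^sub>M vec_algebra {..<d n}) \<and>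
     (\<forall>n\<in>{1..N}.
        (\<forall>m<n. \<forall>i<d m. \<forall>\<omega>\<in>space M. X m \<omega> i \<in> T n m i) \<and>
        conditional_distribution M
          (\<Pi>\<^sub>M m\<in>{..<n}. vec_algebra {..<d m}) (\<lambda>\<omega>. \<lambda>m\<in>{..<n}. X m \<omega>)
          (vec_algebra {..<d n}) (X n)
          (\<lambda>y. distr P (vec_algebra {..<d n}) (compound_map d \<xi> Z n y)))"

text \<open>
  \<open>W\<close> is the process conditioned on \<open>X\<^sub>0 = x\<^sub>0\<close>: it follows the recursion given by the same
  \<open>Q\<^sub>n\<close>, started from the constant \<open>x\<^sub>0\<close>. This determines its distribution.
\<close>

definition conditioned_process ::
    "nat \<Rightarrow> (nat \<Rightarrow> nat) \<Rightarrow> 'u measure \<Rightarrow> (nat \<Rightarrow> 'u \<Rightarrow> nat \<Rightarrow> real) \<Rightarrow>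
     (nat \<Rightarrow> nat \<Rightarrow> nat \<Rightarrow> real \<Rightarrow> 'u \<Rightarrow> nat \<Rightarrow> real) \<Rightarrow> (nat \<Rightarrow> nat \<Rightarrow> nat \<Rightarrow> real set) \<Rightarrow>
     (nat \<Rightarrow> real) \<Rightarrow> 'v measure \<Rightarrow> (nat \<Rightarrow> 'v \<Rightarrow> nat \<Rightarrow> real) \<Rightarrow> bool" where
  "conditioned_process N d P \<xi> Z T x\<^sub>0 M' W \<longleftrightarrow>
     recursively_compounded N d P \<xi> Z T M' W \<and> (\<forall>\<omega>\<in>space M'. W 0 \<omega> = x\<^sub>0)"

text \<open>
  The CGF of \<open>Q\<^sub>n(x\<^sub>0, \<dots>, x\<^sub>n\<^sub>-\<^sub>1)\<close>, extended by the same formula to all real arguments. The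
  convention \<open>0 * \<infinity> = 0\<close> of \<^typ>\<open>ereal\<close> is what is needed: since \<open>Z n m i 0 = 0\<close>, a vanishing
  coordinate puts no restriction on the domain.
\<close>

definition cgf_step ::
    "(nat \<Rightarrow> nat) \<Rightarrow> 'u measure \<Rightarrow> (nat \<Rightarrow> 'u \<Rightarrow> nat \<Rightarrow> real) \<Rightarrow>
     (nat \<Rightarrow> nat \<Rightarrow> nat \<Rightarrow> real \<Rightarrow> 'u \<Rightarrow> nat \<Rightarrow> real) \<Rightarrow> nat \<Rightarrow> (nat \<Rightarrow> nat \<Rightarrow> real) \<Rightarrow>
     (nat \<Rightarrow> real) \<Rightarrow> ereal" where
  "cgf_step d P \<xi> Z n x s =
     cgf P {..<d n} (\<xi> n) s + (\<Sum>m<n. \<Sum>i<d m. ereal (x m i) * cgf P {..<d n} (Z n m i 1) s)"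

text \<open>The concatenation of the vectors \<open>y 1, \<dots>, y N\<close>.\<close>

definition concat_index :: "nat \<Rightarrow> (nat \<Rightarrow> nat) \<Rightarrow> (nat \<times> nat) set" where
  "concat_index N d = (SIGMA n:{1..N}. {..<d n})"

definition concat_vec :: "nat \<Rightarrow> (nat \<Rightarrow> nat) \<Rightarrow> (nat \<Rightarrow> nat \<Rightarrow> real) \<Rightarrow> nat \<times> nat \<Rightarrow> real" where
  "concat_vec N d y = (\<lambda>(n, i)\<in>concat_index N d. y n i)"

end

theory Submission
  imports Defs "Jordan_Normal_Form.Determinant"
begin

text \<open>
  Conditioning on the past turns the joint CGF into a sum: put \<open>r\<^sub>N = s\<^sub>N\<close> and
  \<open>r\<^sub>m = s\<^sub>m + \<Sum>\<^sub>n\<^sub>>\<^sub>m K\<^bsub>Z n m\<^esub>(r\<^sub>n)\<close>; then \<open>K(s) - s x = \<Sum>\<^sub>n (K\<^bsub>Q n\<^esub>(r\<^sub>n) - r\<^sub>n x\<^sub>n)\<close>.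
  The map \<open>s \<mapsto> r\<close> is a unipotent triangular diffeomorphism, so it matches the critical points of the two sides,
  and at a critical point the Hessians are congruent by a matrix of determinant \<open>1\<close>. The change of variables is made
  one \<open>n\<close> at a time, by induction on \<open>N\<close>.

  The domains agree because a nondegenerate saddlepoint of the past excludes null coordinates: a nonnegative
  coordinate \<open>X\<^sub>m\<^sub>,\<^sub>i\<close> is then not almost surely \<open>0\<close>, and \<open>x\<^sub>m\<^sub>,\<^sub>i\<close>, being its mean under an exponential
  tilt, is positive. So on both sides exactly the same \<open>K\<^bsub>Z n m i\<^esub>\<close> have to be finite.
\<close>

section \<open>Determinants over finite index sets\<close>

text \<open>Two mismatches shape the argument. The Hessian of the joint CGF weights the second
  derivatives of the \<open>shift\<close> terms by the tilted means of the past, whereas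
  \<open>cgf_step\<close> weights them by \<open>x\<close>. Hence the determinants factor only where
  the past has mean \<open>x\<close>, and the saddlepoint equations are matched before the Hessians
  are compared. Likewise, finiteness of the joint MGF concerns the processes driven by coordinates
  that are not almost surely zero, and finiteness of \<open>cgf_step\<close> those with a nonzero
  prescribed value; \<open>nondeg_past\<close> reconciles the two and is derived from either side. A
  saddlepoint is picked by \<open>SOME\<close>, so values can be compared only with uniqueness. For
  the CGF of a random vector, the difference of two saddlepoints lies in the kernel of the Hessian.
  The last factor is not treated in this way, since \<open>cgf_step\<close> may have negative
  coefficients; a second saddlepoint of it would lift to a second joint one. The dimension of the
  vectors varies with the step, so derivatives are taken along curves and determinants over index
  sets.\<close>

lemma det_on_reindex:
  assumes f: "bij_betw f {0..<n} I"
  shows "det_on I A = Determinant.det (mat n n (\<lambda>(i, j). A (f i) (f j)))"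
proof -
  let ?U = "{0..<n}"
  have inj: "inj_on f ?U" using f by (auto simp: bij_betw_def)
  have fI: "f ` ?U = I" using f by (auto simp: bij_betw_def)
  have inv: "bij_betw (inv_into ?U f) I ?U" using bij_betw_inv_into[OF f] .
  \<comment> \<open>Conjugation by \<open>f\<close> matches the permutations of the two index sets
    and preserves signs. It gives access to the determinant theory of matrices with numbered
    rows.\<close>
  have bij: "bij_betw (map_permutation ?U f) {p. p permutes ?U} {p. p permutes I}"
  proof (rule bij_betwI[where g = "map_permutation I (inv_into ?U f)"])
    show "map_permutation ?U f \<in> {p. p permutes ?U} \<rightarrow> {p. p permutes I}"
      using map_permutation_permutes[OF f] by auto
    show "map_permutation I (inv_into ?U f) \<in> {p. p permutes I} \<rightarrow> {p. p permutes ?U}"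
      using map_permutation_permutes[OF inv] by auto
    show "map_permutation I (inv_into ?U f) (map_permutation ?U f p) = p" if "p \<in> {p. p permutes ?U}" for p
      using that by (intro map_permutation_compose_inv[where A = ?U]) (auto simp: f inv_into_f_f[OF inj])
    show "map_permutation ?U f (map_permutation I (inv_into ?U f) p) = p" if "p \<in> {p. p permutes I}" for p
      using that fI by (intro map_permutation_compose_inv[where A = I]) (auto simp: inv f_inv_into_f)
  qed
  have "det_on I A = (\<Sum>p | p permutes ?U. of_int (sign (map_permutation ?U f p)) * (\<Prod>i\<in>I. A i (map_permutation ?U f p i)))"
    unfolding det_on_def by (rule sum.reindex_bij_betw[OF bij, symmetric])
  also have "\<dots> = (\<Sum>p | p permutes ?U. signof p * (\<Prod>i\<in>?U. A (f i) (f (p i))))"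
  proof (rule sum.cong[OF refl])
    fix p assume "p \<in> {p. p permutes ?U}"
    hence p: "p permutes ?U" by simp
    have "(\<Prod>i\<in>I. A i (map_permutation ?U f p i)) = (\<Prod>i\<in>?U. A (f i) (map_permutation ?U f p (f i)))"
      by (rule prod.reindex_bij_betw[OF f, symmetric])
    also have "\<dots> = (\<Prod>i\<in>?U. A (f i) (f (p i)))"
      by (intro prod.cong refl) (simp add: map_permutation_apply[OF inj])
    finally show "of_int (sign (map_permutation ?U f p)) * (\<Prod>i\<in>I. A i (map_permutation ?U f p i))
        = signof p * (\<Prod>i\<in>?U. A (f i) (f (p i)))"
      by (simp add: sign_map_permutation[OF inj p])
  qed
  also have "\<dots> = Determinant.det (mat n n (\<lambda>(i, j). A (f i) (f j)))"
  proof -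
    have "(\<Prod>i\<in>?U. A (f i) (f (p i))) = (\<Prod>i\<in>?U. mat n n (\<lambda>(i, j). A (f i) (f j)) $$ (i, p i))"
      if "p permutes ?U" for p
    proof (rule prod.cong[OF refl])
      fix i assume "i \<in> ?U"
      moreover from this have "p i \<in> ?U" using permutes_in_image[OF that] by blast
      ultimately show "A (f i) (f (p i)) = mat n n (\<lambda>(i, j). A (f i) (f j)) $$ (i, p i)" by simp
    qed
    thus ?thesis
      by (subst det_def'[where n = n]) (auto intro!: sum.cong)
  qed
  finally show ?thesis .
qed

lemma det_on_image:
  assumes "finite I" "inj_on g I"
  shows "det_on (g ` I) A = det_on I (\<lambda>i j. A (g i) (g j))"
proof -
  obtain f where f: "bij_betw f {0..<card I} I"
    using ex_bij_betw_nat_finite[OF assms(1)] by blast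
  have "bij_betw (g \<circ> f) {0..<card I} (g ` I)"
    using bij_betw_trans[OF f inj_on_imp_bij_betw[OF assms(2)]] .
  thus ?thesis by (simp add: det_on_reindex[OF f] det_on_reindex[of "g \<circ> f"])
qed

lemma det_on_mult:
  assumes "finite I"
  shows "det_on I (\<lambda>i j. \<Sum>k\<in>I. A i k * B k j) = det_on I A * det_on I B"
proof -
  define n where "n = card I"
  obtain f where f: "bij_betw f {0..<n} I"
    using ex_bij_betw_nat_finite[OF assms] unfolding n_def by blast
  let ?m = "\<lambda>A. mat n n (\<lambda>(i, j). A (f i) (f j))"
  have "?m (\<lambda>i j. \<Sum>k\<in>I. A i k * B k j) = ?m A * ?m B"
    by (rule eq_matI) (auto simp: scalar_prod_def sum.reindex_bij_betw[OF f, symmetric])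
  thus ?thesis
    by (simp add: det_on_reindex[OF f] det_mult[where n = n])
qed

text \<open>The kernel vector to which this is applied is the difference of two saddlepoints with
  the same mean.\<close>

lemma det_on_kernel:
  assumes "finite I" "\<And>i. i \<in> I \<Longrightarrow> (\<Sum>j\<in>I. A i j * v j) = 0" "j \<in> I" "v j \<noteq> 0"
  shows "det_on I A = 0"
proof -
  define n where "n = card I"
  obtain f where f: "bij_betw f {0..<n} I"
    using ex_bij_betw_nat_finite[OF assms(1)] unfolding n_def by blast
  let ?A = "mat n n (\<lambda>(i, j). A (f i) (f j))"
  let ?v = "vec n (\<lambda>i. v (f i))"
  obtain k where k: "k < n" "j = f k" using f assms(3) by (auto simp: bij_betw_def)
  have "?A *\<^sub>v ?v = 0\<^sub>v n"
  proof (rule eq_vecI)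
    fix i assume "i < dim_vec (0\<^sub>v n :: real vec)"
    hence i: "i < n" by simp
    hence "f i \<in> I" using f by (auto simp: bij_betw_def)
    thus "(?A *\<^sub>v ?v) $ i = 0\<^sub>v n $ i"
      using i assms(2)[of "f i"] by (simp add: scalar_prod_def sum.reindex_bij_betw[OF f, symmetric])
  qed simp
  moreover have "?v \<noteq> 0\<^sub>v n"
  proof
    assume "?v = 0\<^sub>v n"
    hence "?v $ k = 0\<^sub>v n $ k" by simp
    thus False using k assms(4) by simp
  qed
  moreover have "?A \<in> carrier_mat n n" "?v \<in> carrier_vec n" by auto
  ultimately show ?thesis
    unfolding det_on_reindex[OF f] using det_0_iff_vec_prod_zero_field[of ?A n] by blast
qed

lemma det_on_block_triangular:
  assumes "finite I" "finite J" "I \<inter> J = {}" "\<And>i j. i \<in> I \<Longrightarrow> j \<in> J \<Longrightarrow> A i j = 0"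
  shows "det_on (I \<union> J) A = det_on I A * det_on J A"
proof -
  define n where "n = card I"
  define m where "m = card J"
  obtain f where f: "bij_betw f {0..<n} I"
    using ex_bij_betw_nat_finite[OF assms(1)] unfolding n_def by blast
  obtain g where g: "bij_betw g {0..<m} J"
    using ex_bij_betw_nat_finite[OF assms(2)] unfolding m_def by blast
  \<comment> \<open>Enumerating \<open>I\<close> first and \<open>J\<close> afterwards turns the
    vanishing of \<open>A\<close> on \<open>I\<close> times \<open>J\<close> into a zero upper right
    block.\<close>
  define h where "h = (\<lambda>i. if i < n then f i else g (i - n))"
  have "bij_betw h ({0..<n} \<union> {n..<n + m}) (I \<union> J)"
  proof (rule bij_betw_combine)
    show "bij_betw h {0..<n} I"
      using f by (subst bij_betw_cong[of _ _ f]) (auto simp: h_def)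
    have "bij_betw (g \<circ> (\<lambda>i. i - n)) {n..<n + m} J"
    proof (rule bij_betw_trans[OF _ g])
      show "bij_betw (\<lambda>i. i - n) {n..<n + m} {0..<m}"
        by (rule bij_betwI[where g = "\<lambda>i. i + n"]) auto
    qed
    thus "bij_betw h {n..<n + m} J"
      by (subst bij_betw_cong[of _ _ "g \<circ> (\<lambda>i. i - n)"]) (auto simp: h_def)
    show "I \<inter> J = {}" by fact
  qed
  moreover have "{0..<n} \<union> {n..<n + m} = {0..<n + m}" by auto
  ultimately have h: "bij_betw h {0..<n + m} (I \<union> J)" by simp
  have hf: "f i \<in> I" if "i < n" for i using f that by (auto simp: bij_betw_def)
  have hg: "g i \<in> J" if "i < m" for i using g that by (auto simp: bij_betw_def)
  have "mat (n + m) (n + m) (\<lambda>(i, j). A (h i) (h j))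
      = four_block_mat (mat n n (\<lambda>(i, j). A (f i) (f j))) (0\<^sub>m n m)
          (mat m n (\<lambda>(i, j). A (g i) (f j))) (mat m m (\<lambda>(i, j). A (g i) (g j)))"
    by (rule eq_matI) (auto simp: h_def hf hg assms(4))
  thus ?thesis
    unfolding det_on_reindex[OF f] det_on_reindex[OF g] det_on_reindex[OF h]
    by (simp add: det_four_block_mat_upper_right_zero[where n = n and m = m])
qed

lemma det_on_cong:
  assumes "\<And>i j. i \<in> I \<Longrightarrow> j \<in> I \<Longrightarrow> A i j = B i j"
  shows "det_on I A = det_on I B"
  unfolding det_on_def
proof (rule sum.cong[OF refl])
  fix p assume "p \<in> {p. p permutes I}"
  hence "p i \<in> I" if "i \<in> I" for i using that permutes_in_image[of p I i] by simp
  thus "of_int (sign p) * (\<Prod>i\<in>I. A i (p i)) = of_int (sign p) * (\<Prod>i\<in>I. B i (p i))"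
    using assms by (simp cong: prod.cong)
qed

text \<open>An almost surely null coordinate has a zero row in the covariance matrix; this excludes
  it at a nondegenerate saddlepoint.\<close>

lemma det_on_zero_row:
  assumes "finite I" "i \<in> I" "\<And>j. j \<in> I \<Longrightarrow> A i j = 0"
  shows "det_on I A = 0"
  unfolding det_on_def
proof (rule sum.neutral, intro ballI)
  fix p assume "p \<in> {p. p permutes I}"
  hence "A i (p i) = 0" using assms(2,3) permutes_in_image[of p I i] by simp
  hence "(\<Prod>i\<in>I. A i (p i)) = 0" using assms(1,2) by (auto intro: prod_zero)
  thus "of_int (sign p) * (\<Prod>i\<in>I. A i (p i)) = 0" by simp
qed

lemma det_on_scale: "det_on I (\<lambda>i j. c * A i j) = c ^ card I * det_on I A"
  by (simp add: det_on_def prod.distrib sum_distrib_left mult_ac)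

lemma det_on_unit:
  assumes "finite I"
  shows "det_on I (\<lambda>i j. if i = j then 1 else 0) = 1"
proof -
  obtain f where f: "bij_betw f {0..<card I} I"
    using ex_bij_betw_nat_finite[OF assms] by blast
  have "mat (card I) (card I) (\<lambda>(i, j). if f i = f j then 1 else 0) = (1\<^sub>m (card I) :: real mat)"
    using f by (intro eq_matI) (auto simp: bij_betw_def inj_on_def)
  thus ?thesis by (simp add: det_on_reindex[OF f])
qed

text \<open>The block matrix \<open>((A, A G), (G\<^sup>T A, G\<^sup>T A G + B))\<close> is the product of
  \<open>((A, 0), (G\<^sup>T A, B))\<close> and \<open>((1, G), (0, 1))\<close>.\<close>

lemma det_on_block_congruence:
  fixes A B H :: "'i \<Rightarrow> 'i \<Rightarrow> real"
  assumes fin: "finite I" "finite J" and dis: "I \<inter> J = {}"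
    and II: "\<And>i j. i \<in> I \<Longrightarrow> j \<in> I \<Longrightarrow> H i j = A i j"
    and IJ: "\<And>i j. i \<in> I \<Longrightarrow> j \<in> J \<Longrightarrow> H i j = (\<Sum>k\<in>I. A i k * G k j)"
    and JI: "\<And>i j. i \<in> J \<Longrightarrow> j \<in> I \<Longrightarrow> H i j = (\<Sum>k\<in>I. G k i * A k j)"
    and JJ: "\<And>i j. i \<in> J \<Longrightarrow> j \<in> J \<Longrightarrow> H i j = (\<Sum>k\<in>I. (\<Sum>l\<in>I. G l i * A l k) * G k j) + B i j"
  shows "det_on (I \<union> J) H = det_on I A * det_on J B"
proof -
  define L where "L i j = (if i \<in> I then if j \<in> I then A i j else 0
      else if j \<in> I then (\<Sum>k\<in>I. G k i * A k j) else B i j)" for i j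
  define R where "R i j = (if i \<in> I \<and> j \<in> J then G i j else if i = j then 1 else 0)" for i j
  have nJ: "i \<notin> I" if "i \<in> J" for i using that dis by auto
  have nI: "i \<notin> J" if "i \<in> I" for i using that dis by auto
  have "det_on (I \<union> J) H = det_on (I \<union> J) (\<lambda>i j. \<Sum>k\<in>I\<union>J. L i k * R k j)"
  proof (rule det_on_cong)
    fix i j assume "i \<in> I \<union> J" "j \<in> I \<union> J"
    moreover have "(\<Sum>k\<in>I\<union>J. L i k * R k j) = (\<Sum>k\<in>I. L i k * R k j) + (\<Sum>k\<in>J. L i k * R k j)"
      by (rule sum.union_disjoint[OF fin dis])
    moreover have "(\<Sum>k\<in>I. L i k * R k j) = (\<Sum>k\<in>I. if k = j then L i j else 0)" if "j \<in> I"
      using that nI by (intro sum.cong) (auto simp: R_def)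
    moreover have "(\<Sum>k\<in>J. L i k * R k j) = (\<Sum>k\<in>J. 0)" if "j \<in> I"
      using that nI nJ by (intro sum.cong) (auto simp: R_def)
    moreover have "(\<Sum>k\<in>J. L i k * R k j) = (\<Sum>k\<in>J. if k = j then L i j else 0)" if "j \<in> J"
      using that nJ by (intro sum.cong) (auto simp: R_def)
    moreover have "(\<Sum>k\<in>I. L i k * R k j) = (\<Sum>k\<in>I. L i k * G k j)" if "j \<in> J"
      using that nJ by (intro sum.cong) (auto simp: R_def)
    ultimately show "H i j = (\<Sum>k\<in>I\<union>J. L i k * R k j)"
      using fin nI nJ by (auto simp: L_def II IJ JI JJ)
  qed
  also have "\<dots> = det_on (I \<union> J) L * det_on (I \<union> J) R"
    using fin by (intro det_on_mult) auto
  also have "det_on (I \<union> J) L = det_on I L * det_on J L"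
    using fin dis nJ by (intro det_on_block_triangular) (auto simp: L_def)
  also have "det_on I L = det_on I A" by (rule det_on_cong) (simp add: L_def)
  also have "det_on J L = det_on J B" using nJ by (intro det_on_cong) (simp add: L_def)
  \<comment> \<open>The zero block of \<open>R\<close> is on \<open>J\<close> times
    \<open>I\<close>, so the two index sets change places before
    \<open>det_on_block_triangular\<close> applies.\<close>
  also have "det_on (I \<union> J) R = det_on (J \<union> I) R" by (simp add: Un_commute)
  also have "\<dots> = det_on J R * det_on I R"
    using fin dis nI nJ by (intro det_on_block_triangular) (auto simp: R_def)
  also have "det_on J R = det_on J (\<lambda>i j. if i = j then 1 else 0)"
    using nJ by (intro det_on_cong) (simp add: R_def)
  also have "det_on I R = det_on I (\<lambda>i j. if i = j then 1 else 0)"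
    using nI by (intro det_on_cong) (simp add: R_def)
  finally show ?thesis by (simp add: det_on_unit fin)
qed

section \<open>Differentiation along curves\<close>

definition inner_on :: "'i set \<Rightarrow> ('i \<Rightarrow> real) \<Rightarrow> ('i \<Rightarrow> real) \<Rightarrow> real" where
  "inner_on I s v = (\<Sum>i\<in>I. s i * v i)"

text \<open>This norm is chosen because \<open>exp (\<epsilon> * l1_on I v)\<close> is the
  exponential of a linear form whose signs follow those of \<open>v\<close>. It is therefore bounded
  by a finite sum of exponentials of linear forms.\<close>

definition l1_on :: "'i set \<Rightarrow> ('i \<Rightarrow> real) \<Rightarrow> real" where
  "l1_on I v = (\<Sum>i\<in>I. \<bar>v i\<bar>)"

text \<open>Values outside \<open>I\<close> are unconstrained, which suits curves; the intersection
  with \<open>vec_space I\<close> is taken only where the topology enters.\<close>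

definition box_on :: "'i set \<Rightarrow> ('i \<Rightarrow> real) \<Rightarrow> real \<Rightarrow> ('i \<Rightarrow> real) set" where
  "box_on I p \<epsilon> = {q. \<forall>i\<in>I. \<bar>q i - p i\<bar> < \<epsilon>}"

lemma box_on_mono: "\<epsilon> \<le> \<delta> \<Longrightarrow> box_on I p \<epsilon> \<subseteq> box_on I p \<delta>"
  by (force simp: box_on_def)

lemma box_on_self: "0 < \<epsilon> \<Longrightarrow> p \<in> box_on I p \<epsilon>"
  by (simp add: box_on_def)

lemma box_on_trans: "q \<in> box_on I p \<delta> \<Longrightarrow> r \<in> box_on I q \<epsilon> \<Longrightarrow> r \<in> box_on I p (\<delta> + \<epsilon>)"
  by (force simp: box_on_def)

lemma l1_on_nonneg: "0 \<le> l1_on I v"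
  by (simp add: l1_on_def sum_nonneg)

lemma abs_le_l1_on: "finite I \<Longrightarrow> i \<in> I \<Longrightarrow> \<bar>v i\<bar> \<le> l1_on I v"
  unfolding l1_on_def by (rule member_le_sum) auto

lemma inner_on_diff_le:
  assumes "\<And>i. i \<in> I \<Longrightarrow> \<bar>q i - p i\<bar> \<le> \<delta>"
  shows "\<bar>inner_on I q v - inner_on I p v\<bar> \<le> \<delta> * l1_on I v"
proof -
  have "\<bar>inner_on I q v - inner_on I p v\<bar> = \<bar>\<Sum>i\<in>I. (q i - p i) * v i\<bar>"
    by (simp add: inner_on_def sum_subtractf left_diff_distrib)
  also have "\<dots> \<le> (\<Sum>i\<in>I. \<bar>(q i - p i) * v i\<bar>)" by (rule sum_abs)
  also have "\<dots> \<le> (\<Sum>i\<in>I. \<delta> * \<bar>v i\<bar>)"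
    using assms by (intro sum_mono) (auto simp: abs_mult intro: mult_right_mono)
  finally show ?thesis by (simp add: l1_on_def sum_distrib_left)
qed

lemma interior_of_powertop_real:
  assumes "finite I" "D \<subseteq> vec_space I"
  shows "s \<in> powertop_real I interior_of D \<longleftrightarrow>
    s \<in> vec_space I \<and> (\<exists>\<epsilon>>0. box_on I s \<epsilon> \<inter> vec_space I \<subseteq> D)"
proof
  assume "s \<in> powertop_real I interior_of D"
  then obtain U where U: "openin (powertop_real I) U" "s \<in> U" "U \<subseteq> D"
    by (auto simp: interior_of_def)
  then obtain A where A: "finite {i \<in> I. A i \<noteq> UNIV}" "\<And>i. i \<in> I \<Longrightarrow> open (A i)"
      "s \<in> Pi\<^sub>E I A" "Pi\<^sub>E I A \<subseteq> U"
    unfolding openin_product_topology_alt by auto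
  have "\<forall>i\<in>I. \<exists>e>0. \<forall>y. \<bar>y - s i\<bar> < e \<longrightarrow> y \<in> A i"
    using A(2,3) by (auto simp: open_real PiE_iff)
  then obtain e where e: "\<And>i. i \<in> I \<Longrightarrow> e i > 0"
      "\<And>i y. i \<in> I \<Longrightarrow> \<bar>y - s i\<bar> < e i \<Longrightarrow> y \<in> A i"
    by metis
  \<comment> \<open>The inserted \<open>1\<close> keeps the minimum meaningful when \<open>I\<close>
    is empty.\<close>
  define \<epsilon> where "\<epsilon> = Min (insert 1 (e ` I))"
  have "\<epsilon> > 0" using assms(1) e(1) by (simp add: \<epsilon>_def)
  moreover have "box_on I s \<epsilon> \<inter> vec_space I \<subseteq> Pi\<^sub>E I A"
  proof
    fix y assume y: "y \<in> box_on I s \<epsilon> \<inter> vec_space I"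
    have "y i \<in> A i" if "i \<in> I" for i
    proof (rule e(2)[OF that])
      have "\<epsilon> \<le> e i" using assms(1) that by (simp add: \<epsilon>_def)
      thus "\<bar>y i - s i\<bar> < e i" using y that by (force simp: box_on_def)
    qed
    thus "y \<in> Pi\<^sub>E I A" using y by (auto simp: PiE_iff)
  qed
  ultimately have "box_on I s \<epsilon> \<inter> vec_space I \<subseteq> D" using A(4) U(3) by (meson order_trans)
  moreover have "s \<in> vec_space I" using U(2,3) assms(2) by (meson subsetD)
  ultimately show "s \<in> vec_space I \<and> (\<exists>\<epsilon>>0. box_on I s \<epsilon> \<inter> vec_space I \<subseteq> D)"
    using \<open>\<epsilon> > 0\<close> by (intro conjI exI[of _ \<epsilon>]) simp_all
next
  assume R: "s \<in> vec_space I \<and> (\<exists>\<epsilon>>0. box_on I s \<epsilon> \<inter> vec_space I \<subseteq> D)"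
  then obtain \<epsilon> where \<epsilon>: "\<epsilon> > 0" "box_on I s \<epsilon> \<inter> vec_space I \<subseteq> D" by auto
  let ?U = "Pi\<^sub>E I (\<lambda>i. {s i - \<epsilon> <..< s i + \<epsilon>})"
  have "openin (powertop_real I) ?U"
    unfolding openin_PiE[OF assms(1)] by simp
  moreover have "?U \<subseteq> D"
  proof (rule subset_trans[OF _ \<epsilon>(2)], rule subsetI)
    fix y assume "y \<in> ?U"
    moreover from this have "y i - s i < \<epsilon>" "s i - y i < \<epsilon>" if "i \<in> I" for i
      using that by (auto dest!: PiE_mem[of _ _ _ i])
    ultimately show "y \<in> box_on I s \<epsilon> \<inter> vec_space I"
      by (auto simp: box_on_def PiE_iff abs_less_iff)
  qed
  moreover have "s \<in> ?U" using R \<epsilon>(1) by (auto simp: PiE_iff)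
  ultimately show "s \<in> powertop_real I interior_of D"
    unfolding interior_of_def by blast
qed

text \<open>Chain rule along curves that are differentiable at one point; it replaces total
  differentiability, which is not available on \<open>I \<rightarrow>\<^sub>E UNIV\<close>.\<close>

definition hadamard ::
    "'i set \<Rightarrow> (('i \<Rightarrow> real) \<Rightarrow> real) \<Rightarrow> ('i \<Rightarrow> real) \<Rightarrow> ('i \<Rightarrow> real) \<Rightarrow> bool" where
  "hadamard I f D p \<longleftrightarrow> (\<forall>c c' t\<^sub>0.
     (\<forall>i\<in>I. ((\<lambda>t. c t i) has_real_derivative c' i) (at t\<^sub>0) \<and> c t\<^sub>0 i = p i) \<longrightarrow>
     ((\<lambda>t. f (c t)) has_real_derivative (\<Sum>i\<in>I. D i * c' i)) (at t\<^sub>0))"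

lemma hadamardD:
  assumes "hadamard I f D p"
    "\<And>i. i \<in> I \<Longrightarrow> ((\<lambda>t. c t i) has_real_derivative c' i) (at t\<^sub>0)" "\<And>i. i \<in> I \<Longrightarrow> c t\<^sub>0 i = p i"
  shows "((\<lambda>t. f (c t)) has_real_derivative (\<Sum>i\<in>I. D i * c' i)) (at t\<^sub>0)"
  using assms(1)[unfolded hadamard_def, THEN spec[of _ c], THEN spec[of _ c'], THEN spec[of _ t\<^sub>0]]
    assms(2,3) by simp

lemma hadamard_subst:
  assumes "hadamard I f D p" "\<And>i. i \<in> I \<Longrightarrow> D i = D' i"
  shows "hadamard I f D' p"
proof -
  have "(\<Sum>i\<in>I. D' i * c' i) = (\<Sum>i\<in>I. D i * c' i)" for c'
    by (intro sum.cong) (simp_all add: assms(2))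
  thus ?thesis using assms(1) by (simp add: hadamard_def)
qed

lemma curve_box_on:
  assumes "finite I" "0 < \<epsilon>"
    "\<And>i. i \<in> I \<Longrightarrow> ((\<lambda>t. c t i) has_real_derivative c' i) (at t\<^sub>0)"
    "\<And>i. i \<in> I \<Longrightarrow> c t\<^sub>0 i = p i"
  shows "\<forall>\<^sub>F t in nhds t\<^sub>0. c t \<in> box_on I p \<epsilon>"
proof -
  have "\<forall>\<^sub>F t in nhds t\<^sub>0. \<bar>c t i - p i\<bar> < \<epsilon>" if "i \<in> I" for i
  proof -
    have "isCont (\<lambda>t. c t i) t\<^sub>0" using DERIV_isCont assms(3)[OF that] by blast
    hence "((\<lambda>t. c t i) \<longlongrightarrow> p i) (nhds t\<^sub>0)"
      using assms(4)[OF that] by (simp add: isCont_def tendsto_nhds_iff)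
    thus ?thesis using assms(2) by (simp add: tendsto_iff dist_real_def)
  qed
  hence "\<forall>\<^sub>F t in nhds t\<^sub>0. \<forall>i\<in>I. \<bar>c t i - p i\<bar> < \<epsilon>"
    using assms(1) by (simp add: eventually_ball_finite)
  thus ?thesis by (simp add: box_on_def)
qed

lemma hadamard_cong:
  assumes "finite I" "0 < \<epsilon>" "\<And>q. q \<in> box_on I p \<epsilon> \<Longrightarrow> f q = f' q" "hadamard I f' D p"
  shows "hadamard I f D p"
  unfolding hadamard_def
proof (intro allI impI)
  fix c c' t\<^sub>0 assume c: "\<forall>i\<in>I. ((\<lambda>t. c t i) has_real_derivative c' i) (at t\<^sub>0) \<and> c t\<^sub>0 i = p i"
  have "\<forall>\<^sub>F t in nhds t\<^sub>0. c t \<in> box_on I p \<epsilon>"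
    using assms(1,2) c by (intro curve_box_on) auto
  hence "\<forall>\<^sub>F t in nhds t\<^sub>0. f (c t) = f' (c t)"
    by eventually_elim (rule assms(3))
  thus "((\<lambda>t. f (c t)) has_real_derivative (\<Sum>i\<in>I. D i * c' i)) (at t\<^sub>0)"
    using hadamardD[OF assms(4), of c c' t\<^sub>0] c by (subst DERIV_cong_ev) auto
qed

lemma hadamard_partial_deriv:
  assumes "finite I" "hadamard I f D p" "i \<in> I"
  shows "partial_deriv i f p = D i"
proof -
  have "((\<lambda>t. f (p(i := t))) has_real_derivative (\<Sum>j\<in>I. D j * (if j = i then 1 else 0))) (at (p i))"
    by (rule hadamardD[OF assms(2)]) (auto intro!: derivative_eq_intros)
  moreover have "(\<Sum>j\<in>I. D j * (if j = i then 1 else 0)) = D i"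
    using assms(1,3) by (simp add: if_distrib cong: if_cong)
  ultimately show ?thesis unfolding partial_deriv_def by (metis DERIV_imp_deriv)
qed

lemma hadamard_const: "hadamard I (\<lambda>_. c) (\<lambda>_. 0) p"
  by (simp add: hadamard_def)

lemma hadamard_add:
  assumes "hadamard I f D p" "hadamard I g E p"
  shows "hadamard I (\<lambda>q. f q + g q) (\<lambda>i. D i + E i) p"
  unfolding hadamard_def
proof (intro allI impI)
  fix c c' t\<^sub>0 assume c: "\<forall>i\<in>I. ((\<lambda>t. c t i) has_real_derivative c' i) (at t\<^sub>0) \<and> c t\<^sub>0 i = p i"
  show "((\<lambda>t. f (c t) + g (c t)) has_real_derivative (\<Sum>i\<in>I. (D i + E i) * c' i)) (at t\<^sub>0)"
    unfolding distrib_right sum.distrib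
    by (intro DERIV_add hadamardD[OF assms(1)] hadamardD[OF assms(2)]) (use c in auto)
qed

lemma hadamard_cmult:
  assumes "hadamard I f D p"
  shows "hadamard I (\<lambda>q. a * f q) (\<lambda>i. a * D i) p"
  unfolding hadamard_def
proof (intro allI impI)
  fix c c' t\<^sub>0 assume c: "\<forall>i\<in>I. ((\<lambda>t. c t i) has_real_derivative c' i) (at t\<^sub>0) \<and> c t\<^sub>0 i = p i"
  show "((\<lambda>t. a * f (c t)) has_real_derivative (\<Sum>i\<in>I. a * D i * c' i)) (at t\<^sub>0)"
    unfolding mult.assoc sum_distrib_left[symmetric]
    by (intro DERIV_cmult hadamardD[OF assms(1)]) (use c in auto)
qed

text \<open>The gradient \<open>g\<close> is required on a whole box, since an iterated
  \<open>partial_deriv\<close> needs the inner derivative near \<open>p\<close>; the second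
  derivative is required at \<open>p\<close> alone. In \<open>h i j\<close> the outer derivative is
  in direction \<open>i\<close>, as in \<open>hessian\<close>.\<close>

definition twice_hadamard :: "'i set \<Rightarrow> (('i \<Rightarrow> real) \<Rightarrow> real) \<Rightarrow> ('i \<Rightarrow> ('i \<Rightarrow> real) \<Rightarrow> real) \<Rightarrow>
    ('i \<Rightarrow> 'i \<Rightarrow> real) \<Rightarrow> ('i \<Rightarrow> real) \<Rightarrow> bool" where
  "twice_hadamard I f g h p \<longleftrightarrow>
     (\<exists>\<epsilon>>0. \<forall>q\<in>box_on I p \<epsilon>. hadamard I f (\<lambda>i. g i q) q) \<and>
     (\<forall>j\<in>I. hadamard I (g j) (\<lambda>i. h i j) p)"

lemma twice_hadamard_first: "twice_hadamard I f g h p \<Longrightarrow> hadamard I f (\<lambda>i. g i p) p"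
  unfolding twice_hadamard_def using box_on_self[of _ p I] by auto

lemma twice_hadamard_cong:
  assumes "finite I" "0 < \<epsilon>" "\<And>q. q \<in> box_on I p \<epsilon> \<Longrightarrow> f q = f' q" "twice_hadamard I f' g h p"
  shows "twice_hadamard I f g h p"
proof -
  obtain \<delta> where \<delta>: "\<delta> > 0" "\<And>q. q \<in> box_on I p \<delta> \<Longrightarrow> hadamard I f' (\<lambda>i. g i q) q"
    using assms(4) unfolding twice_hadamard_def by blast
  \<comment> \<open>Halving leaves, around every point of the smaller box, a box of radius
    \<open>\<epsilon> / 2\<close> on which \<open>f\<close> and \<open>f'\<close> still
    agree.\<close>
  define r where "r = min \<delta> (\<epsilon> / 2)"
  have "hadamard I f (\<lambda>i. g i q) q" if "q \<in> box_on I p r" for q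
  proof (rule hadamard_cong[OF assms(1), where \<epsilon> = "\<epsilon> / 2"])
    show "hadamard I f' (\<lambda>i. g i q) q"
      using that box_on_mono[of r \<delta>] by (intro \<delta>) (auto simp: r_def)
    show "f q' = f' q'" if "q' \<in> box_on I q (\<epsilon> / 2)" for q'
    proof (rule assms(3))
      have "box_on I p (r + \<epsilon> / 2) \<subseteq> box_on I p \<epsilon>" by (rule box_on_mono) (simp add: r_def)
      thus "q' \<in> box_on I p \<epsilon>" using box_on_trans[OF \<open>q \<in> box_on I p r\<close> that] by blast
    qed
  qed (use assms(2) in auto)
  moreover have "r > 0" using \<delta>(1) assms(2) by (simp add: r_def)
  ultimately show ?thesis using assms(4) unfolding twice_hadamard_def by blast
qed

lemma twice_hadamard_partials:
  assumes "finite I" "twice_hadamard I f g h p" "i \<in> I" "j \<in> I"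
  shows "partial_deriv i f p = g i p" "partial_deriv i (partial_deriv j f) p = h i j"
proof -
  show "partial_deriv i f p = g i p"
    using hadamard_partial_deriv[OF assms(1) twice_hadamard_first[OF assms(2)] assms(3)] .
  obtain \<epsilon> where \<epsilon>: "\<epsilon> > 0" "\<And>q. q \<in> box_on I p \<epsilon> \<Longrightarrow> hadamard I f (\<lambda>i. g i q) q"
    using assms(2) unfolding twice_hadamard_def by blast
  have "hadamard I (partial_deriv j f) (\<lambda>i. h i j) p"
  proof (rule hadamard_cong[OF assms(1) \<epsilon>(1)])
    show "partial_deriv j f q = g j q" if "q \<in> box_on I p \<epsilon>" for q
      using hadamard_partial_deriv[OF assms(1) \<epsilon>(2)[OF that] assms(4)] .
    show "hadamard I (g j) (\<lambda>i. h i j) p"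
      using assms(2,4) unfolding twice_hadamard_def by blast
  qed
  thus "partial_deriv i (partial_deriv j f) p = h i j"
    by (rule hadamard_partial_deriv[OF assms(1) _ assms(3)])
qed

lemma twice_hadamard_add:
  assumes "twice_hadamard I f g h p" "twice_hadamard I f' g' h' p"
  shows "twice_hadamard I (\<lambda>q. f q + f' q) (\<lambda>i q. g i q + g' i q) (\<lambda>i j. h i j + h' i j) p"
proof -
  obtain \<epsilon> where \<epsilon>: "\<epsilon> > 0" "\<And>q. q \<in> box_on I p \<epsilon> \<Longrightarrow> hadamard I f (\<lambda>i. g i q) q"
    using assms(1) unfolding twice_hadamard_def by blast
  obtain \<delta> where \<delta>: "\<delta> > 0" "\<And>q. q \<in> box_on I p \<delta> \<Longrightarrow> hadamard I f' (\<lambda>i. g' i q) q"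
    using assms(2) unfolding twice_hadamard_def by blast
  have "\<forall>q\<in>box_on I p (min \<epsilon> \<delta>). hadamard I (\<lambda>q. f q + f' q) (\<lambda>i. g i q + g' i q) q"
    using \<epsilon>(2) \<delta>(2) box_on_mono[of "min \<epsilon> \<delta>" \<epsilon> I p] box_on_mono[of "min \<epsilon> \<delta>" \<delta> I p]
    by (auto intro!: hadamard_add)
  moreover have "min \<epsilon> \<delta> > 0" using \<epsilon> \<delta> by simp
  moreover have "\<forall>j\<in>I. hadamard I (\<lambda>q. g j q + g' j q) (\<lambda>i. h i j + h' i j) p"
    using assms unfolding twice_hadamard_def by (auto intro!: hadamard_add)
  ultimately show ?thesis unfolding twice_hadamard_def by blast
qed

lemma twice_hadamard_cmult:
  assumes "twice_hadamard I f g h p"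
  shows "twice_hadamard I (\<lambda>q. a * f q) (\<lambda>i q. a * g i q) (\<lambda>i j. a * h i j) p"
proof -
  obtain \<epsilon> where \<epsilon>: "\<epsilon> > 0" "\<And>q. q \<in> box_on I p \<epsilon> \<Longrightarrow> hadamard I f (\<lambda>i. g i q) q"
    using assms unfolding twice_hadamard_def by blast
  have "\<forall>q\<in>box_on I p \<epsilon>. hadamard I (\<lambda>q. a * f q) (\<lambda>i. a * g i q) q"
    by (intro ballI hadamard_cmult \<epsilon>(2))
  moreover have "\<forall>j\<in>I. hadamard I (\<lambda>q. a * g j q) (\<lambda>i. a * h i j) p"
    by (intro ballI hadamard_cmult) (use assms in \<open>simp add: twice_hadamard_def\<close>)
  ultimately show ?thesis unfolding twice_hadamard_def using \<epsilon>(1) by blast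
qed

lemma twice_hadamard_zero: "twice_hadamard I (\<lambda>_. 0) (\<lambda>_ _. 0) (\<lambda>_ _. 0) p"
  by (auto simp: twice_hadamard_def hadamard_const intro!: exI[of _ 1])

lemma twice_hadamard_sum:
  assumes "finite A" "\<And>a. a \<in> A \<Longrightarrow> twice_hadamard I (f a) (g a) (h a) p"
  shows "twice_hadamard I (\<lambda>q. \<Sum>a\<in>A. f a q) (\<lambda>i q. \<Sum>a\<in>A. g a i q) (\<lambda>i j. \<Sum>a\<in>A. h a i j) p"
  using assms
proof (induction A rule: finite_induct)
  case empty
  show ?case by (simp add: twice_hadamard_zero)
next
  case (insert a A)
  have "twice_hadamard I (\<lambda>q. f a q + (\<Sum>a\<in>A. f a q)) (\<lambda>i q. g a i q + (\<Sum>a\<in>A. g a i q))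
      (\<lambda>i j. h a i j + (\<Sum>a\<in>A. h a i j)) p"
    by (rule twice_hadamard_add) (use insert in auto)
  thus ?case using insert.hyps by simp
qed

section \<open>Moment generating functions in the interior of their domain\<close>

lemma abs_exp_minus_one_le: "\<bar>exp x - 1\<bar> \<le> \<bar>x\<bar> * exp \<bar>x\<bar>" for x :: real
proof (cases "0 \<le> x")
  case True
  have "1 + - x \<le> exp (- x)" by (rule exp_ge_add_one_self)
  hence "(1 - x) * exp x \<le> exp (- x) * exp x" by (intro mult_right_mono) auto
  also have "exp (- x) * exp x = 1" by (simp flip: exp_add)
  finally have "exp x - 1 \<le> x * exp x" by (simp add: algebra_simps)
  thus ?thesis using True by simp
next
  case False
  have "1 + x \<le> exp x" by (rule exp_ge_add_one_self)
  hence "1 - exp x \<le> - x" by linarith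
  also have "\<dots> \<le> - x * exp (- x)" using False mult_left_mono[of 1 "exp (- x)" "- x"] by simp
  finally show ?thesis using False by simp
qed

lemma le_exp_div: "0 < \<eta> \<Longrightarrow> 0 \<le> x \<Longrightarrow> x \<le> exp (\<eta> * x) / \<eta>" for x :: real
  using order_trans[OF _ exp_ge_add_one_self[of "\<eta> * x"], of "\<eta> * x"]
  by (simp add: pos_le_divide_eq mult.commute)

lemma mgf_inner: "mgf P I V s = (\<integral>\<^sup>+u. ennreal (exp (inner_on I s (V u))) \<partial>P)"
  by (simp add: mgf_def inner_on_def)

text \<open>Measurability is asked of the coordinates only, the form in which it is available for
  concatenated vectors.\<close>

locale random_vec = prob_space M for M :: "'w measure" +
  fixes I :: "'i set" and V :: "'w \<Rightarrow> 'i \<Rightarrow> real"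
  assumes finite_index: "finite I"
    and coord_measurable [measurable]: "\<And>i. i \<in> I \<Longrightarrow> (\<lambda>w. V w i) \<in> borel_measurable M"
begin

abbreviation tilt :: "('i \<Rightarrow> real) \<Rightarrow> 'w \<Rightarrow> real" where
  "tilt p w \<equiv> exp (inner_on I p (V w))"

abbreviation tilt_l1 :: "('i \<Rightarrow> real) \<Rightarrow> real \<Rightarrow> 'w \<Rightarrow> real" where
  "tilt_l1 p \<epsilon> w \<equiv> exp (inner_on I p (V w) + \<epsilon> * l1_on I (V w))"

text \<open>An integral form of \<open>p\<close> being interior to the domain. The single integrable
  function dominates all tilts by points of the box of radius \<open>\<epsilon>\<close>, and spare
  room in \<open>\<epsilon>\<close> absorbs polynomial factors in \<open>V\<close>.\<close>

definition regular :: "('i \<Rightarrow> real) \<Rightarrow> real \<Rightarrow> bool" where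
  "regular p \<epsilon> \<longleftrightarrow> integrable M (\<lambda>w. tilt_l1 p \<epsilon> w)"

lemma inner_measurable [measurable]: "(\<lambda>w. inner_on I p (V w)) \<in> borel_measurable M"
  unfolding inner_on_def by measurable

lemma l1_measurable [measurable]: "(\<lambda>w. l1_on I (V w)) \<in> borel_measurable M"
  unfolding l1_on_def by measurable

lemma mgf_pos: "0 < mgf M I V s"
proof -
  have "\<not> (AE w in M. ennreal (tilt s w) = 0)"
    by simp
  thus ?thesis unfolding mgf_inner by (subst zero_less_iff_neq_zero, subst nn_integral_0_iff_AE) auto
qed

lemma mgf_finite_iff: "mgf M I V s < \<infinity> \<longleftrightarrow> integrable M (\<lambda>w. tilt s w)"
  unfolding mgf_inner integrable_iff_bounded by simp

lemma mgf_integrable: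
  "integrable M (\<lambda>w. tilt s w) \<Longrightarrow>
   mgf M I V s = ennreal (expectation (\<lambda>w. tilt s w))"
  unfolding mgf_inner by (rule nn_integral_eq_integral) auto

lemma expectation_exp_pos:
  assumes "integrable M (\<lambda>w. tilt s w)"
  shows "0 < expectation (\<lambda>w. tilt s w)"
  using mgf_pos[of s] unfolding mgf_integrable[OF assms] by simp

lemma cgf_integrable:
  assumes "integrable M (\<lambda>w. tilt s w)"
  shows "cgf M I V s = ereal (ln (expectation (\<lambda>w. tilt s w)))"
  using assms expectation_exp_pos[OF assms] mgf_finite_iff[of s]
  by (simp add: cgf_def mgf_integrable)

lemma cgf_domain_iff:
  "s \<in> cgf_domain I (cgf M I V) \<longleftrightarrow> s \<in> vec_space I \<and> integrable M (\<lambda>w. tilt s w)"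
  using mgf_finite_iff[of s] by (auto simp: cgf_domain_def cgf_def)

lemma regular_box:
  assumes "regular p \<epsilon>" "q \<in> box_on I p \<delta>" "\<eta> + \<delta> \<le> \<epsilon>"
  shows "regular q \<eta>"
  unfolding regular_def
proof (rule Bochner_Integration.integrable_bound[OF assms(1)[unfolded regular_def]])
  have "inner_on I q (V w) + \<eta> * l1_on I (V w) \<le> inner_on I p (V w) + \<epsilon> * l1_on I (V w)" for w
  proof -
    have "inner_on I q (V w) - inner_on I p (V w) \<le> \<delta> * l1_on I (V w)"
      using inner_on_diff_le[of I q p \<delta> "V w"] assms(2) by (force simp: box_on_def)
    moreover have "(\<eta> + \<delta>) * l1_on I (V w) \<le> \<epsilon> * l1_on I (V w)"
      using assms(3) by (intro mult_right_mono l1_on_nonneg)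
    ultimately show ?thesis by (simp add: algebra_simps)
  qed
  thus "AE x in M. norm (exp (inner_on I q (V x) + \<eta> * l1_on I (V x)))
      \<le> norm (tilt_l1 p \<epsilon> x)" by simp
qed measurable

lemma regular_integrable: "regular p \<epsilon> \<Longrightarrow> 0 \<le> \<epsilon> \<Longrightarrow> integrable M (\<lambda>w. tilt p w)"
  unfolding regular_def
  by (erule Bochner_Integration.integrable_bound) (auto simp: l1_on_nonneg)

text \<open>At each outcome the integrand of \<open>regular\<close> is the tilt by one corner of a
  box around \<open>p\<close>, the corner having the signs of \<open>V\<close>. It is thus bounded
  by the sum over all corners, which is integrable. The corners are at distance
  \<open>\<epsilon> / 2\<close> so as to lie in the open box of radius
  \<open>\<epsilon>\<close>.\<close>

lemma regularI:
  assumes "0 < \<epsilon>" and box: "\<And>q. q \<in> vec_space I \<Longrightarrow> q \<in> box_on I p \<epsilon> \<Longrightarrow> integrable M (\<lambda>w. tilt q w)"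
  shows "regular p (\<epsilon> / 2)"
proof -
  define C where "C = (I \<rightarrow>\<^sub>E {- \<epsilon> / 2, \<epsilon> / 2})"
  let ?q = "\<lambda>\<sigma>. \<lambda>i\<in>I. p i + \<sigma> i"
  have fin: "finite C" unfolding C_def using finite_index by (intro finite_PiE) auto
  have "integrable M (\<lambda>w. \<Sum>\<sigma>\<in>C. tilt (?q \<sigma>) w)"
  proof (intro Bochner_Integration.integrable_sum box)
    fix \<sigma> assume "\<sigma> \<in> C"
    hence "\<sigma> i \<in> {- \<epsilon> / 2, \<epsilon> / 2}" if "i \<in> I" for i
      using that unfolding C_def by (rule PiE_mem)
    hence "\<bar>\<sigma> i\<bar> < \<epsilon>" if "i \<in> I" for i using that assms(1) by fastforce
    thus "?q \<sigma> \<in> box_on I p \<epsilon>" by (simp add: box_on_def)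
  qed auto
  thus ?thesis unfolding regular_def
  proof (rule Bochner_Integration.integrable_bound)
    have "exp (inner_on I p (V w) + \<epsilon> / 2 * l1_on I (V w)) \<le> (\<Sum>\<sigma>\<in>C. tilt (?q \<sigma>) w)" for w
    proof -
      define \<sigma> where "\<sigma> = (\<lambda>i\<in>I. if V w i < 0 then - \<epsilon> / 2 else \<epsilon> / 2)"
      have "inner_on I p (V w) + \<epsilon> / 2 * l1_on I (V w) = inner_on I (?q \<sigma>) (V w)"
        unfolding inner_on_def l1_on_def sum_distrib_left sum.distrib[symmetric]
        by (intro sum.cong) (auto simp: \<sigma>_def algebra_simps)
      moreover have "\<sigma> \<in> C" by (auto simp: \<sigma>_def C_def)
      ultimately show ?thesis using fin by (auto intro: member_le_sum)
    qed
    thus "AE x in M. norm (exp (inner_on I p (V x) + \<epsilon> / 2 * l1_on I (V x)))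
        \<le> norm (\<Sum>\<sigma>\<in>C. tilt (?q \<sigma>) x)"
      by (simp add: sum_nonneg)
  qed measurable
qed

lemma interior_cgf_domain:
  "s \<in> powertop_real I interior_of (cgf_domain I (cgf M I V)) \<longleftrightarrow>
   s \<in> vec_space I \<and> (\<exists>\<epsilon>>0. regular s \<epsilon>)"
proof -
  have sub: "cgf_domain I (cgf M I V) \<subseteq> vec_space I" by (auto simp: cgf_domain_def)
  have "(\<exists>\<epsilon>>0. box_on I s \<epsilon> \<inter> vec_space I \<subseteq> cgf_domain I (cgf M I V)) \<longleftrightarrow> (\<exists>\<epsilon>>0. regular s \<epsilon>)"
  proof
    assume "\<exists>\<epsilon>>0. box_on I s \<epsilon> \<inter> vec_space I \<subseteq> cgf_domain I (cgf M I V)"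
    then obtain \<epsilon> where "\<epsilon> > 0" "box_on I s \<epsilon> \<inter> vec_space I \<subseteq> cgf_domain I (cgf M I V)" by blast
    hence "regular s (\<epsilon> / 2)" by (intro regularI) (auto simp: cgf_domain_iff)
    thus "\<exists>\<epsilon>>0. regular s \<epsilon>" using \<open>\<epsilon> > 0\<close> half_gt_zero by blast
  next
    assume "\<exists>\<epsilon>>0. regular s \<epsilon>"
    then obtain \<epsilon> where \<epsilon>: "\<epsilon> > 0" "regular s \<epsilon>" by blast
    have "box_on I s \<epsilon> \<inter> vec_space I \<subseteq> cgf_domain I (cgf M I V)"
      using regular_integrable[OF regular_box[OF \<epsilon>(2), of _ \<epsilon> 0]] by (auto simp: cgf_domain_iff)
    thus "\<exists>\<epsilon>>0. box_on I s \<epsilon> \<inter> vec_space I \<subseteq> cgf_domain I (cgf M I V)" using \<epsilon>(1) by blast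
  qed
  thus ?thesis unfolding interior_of_powertop_real[OF finite_index sub] by simp
qed

lemma regular_integrable_mult:
  assumes "regular p \<epsilon>" "f \<in> borel_measurable M" "\<And>w. \<bar>f w\<bar> \<le> C * exp (\<eta> * l1_on I (V w))" "\<eta> \<le> \<epsilon>"
  shows "integrable M (\<lambda>w. f w * tilt p w)"
proof (rule Bochner_Integration.integrable_bound)
  show "integrable M (\<lambda>w. C * tilt_l1 p \<epsilon> w)"
    using assms(1) unfolding regular_def by (rule integrable_mult_right)
  have "\<bar>f w * tilt p w\<bar> \<le> \<bar>C * tilt_l1 p \<epsilon> w\<bar>" for w
  proof -
    have "0 \<le> C * exp (\<eta> * l1_on I (V w))" using assms(3)[of w] by (meson abs_ge_zero order_trans)
    hence C: "0 \<le> C" by (simp add: zero_le_mult_iff)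
    have "\<bar>f w\<bar> \<le> C * exp (\<epsilon> * l1_on I (V w))"
      using assms(3)[of w] C assms(4)
      by (elim order_trans) (auto intro!: mult_left_mono mult_right_mono l1_on_nonneg)
    hence "\<bar>f w\<bar> * tilt p w \<le> C * exp (\<epsilon> * l1_on I (V w)) * tilt p w"
      by (rule mult_right_mono) simp
    thus ?thesis using C by (simp add: abs_mult exp_add mult_ac)
  qed
  thus "AE x in M. norm (f x * tilt p x)
      \<le> norm (C * tilt_l1 p \<epsilon> x)" by simp
qed (use assms(2) in measurable)

text \<open>The domination of difference quotients of tilts. By \<open>abs_exp_minus_one_le\<close>
  the quotient grows like the l1 norm times an exponential; one \<open>\<delta>\<close> in the
  exponent pays for the exponential and a second one for the linear factor.\<close>

lemma exp_quotient_le: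
  assumes "\<And>i. i \<in> I \<Longrightarrow> \<bar>q i - p i\<bar> \<le> L * h" "0 \<le> L" "0 < h" "L * h \<le> \<delta>" "0 < \<delta>"
  shows "\<bar>exp (inner_on I q v) - exp (inner_on I p v)\<bar> / h
    \<le> L / \<delta> * exp (2 * \<delta> * l1_on I v) * exp (inner_on I p v)"
proof -
  define \<Delta> where "\<Delta> = inner_on I q v - inner_on I p v"
  let ?l = "l1_on I v"
  have l: "0 \<le> ?l" by (rule l1_on_nonneg)
  have D: "\<bar>\<Delta>\<bar> \<le> L * h * ?l" unfolding \<Delta>_def using assms(1) by (rule inner_on_diff_le)
  also have "\<dots> \<le> \<delta> * ?l" using assms(4) l by (rule mult_right_mono)
  finally have D': "\<bar>\<Delta>\<bar> \<le> \<delta> * ?l" .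
  have "\<bar>exp (inner_on I q v) - exp (inner_on I p v)\<bar> = \<bar>exp \<Delta> - 1\<bar> * exp (inner_on I p v)"
  proof -
    have "exp (inner_on I q v) - exp (inner_on I p v) = (exp \<Delta> - 1) * exp (inner_on I p v)"
      by (simp add: \<Delta>_def left_diff_distrib flip: exp_add)
    thus ?thesis by (simp add: abs_mult)
  qed
  also have "\<bar>exp \<Delta> - 1\<bar> \<le> \<bar>\<Delta>\<bar> * exp \<bar>\<Delta>\<bar>" by (rule abs_exp_minus_one_le)
  also have "\<dots> \<le> (L * h * ?l) * exp (\<delta> * ?l)"
    using D D' assms(2,3) l by (intro mult_mono) auto
  also have "\<dots> \<le> (L * h * (exp (\<delta> * ?l) / \<delta>)) * exp (\<delta> * ?l)"
    using assms(2,3) le_exp_div[OF assms(5) l] by (intro mult_right_mono mult_left_mono) auto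
  also have "\<dots> = h * (L / \<delta> * exp (2 * \<delta> * ?l))"
    by (simp add: mult_ac flip: exp_add)
  finally have "\<bar>exp (inner_on I q v) - exp (inner_on I p v)\<bar>
      \<le> h * (L / \<delta> * exp (2 * \<delta> * ?l)) * exp (inner_on I p v)"
    by (simp add: mult_right_mono)
  thus ?thesis using assms(3) by (simp add: field_simps)
qed

end

text \<open>The curve meets \<open>p\<close> only on the coordinates in \<open>I\<close>. The last
  assumption, that \<open>f\<close> depends on these coordinates alone, is what identifies
  \<open>f\<close> at the base point of the curve with \<open>f p\<close>.\<close>

lemma hadamard_comp:
  assumes "hadamard I f D p" "(\<phi> has_real_derivative \<phi>') (at (f p))"
    "\<And>q. (\<And>i. i \<in> I \<Longrightarrow> q i = p i) \<Longrightarrow> f q = f p"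
  shows "hadamard I (\<lambda>q. \<phi> (f q)) (\<lambda>i. \<phi>' * D i) p"
  unfolding hadamard_def
proof (intro allI impI)
  fix c c' t\<^sub>0 assume c: "\<forall>i\<in>I. ((\<lambda>t. c t i) has_real_derivative c' i) (at t\<^sub>0) \<and> c t\<^sub>0 i = p i"
  have "f (c t\<^sub>0) = f p" using c by (intro assms(3)) auto
  hence "((\<lambda>t. \<phi> (f (c t))) has_real_derivative \<phi>' * (\<Sum>i\<in>I. D i * c' i)) (at t\<^sub>0)"
    using hadamardD[OF assms(1), of c c' t\<^sub>0] c assms(2) by (intro DERIV_chain2[of \<phi> _ "\<lambda>t. f (c t)"]) auto
  thus "((\<lambda>t. \<phi> (f (c t))) has_real_derivative (\<Sum>i\<in>I. \<phi>' * D i * c' i)) (at t\<^sub>0)"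
    by (simp add: sum_distrib_left mult.assoc)
qed

lemma hadamard_divide:
  assumes "hadamard I f D p" "hadamard I g E p" "g p \<noteq> 0"
    "\<And>q. (\<And>i. i \<in> I \<Longrightarrow> q i = p i) \<Longrightarrow> f q = f p"
    "\<And>q. (\<And>i. i \<in> I \<Longrightarrow> q i = p i) \<Longrightarrow> g q = g p"
  shows "hadamard I (\<lambda>q. f q / g q) (\<lambda>i. D i / g p - f p * E i / (g p)\<^sup>2) p"
  unfolding hadamard_def
proof (intro allI impI)
  fix c c' t\<^sub>0 assume c: "\<forall>i\<in>I. ((\<lambda>t. c t i) has_real_derivative c' i) (at t\<^sub>0) \<and> c t\<^sub>0 i = p i"
  have eq: "f (c t\<^sub>0) = f p" "g (c t\<^sub>0) = g p" using c by (auto intro!: assms(4,5))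
  have "((\<lambda>t. f (c t) / g (c t)) has_real_derivative
      ((\<Sum>i\<in>I. D i * c' i) * g (c t\<^sub>0) - f (c t\<^sub>0) * (\<Sum>i\<in>I. E i * c' i)) / (g (c t\<^sub>0) * g (c t\<^sub>0))) (at t\<^sub>0)"
    using c assms(3) eq by (intro DERIV_divide hadamardD[OF assms(1)] hadamardD[OF assms(2)]) auto
  moreover have "((\<Sum>i\<in>I. D i * c' i) * g (c t\<^sub>0) - f (c t\<^sub>0) * (\<Sum>i\<in>I. E i * c' i)) / (g (c t\<^sub>0) * g (c t\<^sub>0))
      = (\<Sum>i\<in>I. (D i / g p - f p * E i / (g p)\<^sup>2) * c' i)"
  proof -
    have "(D i / g p - f p * E i / (g p)\<^sup>2) * c' i = (D i * c' i) / g p - (f p / (g p)\<^sup>2) * (E i * c' i)" for i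
      by (simp add: left_diff_distrib)
    hence "(\<Sum>i\<in>I. (D i / g p - f p * E i / (g p)\<^sup>2) * c' i)
        = (\<Sum>i\<in>I. D i * c' i) / g p - (f p / (g p)\<^sup>2) * (\<Sum>i\<in>I. E i * c' i)"
      by (simp add: sum_subtractf sum_divide_distrib sum_distrib_left)
    thus ?thesis using assms(3) eq by (simp add: field_simps power2_eq_square)
  qed
  ultimately show "((\<lambda>t. f (c t) / g (c t)) has_real_derivative
      (\<Sum>i\<in>I. (D i / g p - f p * E i / (g p)\<^sup>2) * c' i)) (at t\<^sub>0)" by simp
qed

lemma inner_on_cong: "(\<And>i. i \<in> I \<Longrightarrow> q i = p i) \<Longrightarrow> inner_on I q v = inner_on I p v"
  unfolding inner_on_def by (intro sum.cong) auto

section \<open>Tilted moments and the derivatives of the CGF\<close>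

context random_vec
begin

definition moment :: "('w \<Rightarrow> real) \<Rightarrow> ('i \<Rightarrow> real) \<Rightarrow> real" where
  "moment f p = expectation (\<lambda>w. f w * tilt p w)"

lemma moment_cong_index: "(\<And>i. i \<in> I \<Longrightarrow> q i = p i) \<Longrightarrow> moment f q = moment f p"
  unfolding moment_def using inner_on_cong[of I q p] by simp

text \<open>A coordinate factor costs an arbitrarily small increase of the exponential growth rate.
  The growth class of \<open>moment_hadamard\<close> is therefore stable under differentiation, and
  the lemma can be iterated.\<close>

lemma coord_times_le:
  assumes "\<And>w. \<bar>f w\<bar> \<le> C * exp (\<eta> * l1_on I (V w))" "0 < \<delta>" "i \<in> I"
  shows "\<bar>V w i * f w\<bar> \<le> C / \<delta> * exp ((\<eta> + \<delta>) * l1_on I (V w))"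
proof -
  have "\<bar>V w i\<bar> \<le> exp (\<delta> * l1_on I (V w)) / \<delta>"
    using abs_le_l1_on[OF finite_index assms(3), of "V w"] le_exp_div[OF assms(2) l1_on_nonneg[of I "V w"]]
    by linarith
  hence "\<bar>V w i\<bar> * \<bar>f w\<bar> \<le> (exp (\<delta> * l1_on I (V w)) / \<delta>) * (C * exp (\<eta> * l1_on I (V w)))"
    using assms(1,2) by (intro mult_mono) auto
  thus ?thesis by (simp add: abs_mult exp_add distrib_right mult_ac)
qed

text \<open>Differentiation under the integral sign: the difference quotients along the curve
  converge pointwise and are dominated because the growth rate \<open>\<eta>\<close> of
  \<open>f\<close> stays strictly below the margin \<open>\<epsilon>\<close>.\<close>

lemma moment_hadamard:
  assumes reg: "regular p \<epsilon>" and f: "f \<in> borel_measurable M"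
    and bound: "\<And>w. \<bar>f w\<bar> \<le> C * exp (\<eta> * l1_on I (V w))" and \<eta>: "\<eta> < \<epsilon>"
  shows "hadamard I (moment f) (\<lambda>i. moment (\<lambda>w. V w i * f w) p) p"
  unfolding hadamard_def
proof (intro allI impI)
  fix c c' and t\<^sub>0 :: real
  assume c: "\<forall>i\<in>I. ((\<lambda>t. c t i) has_real_derivative c' i) (at t\<^sub>0) \<and> c t\<^sub>0 i = p i"
  note [measurable] = f
  \<comment> \<open>\<open>exp_quotient_le\<close> consumes \<open>2 * \<delta>\<close>, which
    together with the rate \<open>\<eta>\<close> exhausts exactly the margin
    \<open>\<epsilon>\<close>.\<close>
  define \<delta> where "\<delta> = (\<epsilon> - \<eta>) / 2"
  have \<delta>: "\<delta> > 0" "\<eta> + 2 * \<delta> = \<epsilon>" using \<eta> by (auto simp: \<delta>_def field_simps)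
  \<comment> \<open>\<open>L\<close> strictly exceeds every speed \<open>\<bar>c' i\<bar>\<close>,
    so it bounds the difference quotients of all coordinates near the base time. The summand
    \<open>1\<close> also keeps it positive for empty \<open>I\<close>.\<close>
  define L where "L = 1 + (\<Sum>i\<in>I. \<bar>c' i\<bar>)"
  have L: "L > 0" unfolding L_def by (rule add_pos_nonneg) (auto intro: sum_nonneg)
  have C: "0 \<le> C"
  proof -
    obtain w where "w \<in> space M" using not_empty by blast
    have "0 \<le> C * exp (\<eta> * l1_on I (V w))" using bound[of w] by (meson abs_ge_zero order_trans)
    thus ?thesis by (simp add: zero_le_mult_iff)
  qed
  define Q where "Q t \<longleftrightarrow> (\<forall>i\<in>I. \<bar>c t i - p i\<bar> \<le> L * \<bar>t - t\<^sub>0\<bar>) \<and> L * \<bar>t - t\<^sub>0\<bar> \<le> \<delta> \<and> t \<noteq> t\<^sub>0" for t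
  have evQ: "\<forall>\<^sub>F t in at t\<^sub>0. Q t"
  proof -
    have "\<forall>\<^sub>F t in at t\<^sub>0. \<bar>c t i - p i\<bar> \<le> L * \<bar>t - t\<^sub>0\<bar>" if i: "i \<in> I" for i
    proof -
      have "((\<lambda>t. \<bar>(c t i - c t\<^sub>0 i) / (t - t\<^sub>0)\<bar>) \<longlongrightarrow> \<bar>c' i\<bar>) (at t\<^sub>0)"
        using c i by (intro tendsto_rabs) (auto simp: has_field_derivative_iff)
      moreover have "\<bar>c' i\<bar> < L"
        using member_le_sum[OF i, of "\<lambda>i. \<bar>c' i\<bar>"] finite_index by (simp add: L_def)
      ultimately have "\<forall>\<^sub>F t in at t\<^sub>0. \<bar>(c t i - c t\<^sub>0 i) / (t - t\<^sub>0)\<bar> < L"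
        by (rule order_tendstoD(2))
      moreover have "\<forall>\<^sub>F t in at t\<^sub>0. t \<noteq> t\<^sub>0" by (simp add: eventually_at_filter)
      ultimately show ?thesis
      proof eventually_elim
        case (elim t)
        thus ?case using c i by (simp add: abs_divide pos_divide_less_eq less_imp_le)
      qed
    qed
    hence "\<forall>\<^sub>F t in at t\<^sub>0. \<forall>i\<in>I. \<bar>c t i - p i\<bar> \<le> L * \<bar>t - t\<^sub>0\<bar>"
      using finite_index by (simp add: eventually_ball_finite)
    moreover have "\<forall>\<^sub>F t in at t\<^sub>0. L * \<bar>t - t\<^sub>0\<bar> \<le> \<delta>"
    proof -
      have "((\<lambda>t. L * \<bar>t - t\<^sub>0\<bar>) \<longlongrightarrow> L * \<bar>t\<^sub>0 - t\<^sub>0\<bar>) (at t\<^sub>0)" by (intro tendsto_intros)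
      hence "\<forall>\<^sub>F t in at t\<^sub>0. L * \<bar>t - t\<^sub>0\<bar> < \<delta>" by (rule order_tendstoD(2)) (use \<delta> in simp)
      thus ?thesis by (rule eventually_mono) simp
    qed
    moreover have "\<forall>\<^sub>F t in at t\<^sub>0. t \<noteq> t\<^sub>0" by (simp add: eventually_at_filter)
    ultimately show ?thesis unfolding Q_def by eventually_elim blast
  qed
  define G where "G t w = f w * ((tilt (c t) w - tilt p w) / (t - t\<^sub>0))" for t w
  define G' where "G' w = f w * ((\<Sum>i\<in>I. V w i * c' i) * tilt p w)" for w
  have int_p: "integrable M (\<lambda>w. f w * tilt p w)"
    using \<eta> by (intro regular_integrable_mult[OF reg f bound]) auto
  have quot: "(moment f (c t) - moment f (c t\<^sub>0)) / (t - t\<^sub>0) = expectation (G t)" if "Q t" for t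
  proof -
    have "c t \<in> box_on I p (2 * \<delta>)"
      using that \<delta> by (fastforce simp: Q_def box_on_def)
    hence "regular (c t) \<eta>" by (intro regular_box[OF reg]) (use \<delta> in auto)
    hence "integrable M (\<lambda>w. f w * tilt (c t) w)"
      by (intro regular_integrable_mult[OF _ f bound]) auto
    hence "moment f (c t) - moment f p
        = expectation (\<lambda>w. f w * tilt (c t) w - f w * tilt p w)"
      using int_p unfolding moment_def by simp
    moreover have "moment f (c t\<^sub>0) = moment f p" using c by (intro moment_cong_index) auto
    ultimately show ?thesis
      by (simp add: G_def[abs_def] right_diff_distrib[symmetric] flip: integral_divide_zero)
  qed
  have lim: "((\<lambda>t. G t w) \<longlongrightarrow> G' w) (at t\<^sub>0)" for w
  proof -
    have "((\<lambda>t. tilt (c t) w) has_real_derivative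
        tilt (c t\<^sub>0) w * (\<Sum>i\<in>I. c' i * V w i)) (at t\<^sub>0)"
      unfolding inner_on_def using c by (auto intro!: derivative_eq_intros)
    moreover have "inner_on I (c t\<^sub>0) (V w) = inner_on I p (V w)" using c by (intro inner_on_cong) auto
    ultimately show ?thesis
      unfolding G_def G'_def has_field_derivative_iff
      by (intro tendsto_mult tendsto_const) (simp add: mult.commute)
  qed
  define bnd where "bnd w = C * L / \<delta> * tilt_l1 p \<epsilon> w" for w
  have bnd: "integrable M bnd"
    using reg unfolding bnd_def regular_def by (rule integrable_mult_right)
  have dom: "\<bar>G t w\<bar> \<le> bnd w" if "Q t" for t w
  proof -
    have "\<bar>tilt (c t) w - tilt p w\<bar> / \<bar>t - t\<^sub>0\<bar>
        \<le> L / \<delta> * exp (2 * \<delta> * l1_on I (V w)) * tilt p w"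
      using that L \<delta> by (intro exp_quotient_le) (auto simp: Q_def)
    hence "\<bar>G t w\<bar> \<le> (C * exp (\<eta> * l1_on I (V w)))
        * (L / \<delta> * exp (2 * \<delta> * l1_on I (V w)) * tilt p w)"
      unfolding G_def abs_mult abs_divide using bound[of w] C by (intro mult_mono) auto
    also have "\<dots> = bnd w"
      unfolding bnd_def \<delta>(2)[symmetric] by (simp add: exp_add algebra_simps)
    finally show ?thesis .
  qed
  have "((\<lambda>t. (moment f (c t) - moment f (c t\<^sub>0)) / (t - t\<^sub>0)) \<longlongrightarrow> expectation G') (at t\<^sub>0)"
    unfolding tendsto_at_iff_sequentially comp_def
  proof (intro allI impI)
    fix X :: "nat \<Rightarrow> real" assume X: "\<forall>i. X i \<in> UNIV - {t\<^sub>0}" "X \<longlonglongrightarrow> t\<^sub>0"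
    hence Xat: "filterlim X (at t\<^sub>0) sequentially"
      by (auto simp: filterlim_at)
    have "\<forall>\<^sub>F n in sequentially. Q (X n)" using evQ Xat by (rule eventually_compose_filterlim)
    \<comment> \<open>Domination holds only eventually along the sequence, while dominated
      convergence is stated for all terms; the first \<open>m\<close> terms are dropped.\<close>
    then obtain m where m: "Q (X n)" if "n \<ge> m" for n by (auto simp: eventually_sequentially)
    have "(\<lambda>n. expectation (G (X (n + m)))) \<longlonglongrightarrow> expectation G'"
    proof (rule integral_dominated_convergence[where w = bnd])
      show "G' \<in> borel_measurable M" unfolding G'_def by measurable
      show "G (X (n + m)) \<in> borel_measurable M" for n unfolding G_def by measurable
      show "integrable M bnd" by (rule bnd)
      show "AE w in M. (\<lambda>n. G (X (n + m)) w) \<longlonglongrightarrow> G' w"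
        using filterlim_compose[OF lim Xat] by (intro AE_I2 LIMSEQ_ignore_initial_segment)
      show "AE w in M. norm (G (X (n + m)) w) \<le> bnd w" for n
        using dom[OF m] by simp
    qed
    hence "(\<lambda>n. (moment f (c (X (n + m))) - moment f (c t\<^sub>0)) / (X (n + m) - t\<^sub>0)) \<longlonglongrightarrow> expectation G'"
      by (simp add: quot m)
    thus "(\<lambda>n. (moment f (c (X n)) - moment f (c t\<^sub>0)) / (X n - t\<^sub>0)) \<longlonglongrightarrow> expectation G'"
      by (rule LIMSEQ_offset)
  qed
  moreover have "expectation G' = (\<Sum>i\<in>I. moment (\<lambda>w. V w i * f w) p * c' i)"
  proof -
    have "integrable M (\<lambda>w. V w i * f w * tilt p w)" if "i \<in> I" for i
      using \<delta> that by (intro regular_integrable_mult[OF reg _ coord_times_le[OF bound, of \<delta>]]) auto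
    hence "(\<Sum>i\<in>I. moment (\<lambda>w. V w i * f w) p * c' i)
        = expectation (\<lambda>w. \<Sum>i\<in>I. V w i * f w * tilt p w * c' i)"
      unfolding moment_def by (subst Bochner_Integration.integral_sum) auto
    also have "(\<lambda>w. \<Sum>i\<in>I. V w i * f w * tilt p w * c' i) = G'"
      unfolding G'_def by (simp add: sum_distrib_left sum_distrib_right mult_ac)
    finally show ?thesis by simp
  qed
  ultimately show "((\<lambda>t. moment f (c t)) has_real_derivative
      (\<Sum>i\<in>I. moment (\<lambda>w. V w i * f w) p * c' i)) (at t\<^sub>0)"
    unfolding has_field_derivative_iff by simp
qed

lemma cgf_regular:
  "regular p \<epsilon> \<Longrightarrow> 0 \<le> \<epsilon> \<Longrightarrow> cgf M I V p = ereal (ln (moment (\<lambda>_. 1) p))"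
  by (simp add: cgf_integrable regular_integrable moment_def)

lemma moment_one_pos: "regular p \<epsilon> \<Longrightarrow> 0 \<le> \<epsilon> \<Longrightarrow> 0 < moment (\<lambda>_. 1) p"
  using expectation_exp_pos[OF regular_integrable] by (simp add: moment_def)

definition tilted_mean :: "'i \<Rightarrow> ('i \<Rightarrow> real) \<Rightarrow> real" where
  "tilted_mean i p = moment (\<lambda>w. V w i) p / moment (\<lambda>_. 1) p"

definition tilted_cov :: "('i \<Rightarrow> real) \<Rightarrow> 'i \<Rightarrow> 'i \<Rightarrow> real" where
  "tilted_cov p i j = moment (\<lambda>w. V w i * V w j) p / moment (\<lambda>_. 1) p
     - moment (\<lambda>w. V w j) p * moment (\<lambda>w. V w i) p / (moment (\<lambda>_. 1) p)\<^sup>2"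

lemma abs_coord_le: "0 < \<delta> \<Longrightarrow> i \<in> I \<Longrightarrow> \<bar>V w i\<bar> \<le> 1 / \<delta> * exp (\<delta> * l1_on I (V w))"
  using coord_times_le[of "\<lambda>_. 1" 1 0 \<delta> i w] by simp

lemma twice_hadamard_cgf:
  assumes reg: "regular p \<epsilon>" and \<epsilon>: "0 < \<epsilon>"
  shows "twice_hadamard I (\<lambda>q. real_of_ereal (cgf M I V q)) tilted_mean (tilted_cov p) p"
proof -
  have h1: "hadamard I (moment (\<lambda>_. 1)) (\<lambda>i. moment (\<lambda>w. V w i) q) q" if "regular q \<delta>" "0 < \<delta>" for q \<delta>
    using moment_hadamard[OF that(1), of "\<lambda>_. 1" 1 0] that(2) by simp
  have "hadamard I (\<lambda>q. real_of_ereal (cgf M I V q)) (\<lambda>i. tilted_mean i q) q"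
    if q: "q \<in> box_on I p (\<epsilon> / 2)" for q
  proof -
    have rq: "regular q (\<epsilon> / 2)" using q by (intro regular_box[OF reg q]) simp
    have ln: "hadamard I (\<lambda>q. ln (moment (\<lambda>_. 1) q)) (\<lambda>i. inverse (moment (\<lambda>_. 1) q) * moment (\<lambda>w. V w i) q) q"
      using \<epsilon> moment_one_pos[OF rq] by (intro hadamard_comp h1[OF rq] moment_cong_index DERIV_ln) auto
    show ?thesis
    proof (rule hadamard_cong[OF finite_index, where \<epsilon> = "\<epsilon> / 2"])
      show "real_of_ereal (cgf M I V r) = ln (moment (\<lambda>_. 1) r)" if "r \<in> box_on I q (\<epsilon> / 2)" for r
        using cgf_regular[OF regular_box[OF rq that, of 0]] by simp
      show "hadamard I (\<lambda>q. ln (moment (\<lambda>_. 1) q)) (\<lambda>i. tilted_mean i q) q"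
        using ln by (rule hadamard_subst) (simp add: tilted_mean_def field_simps)
    qed (use \<epsilon> in auto)
  qed
  moreover have "hadamard I (tilted_mean j) (\<lambda>i. tilted_cov p i j) p" if j: "j \<in> I" for j
  proof -
    have "hadamard I (moment (\<lambda>w. V w j)) (\<lambda>i. moment (\<lambda>w. V w i * V w j) p) p"
      using \<epsilon> abs_coord_le[of "\<epsilon> / 2" j] j by (intro moment_hadamard[OF reg, of _ "1 / (\<epsilon> / 2)" "\<epsilon> / 2"]) auto
    thus ?thesis
      unfolding tilted_mean_def[abs_def] tilted_cov_def
      using \<epsilon> moment_one_pos[OF reg] by (intro hadamard_divide h1[OF reg] moment_cong_index) auto
  qed
  moreover have "\<epsilon> / 2 > 0" using \<epsilon> by simp
  ultimately show ?thesis unfolding twice_hadamard_def by blast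
qed

lemma cgf_gradient_hessian:
  assumes "regular p \<epsilon>" "0 < \<epsilon>" "i \<in> I"
  shows "gradient (cgf M I V) p i = tilted_mean i p"
    and "j \<in> I \<Longrightarrow> hessian (cgf M I V) p i j = tilted_cov p i j"
  using twice_hadamard_partials[OF finite_index twice_hadamard_cgf[OF assms(1,2)] assms(3)] assms(3)
  by (auto simp: gradient_def hessian_def)

text \<open>The shear has to map boxes into boxes, which calls for continuity uniform in all
  directions. It comes from a Lipschitz estimate of the MGF on boxes rather than from derivatives
  along curves.\<close>

lemma cgf_continuous:
  assumes reg: "regular p \<epsilon>" and \<epsilon>: "0 < \<epsilon>" and e: "0 < e"
  shows "\<exists>\<delta>>0. \<forall>q\<in>box_on I p \<delta>. \<bar>real_of_ereal (cgf M I V q) - real_of_ereal (cgf M I V p)\<bar> < e"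
proof -
  \<comment> \<open>The factor is that of \<open>exp_quotient_le\<close> for Lipschitz constant
    \<open>1\<close> and \<open>\<delta> = \<epsilon> / 2\<close>; doubling this
    \<open>\<delta>\<close> uses the whole margin.\<close>
  define B where "B = expectation (\<lambda>w. 2 / \<epsilon> * tilt_l1 p \<epsilon> w)"
  have intB: "integrable M (\<lambda>w. 2 / \<epsilon> * tilt_l1 p \<epsilon> w)"
    using reg unfolding regular_def by (rule integrable_mult_right)
  have B: "0 \<le> B" unfolding B_def using \<epsilon> by (intro integral_nonneg_AE) auto
  have lip: "\<bar>moment (\<lambda>_. 1) q - moment (\<lambda>_. 1) p\<bar> \<le> h * B"
    if q: "q \<in> box_on I p h" and h: "0 < h" "h \<le> \<epsilon> / 2" for q h
  proof -
    have iq: "integrable M (\<lambda>w. tilt q w)"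
      using \<epsilon> h by (intro regular_integrable[of _ 0] regular_box[OF reg q]) auto
    have ip: "integrable M (\<lambda>w. tilt p w)"
      using \<epsilon> by (intro regular_integrable[OF reg]) auto
    have "\<bar>moment (\<lambda>_. 1) q - moment (\<lambda>_. 1) p\<bar>
        = \<bar>expectation (\<lambda>w. tilt q w - tilt p w)\<bar>"
      using iq ip by (simp add: moment_def)
    also have "\<dots> \<le> expectation (\<lambda>w. \<bar>tilt q w - tilt p w\<bar>)"
      by (rule integral_abs_bound)
    also have "\<dots> \<le> expectation (\<lambda>w. h * (2 / \<epsilon> * tilt_l1 p \<epsilon> w))"
    proof (rule integral_mono)
      show "integrable M (\<lambda>w. \<bar>tilt q w - tilt p w\<bar>)"
        using iq ip by simp
      show "integrable M (\<lambda>w. h * (2 / \<epsilon> * tilt_l1 p \<epsilon> w))"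
        by (rule integrable_mult_right[OF intB])
      fix w
      have "\<bar>tilt q w - tilt p w\<bar> / h
          \<le> 1 / (\<epsilon> / 2) * exp (2 * (\<epsilon> / 2) * l1_on I (V w)) * tilt p w"
        using q h \<epsilon> by (intro exp_quotient_le) (auto simp: box_on_def less_imp_le)
      thus "\<bar>tilt q w - tilt p w\<bar>
          \<le> h * (2 / \<epsilon> * tilt_l1 p \<epsilon> w)"
        using h(1) by (simp add: pos_divide_le_eq exp_add mult_ac)
    qed
    also have "\<dots> = h * B" unfolding B_def by simp
    finally show ?thesis .
  qed
  have "isCont ln (moment (\<lambda>_. 1) p)" using moment_one_pos[OF reg] \<epsilon> by (intro isCont_ln) auto
  then obtain r where r: "r > 0" "\<And>y. \<bar>y - moment (\<lambda>_. 1) p\<bar> < r \<Longrightarrow> \<bar>ln y - ln (moment (\<lambda>_. 1) p)\<bar> < e"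
    using e unfolding continuous_at_eps_delta dist_real_def by metis
  \<comment> \<open>The first bound makes \<open>lip\<close> applicable and the second gives
    \<open>h * B < r\<close>; \<open>B + 1\<close> avoids a division by zero.\<close>
  define h where "h = min (\<epsilon> / 2) (r / (B + 1))"
  have "0 < h" unfolding h_def using \<epsilon> r(1) B by simp
  moreover have "h \<le> \<epsilon> / 2" unfolding h_def by (rule min.cobounded1)
  ultimately have h: "0 < h" "h \<le> \<epsilon> / 2" .
  have hB: "h * B < r"
  proof -
    have "h * (B + 1) \<le> r" using B by (simp add: h_def pos_le_divide_eq[symmetric])
    thus ?thesis using h(1) by (simp add: algebra_simps)
  qed
  have "\<bar>real_of_ereal (cgf M I V q) - real_of_ereal (cgf M I V p)\<bar> < e" if q: "q \<in> box_on I p h" for q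
  proof -
    have "regular q 0" using h \<epsilon> by (intro regular_box[OF reg q]) auto
    hence "cgf M I V q = ereal (ln (moment (\<lambda>_. 1) q))" by (rule cgf_regular) simp
    moreover have "cgf M I V p = ereal (ln (moment (\<lambda>_. 1) p))" using reg \<epsilon> by (intro cgf_regular) auto
    ultimately show ?thesis using r(2)[of "moment (\<lambda>_. 1) q"] lip[OF q h] hB by simp
  qed
  thus ?thesis using h(1) by blast
qed

section \<open>Positive means, null coordinates and the kernel of the tilted covariance\<close>

lemma regular_moments_integrable:
  assumes "regular p \<epsilon>" "0 < \<epsilon>" "i \<in> I"
  shows "integrable M (\<lambda>w. V w i * tilt p w)"
    and "j \<in> I \<Longrightarrow> integrable M (\<lambda>w. V w i * V w j * tilt p w)"
proof -
  show "integrable M (\<lambda>w. V w i * tilt p w)"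
    using assms(2,3) by (intro regular_integrable_mult[OF assms(1) _ abs_coord_le[of \<epsilon> i]]) auto
  show "integrable M (\<lambda>w. V w i * V w j * tilt p w)" if "j \<in> I"
    using assms(2,3) that
    by (intro regular_integrable_mult[OF assms(1) _ coord_times_le[OF abs_coord_le[of "\<epsilon> / 2" j], of "\<epsilon> / 2"]]) auto
qed

text \<open>An exponential tilt has the same null sets as \<open>M\<close>, so a nonnegative
  coordinate that is not almost surely zero keeps a positive mean.\<close>

lemma tilted_mean_pos:
  assumes "regular p \<epsilon>" "0 < \<epsilon>" "i \<in> I" "\<And>w. w \<in> space M \<Longrightarrow> 0 \<le> V w i" "\<not> (AE w in M. V w i = 0)"
  shows "0 < tilted_mean i p"
proof -
  have int: "integrable M (\<lambda>w. V w i * tilt p w)"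
    using regular_moments_integrable(1)[OF assms(1-3)] .
  have nn: "AE w in M. 0 \<le> V w i * tilt p w" using assms(4) by auto
  have "moment (\<lambda>w. V w i) p \<noteq> 0"
    unfolding moment_def using integral_nonneg_eq_0_iff_AE[OF int nn] assms(5) by simp
  moreover have "0 \<le> moment (\<lambda>w. V w i) p" unfolding moment_def using nn by (rule integral_nonneg_AE)
  ultimately show ?thesis using moment_one_pos[OF assms(1)] assms(2) by (simp add: tilted_mean_def)
qed

lemma tilted_cov_null:
  assumes "AE w in M. V w i = 0" "i \<in> I" "j \<in> I"
  shows "tilted_cov p i j = 0"
proof -
  have "moment (\<lambda>w. V w i) p = 0" unfolding moment_def
    by (rule integral_eq_zero_AE) (use assms(1) in auto)
  moreover have "moment (\<lambda>w. V w i * V w j) p = 0" unfolding moment_def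
    by (rule integral_eq_zero_AE) (use assms(1) in auto)
  ultimately show ?thesis by (simp add: tilted_cov_def)
qed

text \<open>Let \<open>a = (q - p) V\<close>. If the means of \<open>V\<close> under the exponential tilts by \<open>p\<close> and \<open>q\<close> agree, then \<open>a\<close> has
  the same mean \<open>c\<close> under both, so that \<open>(a - c) (e\<^sup>a - e\<^sup>c) \<ge> 0\<close> integrates to \<open>0\<close>; hence \<open>a\<close> is constant.\<close>

lemma tilted_cov_kernel:
  assumes p: "regular p \<epsilon>" "0 < \<epsilon>" and q: "regular q \<delta>" "0 < \<delta>"
    and eq: "\<And>i. i \<in> I \<Longrightarrow> tilted_mean i p = tilted_mean i q" and i: "i \<in> I"
  shows "(\<Sum>j\<in>I. tilted_cov p i j * (q j - p j)) = 0"
proof -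
  define a where "a w = (\<Sum>j\<in>I. V w j * (q j - p j))" for w
  define c where "c = (\<Sum>j\<in>I. tilted_mean j p * (q j - p j))"
  note int_p = regular_moments_integrable[OF p] and int_q = regular_moments_integrable[OF q]
  have int1_p: "integrable M (\<lambda>w. tilt p w)" using p by (intro regular_integrable) auto
  have int1_q: "integrable M (\<lambda>w. tilt q w)" using q by (intro regular_integrable) auto
  have "integrable M (\<lambda>w. \<Sum>j\<in>I. V w j * tilt p w * (q j - p j))"
    by (intro Bochner_Integration.integrable_sum integrable_mult_left int_p(1))
  moreover have "(\<lambda>w. \<Sum>j\<in>I. V w j * tilt p w * (q j - p j))
      = (\<lambda>w. a w * tilt p w)"
    unfolding a_def sum_distrib_right by (intro ext sum.cong refl) simp
  ultimately have a_p: "integrable M (\<lambda>w. a w * tilt p w)"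
    by simp
  have "integrable M (\<lambda>w. \<Sum>j\<in>I. V w j * tilt q w * (q j - p j))"
    by (intro Bochner_Integration.integrable_sum integrable_mult_left int_q(1))
  moreover have "(\<lambda>w. \<Sum>j\<in>I. V w j * tilt q w * (q j - p j))
      = (\<lambda>w. a w * tilt q w)"
    unfolding a_def sum_distrib_right by (intro ext sum.cong refl) simp
  ultimately have a_q: "integrable M (\<lambda>w. a w * tilt q w)"
    by simp
  have mean: "moment a r = c * moment (\<lambda>_. 1) r"
    if r: "\<And>j. j \<in> I \<Longrightarrow> tilted_mean j p = tilted_mean j r" "0 < moment (\<lambda>_. 1) r"
      "\<And>j. j \<in> I \<Longrightarrow> integrable M (\<lambda>w. V w j * tilt r w)" for r
  proof -
    have "moment a r = expectation (\<lambda>w. \<Sum>j\<in>I. (q j - p j) * (V w j * tilt r w))"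
      unfolding moment_def a_def sum_distrib_right
      by (intro Bochner_Integration.integral_cong sum.cong refl) simp
    also have "\<dots> = (\<Sum>j\<in>I. (q j - p j) * moment (\<lambda>w. V w j) r)"
      unfolding moment_def using r(3) by (subst Bochner_Integration.integral_sum) auto
    also have "\<dots> = (\<Sum>j\<in>I. tilted_mean j p * (q j - p j) * moment (\<lambda>_. 1) r)"
      using r(1,2) by (intro sum.cong) (auto simp: tilted_mean_def)
    finally show ?thesis by (simp add: c_def sum_distrib_right)
  qed
  have Mp: "moment a p = c * moment (\<lambda>_. 1) p"
    using p int_p(1) moment_one_pos[OF p(1)] by (intro mean) auto
  have Mq: "moment a q = c * moment (\<lambda>_. 1) q"
    using q int_q(1) moment_one_pos[OF q(1)] eq by (intro mean) auto
  define D where "D w = (a w - c) * (exp (a w) - exp c) * tilt p w" for w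
  have exp_q: "tilt q w = exp (a w) * tilt p w" for w
    by (simp add: a_def inner_on_def sum_subtractf right_diff_distrib mult.commute flip: exp_add)
  have D_eq: "D = (\<lambda>w. (a w * tilt q w - c * tilt q w)
      - exp c * (a w * tilt p w - c * tilt p w))"
    by (simp add: fun_eq_iff D_def exp_q algebra_simps)
  have D_int: "integrable M D" unfolding D_eq using a_p a_q int1_p int1_q by auto
  have "expectation D = (moment a q - c * moment (\<lambda>_. 1) q) - exp c * (moment a p - c * moment (\<lambda>_. 1) p)"
    unfolding D_eq moment_def using a_p a_q int1_p int1_q by simp
  hence D0: "expectation D = 0" by (simp add: Mp Mq)
  have D_nonneg: "0 \<le> D w" for w
    unfolding D_def by (cases "a w" c rule: linorder_cases) (auto simp: zero_le_mult_iff)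
  have "AE w in M. D w = 0" using D0 D_int D_nonneg by (subst (asm) integral_nonneg_eq_0_iff_AE) auto
  hence ac: "AE w in M. a w = c" by eventually_elim (auto simp: D_def)
  have M1: "0 < moment (\<lambda>_. 1) p" using p by (intro moment_one_pos[OF p(1)]) auto
  \<comment> \<open>Applied to \<open>q - p\<close>, the tilted covariance matrix gives the
    covariances of the coordinates with \<open>a\<close>. Since \<open>a\<close> is almost surely
    the constant \<open>c\<close>, the second moments collapse to \<open>c\<close> times first
    moments and cancel.\<close>
  have "(\<Sum>j\<in>I. moment (\<lambda>w. V w i * V w j) p * (q j - p j)) = moment (\<lambda>w. V w i * a w) p"
  proof -
    have "moment (\<lambda>w. V w i * a w) p
        = expectation (\<lambda>w. \<Sum>j\<in>I. V w i * V w j * tilt p w * (q j - p j))"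
      unfolding moment_def a_def sum_distrib_left sum_distrib_right
      by (intro Bochner_Integration.integral_cong sum.cong refl) simp
    also have "\<dots> = (\<Sum>j\<in>I. moment (\<lambda>w. V w i * V w j) p * (q j - p j))"
      unfolding moment_def using int_p(2)[OF i] by (subst Bochner_Integration.integral_sum) auto
    finally show ?thesis by simp
  qed
  also have "\<dots> = expectation (\<lambda>w. c * (V w i * tilt p w))"
    unfolding moment_def
  proof (rule integral_cong_AE)
    show "AE w in M. V w i * a w * tilt p w = c * (V w i * tilt p w)"
      using ac by eventually_elim simp
    have [measurable]: "(\<lambda>w. V w i) \<in> borel_measurable M" using i by (rule coord_measurable)
    have [measurable]: "a \<in> borel_measurable M" unfolding a_def by measurable
    show "(\<lambda>w. V w i * a w * tilt p w) \<in> borel_measurable M"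
      "(\<lambda>w. c * (V w i * tilt p w)) \<in> borel_measurable M" by measurable
  qed
  finally have E2: "(\<Sum>j\<in>I. moment (\<lambda>w. V w i * V w j) p * (q j - p j)) = c * moment (\<lambda>w. V w i) p"
    by (simp add: moment_def)
  have "tilted_cov p i j * (q j - p j) = moment (\<lambda>w. V w i * V w j) p * (q j - p j) / moment (\<lambda>_. 1) p
      - tilted_mean j p * (q j - p j) * (moment (\<lambda>w. V w i) p / moment (\<lambda>_. 1) p)" for j
    using M1 by (simp add: tilted_cov_def tilted_mean_def power2_eq_square field_simps)
  hence "(\<Sum>j\<in>I. tilted_cov p i j * (q j - p j))
      = (\<Sum>j\<in>I. moment (\<lambda>w. V w i * V w j) p * (q j - p j)) / moment (\<lambda>_. 1) p
        - c * (moment (\<lambda>w. V w i) p / moment (\<lambda>_. 1) p)"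
    by (simp add: sum_subtractf c_def sum_divide_distrib sum_distrib_right)
  thus ?thesis by (simp add: E2)
qed

end

section \<open>Moment generating functions of compounding processes\<close>

text \<open>Cauchy's functional equation on the half-line with a one-sided local bound.
  \<open>g\<close> vanishes at rationals, so subtracting a rational carries the lower bound from
  \<open>[0, \<delta>]\<close> to all times. A negative value would violate it after multiplication
  by a large integer, hence \<open>g\<close> is nonnegative; as \<open>g t\<close> and
  \<open>g (n - t)\<close> add up to \<open>0\<close>, both vanish.\<close>

lemma nonneg_additive_bounded_below:
  fixes g :: "real \<Rightarrow> real"
  assumes add: "\<And>r t. 0 \<le> r \<Longrightarrow> 0 \<le> t \<Longrightarrow> g (r + t) = g r + g t"
    and one: "g 1 = 0" and \<delta>: "0 < \<delta>" and lower: "\<And>t. 0 \<le> t \<Longrightarrow> t \<le> \<delta> \<Longrightarrow> - C \<le> g t"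
    and t: "0 \<le> t"
  shows "g t = 0"
proof -
  have zero: "g 0 = 0" using add[of 0 0] by simp
  have mult: "g (of_nat n * r) = of_nat n * g r" if "0 \<le> r" for n r
  proof (induction n)
    case (Suc n)
    have "g (of_nat (Suc n) * r) = g (r + of_nat n * r)" by (simp add: algebra_simps)
    also have "\<dots> = g r + g (of_nat n * r)" using that by (intro add) auto
    finally show ?case using Suc by (simp add: algebra_simps)
  qed (simp add: zero)
  have rat: "g (of_nat m / of_nat n) = 0" if "0 < n" for m n :: nat
  proof -
    have "of_nat n * g (of_nat m / of_nat n) = g (of_nat n * (of_nat m / of_nat n))"
      by (rule mult[symmetric]) simp
    also have "\<dots> = g (of_nat m * 1)" using that by simp
    also have "\<dots> = 0" by (subst mult) (auto simp: one)
    finally show ?thesis using that by simp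
  qed
  have lower': "- C \<le> g r" if r: "0 \<le> r" for r
  proof -
    obtain n :: nat where n: "0 < n" "inverse (of_nat n) < \<delta>" using ex_inverse_of_nat_less[OF \<delta>] by blast
    define k where "k = nat \<lfloor>r * of_nat n\<rfloor>"
    define u where "u = r - of_nat k / of_nat n"
    have "of_nat k \<le> r * of_nat n" "r * of_nat n < of_nat k + 1"
      using r by (auto simp: k_def intro: floor_correct)
    moreover have "u * of_nat n = r * of_nat n - of_nat k" using n(1) by (simp add: u_def left_diff_distrib)
    ultimately have un: "0 \<le> u * of_nat n" "u * of_nat n < 1" by simp_all
    have u: "0 \<le> u" "u < inverse (of_nat n)"
      using un n(1) by (simp_all add: zero_le_mult_iff inverse_eq_divide pos_less_divide_eq)
    have "g r = g (of_nat k / of_nat n + u)" by (simp add: u_def)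
    also have "\<dots> = g u" using u(1) rat[OF n(1)] by (subst add) auto
    finally show ?thesis using lower[of u] u n(2) by simp
  qed
  have nonneg: "0 \<le> g r" if r: "0 \<le> r" for r
  proof (rule ccontr)
    assume "\<not> 0 \<le> g r"
    then obtain n :: nat where "C < of_nat n * (- g r)"
      using ex_less_of_nat_mult[of "- g r" C] by auto
    moreover have "- C \<le> of_nat n * g r" using lower'[of "of_nat n * r"] mult[OF r, of n] r by simp
    ultimately show False by simp
  qed
  obtain n :: nat where n: "t \<le> of_nat n" using real_arch_simple by blast
  have "g t + g (of_nat n - t) = g (of_nat n * 1)" using t n by (subst add[symmetric]) auto
  also have "\<dots> = 0" by (subst mult) (auto simp: one)
  finally show ?thesis using nonneg[OF t] nonneg[of "of_nat n - t"] n by simp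
qed

text \<open>Only a lower bound near time \<open>0\<close> is assumed, because stochastic continuity
  bounds an MGF from below but not from above. In the finite case the logarithm minus its linear
  interpolation between \<open>0\<close> and \<open>1\<close> is additive and bounded below on a
  short interval. In the infinite case the value at \<open>1/n\<close> is already infinite, for
  every \<open>n\<close>, and the remaining factor is positive.\<close>

lemma mult_ennreal:
  fixes \<phi> :: "real \<Rightarrow> ennreal"
  assumes mult: "\<And>r t. 0 \<le> r \<Longrightarrow> 0 \<le> t \<Longrightarrow> \<phi> (r + t) = \<phi> r * \<phi> t"
    and zero: "\<phi> 0 = 1" and pos: "\<And>t. 0 \<le> t \<Longrightarrow> 0 < \<phi> t"
    and \<delta>: "0 < \<delta>" and c: "0 < c" and lower: "\<And>t. 0 \<le> t \<Longrightarrow> t \<le> \<delta> \<Longrightarrow> ennreal c \<le> \<phi> t"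
  shows "\<phi> 1 < \<infinity> \<Longrightarrow> 0 \<le> t \<Longrightarrow> \<phi> t = ennreal (exp (t * ln (enn2real (\<phi> 1))))"
    and "\<phi> 1 = \<infinity> \<Longrightarrow> 0 < t \<Longrightarrow> \<phi> t = \<infinity>"
proof -
  have pow: "\<phi> (of_nat n * r) = \<phi> r ^ n" if "0 \<le> r" for n r
  proof (induction n)
    case (Suc n)
    have "\<phi> (of_nat (Suc n) * r) = \<phi> (r + of_nat n * r)" by (simp add: algebra_simps)
    also have "\<dots> = \<phi> r * \<phi> (of_nat n * r)" using that by (intro mult) auto
    finally show ?case using Suc by simp
  qed (simp add: zero)
  show "\<phi> t = \<infinity>" if inf: "\<phi> 1 = \<infinity>" and tpos: "0 < t"
  proof -
    obtain n :: nat where n: "0 < n" "inverse (of_nat n) < t" using ex_inverse_of_nat_less[OF tpos] by blast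
    have "\<phi> (inverse (of_nat n)) ^ n = \<phi> (of_nat n * inverse (of_nat n))" by (rule pow[symmetric]) simp
    also have "\<dots> = \<infinity>" using inf n by simp
    finally have "\<phi> (inverse (of_nat n)) = \<infinity>" by (simp add: power_eq_top_ennreal)
    moreover have "\<phi> t = \<phi> (inverse (of_nat n)) * \<phi> (t - inverse (of_nat n))"
      using n by (subst mult[symmetric]) auto
    ultimately show ?thesis using pos[of "t - inverse (of_nat n)"] n by (simp add: ennreal_top_mult)
  qed
  assume fin: "\<phi> 1 < \<infinity>"
  have finite: "\<phi> r < \<infinity>" if r: "0 \<le> r" for r
  proof (rule ccontr)
    assume "\<not> \<phi> r < \<infinity>"
    hence inf: "\<phi> r = \<infinity>" by (simp add: less_top[symmetric])
    obtain n :: nat where n: "r \<le> of_nat n" using real_arch_simple by blast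
    have "\<phi> r * \<phi> (of_nat n - r) = \<phi> (of_nat n * 1)" using r n by (subst mult[symmetric]) auto
    also have "\<dots> = \<phi> 1 ^ n" by (rule pow) simp
    also have "\<dots> < \<infinity>" using fin by (simp add: less_top[symmetric] power_eq_top_ennreal)
    finally show False using inf pos[of "of_nat n - r"] n by (simp add: ennreal_top_mult split: if_splits)
  qed
  define f where "f r = ln (enn2real (\<phi> r))" for r
  have rpos: "0 < enn2real (\<phi> r)" if "0 \<le> r" for r
    using finite[OF that] pos[OF that] by (simp add: enn2real_positive_iff)
  have \<phi>_eq: "\<phi> r = ennreal (exp (f r))" if "0 \<le> r" for r
    using rpos[OF that] finite[OF that] by (simp add: f_def)
  have f_add: "f (r + u) = f r + f u" if "0 \<le> r" "0 \<le> u" for r u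
    using that rpos[of r] rpos[of u] by (simp add: f_def mult enn2real_mult ln_mult)
  assume t: "0 \<le> t"
  have "f t - t * f 1 = 0"
  proof (rule nonneg_additive_bounded_below[where g = "\<lambda>t. f t - t * f 1"])
    show "f (r + u) - (r + u) * f 1 = f r - r * f 1 + (f u - u * f 1)" if "0 \<le> r" "0 \<le> u" for r u
      using f_add[OF that] by (simp add: algebra_simps)
    show "- (\<bar>ln c\<bar> + \<delta> * \<bar>f 1\<bar>) \<le> f u - u * f 1" if u: "0 \<le> u" "u \<le> \<delta>" for u
    proof -
      have "c \<le> enn2real (\<phi> u)"
        using lower[OF u] finite[OF u(1)] c by (metis enn2real_ennreal enn2real_mono infinity_ennreal_def less_imp_le)
      hence "ln c \<le> f u" using c unfolding f_def by (intro ln_mono) auto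
      moreover have "u * f 1 \<le> \<delta> * \<bar>f 1\<bar>" using u mult_left_mono[OF abs_ge_self[of "f 1"] u(1)] mult_right_mono[OF u(2), of "\<bar>f 1\<bar>"] by simp
      ultimately show ?thesis by linarith
    qed
  qed (use \<delta> t in auto)
  hence "\<phi> t = ennreal (exp (t * f 1))" using \<phi>_eq[OF t] by simp
  thus "\<phi> t = ennreal (exp (t * ln (enn2real (\<phi> 1))))" unfolding f_def .
qed

section \<open>Random walks, Levy processes and drifts at a fixed time\<close>

lemma inner_on_measurable [measurable]: "inner_on I s \<in> borel_measurable (vec_algebra I)"
proof -
  have "(\<lambda>v. \<Sum>i\<in>I. s i * v i) \<in> borel_measurable (vec_algebra I)" by measurable
  thus ?thesis by (simp add: inner_on_def[abs_def])
qed

lemma (in prob_space) indep_vars_mgf: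
  assumes "indep_vars (\<lambda>_. vec_algebra I) Y A" "finite A"
  shows "(\<integral>\<^sup>+u. (\<Prod>j\<in>A. ennreal (exp (inner_on I s (Y j u)))) \<partial>M) = (\<Prod>j\<in>A. mgf M I (Y j) s)"
  unfolding mgf_inner
proof (rule indep_vars_nn_integral[OF assms(2)])
  show "indep_vars (\<lambda>_. borel) (\<lambda>j u. ennreal (exp (inner_on I s (Y j u)))) A"
    by (rule indep_vars_compose2[OF assms(1), of "\<lambda>_ v. ennreal (exp (inner_on I s v))"]) measurable
qed simp

lemma mgf_distr:
  assumes "V \<in> P \<rightarrow>\<^sub>M vec_algebra I"
  shows "mgf P I V s = (\<integral>\<^sup>+v. ennreal (exp (inner_on I s v)) \<partial>distr P (vec_algebra I) V)"
  unfolding mgf_inner by (rule nn_integral_distr[OF assms, symmetric]) measurable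

lemma random_vecI:
  assumes "prob_space P" "finite I" "V \<in> P \<rightarrow>\<^sub>M vec_algebra I"
  shows "random_vec P I V"
proof -
  interpret prob_space P by fact
  show ?thesis
  proof
    show "(\<lambda>u. V u i) \<in> borel_measurable P" if "i \<in> I" for i
      using measurable_compose[OF assms(3) measurable_component_singleton[OF that]] .
  qed fact
qed

text \<open>The power of \<open>\<phi>\<close> with exponent \<open>t\<close>. An infinite base
  gives \<open>1\<close> at \<open>t = 0\<close>, which corresponds to the convention
  \<open>0 * \<infinity> = 0\<close> in \<open>cgf_step\<close>. Negative times arise only for
  linear drifts, where \<open>\<phi>\<close> is finite.\<close>

definition mgf_at_time :: "ennreal \<Rightarrow> real \<Rightarrow> ennreal" where
  "mgf_at_time \<phi> t =
     (if t = 0 then 1 else if \<phi> < \<infinity> then ennreal (exp (t * ln (enn2real \<phi>))) else \<infinity>)"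

lemma random_walk_mgf:
  assumes "prob_space P" "random_walk P I Z" "finite I"
  shows "Z (of_nat t) \<in> P \<rightarrow>\<^sub>M vec_algebra I"
    and "mgf P I (Z (of_nat t)) s = mgf_at_time (mgf P I (Z 1) s) (of_nat t)"
proof -
  interpret prob_space P by fact
  obtain Y :: "nat \<Rightarrow> 'a \<Rightarrow> 'b \<Rightarrow> real"
    where Y: "indep_vars (\<lambda>_. vec_algebra I) Y {1..}"
      "\<And>j. j \<ge> 1 \<Longrightarrow> distr P (vec_algebra I) (Y j) = distr P (vec_algebra I) (Y 1)"
      "\<And>t u. u \<in> space P \<Longrightarrow> Z (of_nat t) u = vec_sum I {1..t} (\<lambda>j. Y j u)"
    using assms(2) unfolding random_walk_def by metis
  have meas: "Y j \<in> P \<rightarrow>\<^sub>M vec_algebra I" if "j \<ge> 1" for j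
    using Y(1) that unfolding indep_vars_def by auto
  have coord: "(\<lambda>u. Y j u i) \<in> borel_measurable P" if "j \<ge> 1" "i \<in> I" for i j
    using measurable_compose[OF meas[OF that(1)] measurable_component_singleton[OF that(2)]] .
  show "Z (of_nat t) \<in> P \<rightarrow>\<^sub>M vec_algebra I"
  proof (subst measurable_cong[OF Y(3)])
    show "(\<lambda>u. vec_sum I {1..t} (\<lambda>j. Y j u)) \<in> P \<rightarrow>\<^sub>M vec_algebra I"
      unfolding vec_sum_def by (intro measurable_restrict borel_measurable_sum coord) auto
  qed
  have pow: "mgf P I (Z (of_nat t)) s = mgf P I (Y 1) s ^ t" for t :: nat
  proof -
    have "mgf P I (Z (of_nat t)) s = (\<integral>\<^sup>+u. (\<Prod>j\<in>{1..t}. ennreal (exp (inner_on I s (Y j u)))) \<partial>P)"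
      unfolding mgf_inner
    proof (rule nn_integral_cong)
      fix u assume "u \<in> space P"
      hence "inner_on I s (Z (of_nat t) u) = (\<Sum>i\<in>I. \<Sum>j\<in>{1..t}. s i * Y j u i)"
        unfolding inner_on_def by (subst Y(3)) (auto simp: vec_sum_def sum_distrib_left)
      also have "\<dots> = (\<Sum>j\<in>{1..t}. inner_on I s (Y j u))"
        unfolding inner_on_def by (rule sum.swap)
      finally show "ennreal (exp (inner_on I s (Z (of_nat t) u)))
          = (\<Prod>j\<in>{1..t}. ennreal (exp (inner_on I s (Y j u))))"
        by (simp add: exp_sum prod_ennreal)
    qed
    also have "\<dots> = (\<Prod>j\<in>{1..t}. mgf P I (Y j) s)"
      by (rule indep_vars_mgf[OF indep_vars_subset[OF Y(1)]]) auto
    also have "\<dots> = (\<Prod>j\<in>{1..t}. mgf P I (Y 1) s)"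
    proof (rule prod.cong[OF refl])
      fix j assume "j \<in> {1..t}"
      hence "j \<ge> 1" by simp
      show "mgf P I (Y j) s = mgf P I (Y 1) s"
        unfolding mgf_distr[OF meas[OF \<open>j \<ge> 1\<close>]] mgf_distr[OF meas[OF order_refl]] Y(2)[OF \<open>j \<ge> 1\<close>] ..
    qed
    finally show ?thesis by simp
  qed
  have one: "mgf P I (Z 1) s = mgf P I (Y 1) s" using pow[of 1] by simp
  have pos: "0 < mgf P I (Y 1) s"
    using random_vec.mgf_pos[OF random_vecI[OF assms(1,3) meas]] by simp
  show "mgf P I (Z (of_nat t)) s = mgf_at_time (mgf P I (Z 1) s) (of_nat t)"
  proof (cases "mgf P I (Y 1) s < \<infinity>")
    case True
    then obtain a where a: "mgf P I (Y 1) s = ennreal a" "0 < a"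
      using pos by (cases "mgf P I (Y 1) s") auto
    thus ?thesis unfolding pow one
      by (simp add: mgf_at_time_def ennreal_power exp_of_nat_mult)
  next
    case False
    thus ?thesis unfolding pow one
      by (simp add: mgf_at_time_def less_top[symmetric] power_eq_top_ennreal top_power_ennreal)
  qed
qed

text \<open>Stationary independent increments make the MGF multiplicative in time. Stochastic
  continuity at \<open>0\<close> bounds it from below on a short interval, since the process stays
  within distance \<open>1\<close> of its start with probability at least one half. Then
  \<open>mult_ennreal\<close> applies.\<close>

lemma levy_process_mgf:
  assumes "prob_space P" "levy_process P I Z" "finite I" "0 \<le> t"
  shows "mgf P I (Z t) s = mgf_at_time (mgf P I (Z 1) s) t"
proof -
  interpret prob_space P by fact
  have meas: "Z r \<in> P \<rightarrow>\<^sub>M vec_algebra I" if "0 \<le> r" for r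
    using assms(2) that unfolding levy_process_def by blast
  have Z0: "AE u in P. \<forall>i\<in>I. Z 0 u i = 0"
    using assms(2) unfolding levy_process_def by blast
  have incr: "indep_vars (\<lambda>_. vec_algebra I) (\<lambda>j u. vec_diff I (Z (\<tau> (Suc j)) u) (Z (\<tau> j) u)) UNIV"
    if "mono \<tau>" "0 \<le> \<tau> 0" for \<tau>
  proof -
    have "\<forall>\<tau> :: nat \<Rightarrow> real. mono \<tau> \<and> 0 \<le> \<tau> 0 \<longrightarrow> indep_vars (\<lambda>_. vec_algebra I)
        (\<lambda>j u. vec_diff I (Z (\<tau> (Suc j)) u) (Z (\<tau> j) u)) UNIV"
      using assms(2) unfolding levy_process_def by blast
    from this[THEN spec, of \<tau>] show ?thesis using that by simp
  qed
  have stat: "distr P (vec_algebra I) (\<lambda>u. vec_diff I (Z (r + v) u) (Z r u)) = distr P (vec_algebra I) (Z v)"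
    if "0 \<le> r" "0 \<le> v" for r v
  proof -
    have "0 \<le> r \<and> r \<le> r + v" using that by simp
    hence "distr P (vec_algebra I) (\<lambda>u. vec_diff I (Z (r + v) u) (Z r u)) = distr P (vec_algebra I) (Z (r + v - r))"
      using assms(2) unfolding levy_process_def by blast
    thus ?thesis by simp
  qed
  have cont: "((\<lambda>v. measure P {u \<in> space P. \<exists>i\<in>I. \<bar>Z v u i - Z 0 u i\<bar> > 1}) \<longlongrightarrow> 0) (at 0 within {0..})"
  proof -
    have "\<forall>r\<ge>0. \<forall>\<epsilon>>0. ((\<lambda>t. measure P {u \<in> space P. \<exists>i\<in>I. \<bar>Z t u i - Z r u i\<bar> > \<epsilon>}) \<longlongrightarrow> 0) (at r within {0..})"
      using assms(2) unfolding levy_process_def by blast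
    from this[rule_format, of 0 1] show ?thesis by simp
  qed
  have coord: "(\<lambda>u. Z r u i) \<in> borel_measurable P" if "0 \<le> r" "i \<in> I" for i r
    using measurable_compose[OF meas[OF that(1)] measurable_component_singleton[OF that(2)]] .
  have diff_meas: "(\<lambda>u. vec_diff I (Z r u) (Z v u)) \<in> P \<rightarrow>\<^sub>M vec_algebra I" if "0 \<le> r" "0 \<le> v" for r v
    unfolding vec_diff_def using that by (intro measurable_restrict borel_measurable_diff coord) auto
  let ?\<phi> = "\<lambda>r. mgf P I (Z r) s"
  have zero: "?\<phi> 0 = 1"
  proof -
    have "?\<phi> 0 = (\<integral>\<^sup>+u. 1 \<partial>P)"
      unfolding mgf_inner using Z0
      by (intro nn_integral_cong_AE) (auto simp: inner_on_def elim!: eventually_mono)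
    thus ?thesis by (simp add: emeasure_space_1)
  qed
  have inner_diff: "inner_on I s (vec_diff I v v') = inner_on I s v - inner_on I s v'" for v v'
    by (simp add: inner_on_def vec_diff_def sum_subtractf right_diff_distrib)
  have mult: "?\<phi> (r + v) = ?\<phi> r * ?\<phi> v" if r: "0 \<le> r" and v: "0 \<le> v" for r v
  proof -
    \<comment> \<open>The times \<open>0\<close>, \<open>r\<close>, \<open>r + v\<close>, continued
      as a constant sequence; only the first two increments are used.\<close>
    define \<tau> where "\<tau> j = (if j = 0 then 0 else if j = 1 then r else r + v)" for j :: nat
    define D where "D j u = vec_diff I (Z (\<tau> (Suc j)) u) (Z (\<tau> j) u)" for j u
    have "mono \<tau>" using r v unfolding \<tau>_def by (intro monoI) auto
    hence indep: "indep_vars (\<lambda>_. vec_algebra I) D UNIV"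
      unfolding D_def[abs_def] by (rule incr) (simp add: \<tau>_def)
    have "?\<phi> (r + v) = (\<integral>\<^sup>+u. (\<Prod>j\<in>{0,1}. ennreal (exp (inner_on I s (D j u)))) \<partial>P)"
      unfolding mgf_inner
    proof (rule nn_integral_cong_AE, use Z0 in eventually_elim)
      case (elim u)
      hence "inner_on I s (Z 0 u) = 0" by (simp add: inner_on_def)
      hence "inner_on I s (Z (r + v) u) = inner_on I s (D 0 u) + inner_on I s (D 1 u)"
        by (simp add: D_def inner_diff \<tau>_def)
      thus ?case by (simp add: exp_add ennreal_mult)
    qed
    also have "\<dots> = (\<Prod>j\<in>{0,1}. mgf P I (D j) s)"
      by (rule indep_vars_mgf[OF indep_vars_subset[OF indep]]) auto
    also have "\<dots> = mgf P I (D 0) s * mgf P I (D 1) s" by simp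
    also have "mgf P I (D 0) s = ?\<phi> r"
      unfolding mgf_inner
    proof (rule nn_integral_cong_AE, use Z0 in eventually_elim)
      case (elim u)
      hence "inner_on I s (Z 0 u) = 0" by (simp add: inner_on_def)
      thus ?case by (simp add: D_def inner_diff \<tau>_def)
    qed
    also have "mgf P I (D 1) s = ?\<phi> v"
    proof -
      have D1: "D 1 = (\<lambda>u. vec_diff I (Z (r + v) u) (Z r u))" by (simp add: D_def[abs_def] \<tau>_def)
      show ?thesis unfolding D1
        using r v by (subst mgf_distr[OF diff_meas]) (auto simp: stat mgf_distr[OF meas])
    qed
    finally show ?thesis .
  qed
  have pos: "0 < ?\<phi> r" if "0 \<le> r" for r
    using random_vec.mgf_pos[OF random_vecI[OF assms(1,3) meas[OF that]]] .
  have "\<forall>\<^sub>F v in at 0 within {0..}. measure P {u \<in> space P. \<exists>i\<in>I. \<bar>Z v u i - Z 0 u i\<bar> > 1} < 1 / 2"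
    using cont by (rule order_tendstoD(2)) simp
  then obtain \<delta> where \<delta>: "\<delta> > 0"
    "\<And>v. 0 < v \<Longrightarrow> v < \<delta> \<Longrightarrow> measure P {u \<in> space P. \<exists>i\<in>I. \<bar>Z v u i - Z 0 u i\<bar> > 1} < 1 / 2"
    unfolding eventually_at by (auto simp: dist_real_def)
  \<comment> \<open>\<open>S\<close> bounds the pairing of \<open>s\<close> with any vector whose
    coordinates are at most \<open>1\<close> in absolute value.\<close>
  define S where "S = (\<Sum>i\<in>I. \<bar>s i\<bar>)"
  have "S \<ge> 0" by (simp add: S_def sum_nonneg)
  have lower: "ennreal (exp (- S) / 2) \<le> ?\<phi> v" if v: "0 \<le> v" "v \<le> \<delta> / 2" for v
  \<comment> \<open>The limit at \<open>0\<close> within \<open>{0..}\<close> gives no information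
    about time \<open>0\<close> itself; there the MGF is \<open>1\<close>.\<close>
  proof (cases "v = 0")
    case True
    have "exp (- S) / 2 \<le> 1" using \<open>S \<ge> 0\<close> by (smt (verit) exp_le_one_iff field_sum_of_halves exp_gt_zero)
    thus ?thesis using True zero by (simp add: ennreal_le_1)
  next
    case False
    define B where "B = {u \<in> space P. \<exists>i\<in>I. \<bar>Z v u i - Z 0 u i\<bar> > 1}"
    have [measurable]: "B \<in> sets P"
    proof -
      have "B = (\<Union>i\<in>I. {u \<in> space P. \<bar>Z v u i - Z 0 u i\<bar> > 1})" by (auto simp: B_def)
      moreover have "{u \<in> space P. \<bar>Z v u i - Z 0 u i\<bar> > 1} \<in> sets P" if "i \<in> I" for i
      proof -
        have [measurable]: "(\<lambda>u. Z v u i) \<in> borel_measurable P" "(\<lambda>u. Z 0 u i) \<in> borel_measurable P"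
          using coord that v by auto
        show ?thesis by measurable
      qed
      ultimately show ?thesis using assms(3) by (auto intro!: sets.finite_UN)
    qed
    have "measure P B < 1 / 2" unfolding B_def using v False \<delta> by (intro \<delta>(2)) auto
    hence half: "1 / 2 \<le> measure P (space P - B)" by (simp add: prob_compl)
    have "ennreal (exp (- S) / 2) \<le> ennreal (exp (- S)) * emeasure P (space P - B)"
    proof -
      have "exp (- S) / 2 \<le> exp (- S) * measure P (space P - B)"
        using mult_left_mono[OF half, of "exp (- S)"] by simp
      thus ?thesis by (simp add: emeasure_eq_measure ennreal_leI flip: ennreal_mult)
    qed
    also have "\<dots> = (\<integral>\<^sup>+u. ennreal (exp (- S)) * indicator (space P - B) u \<partial>P)"
      by (rule nn_integral_cmult_indicator[symmetric]) measurable
    also have "\<dots> \<le> ?\<phi> v"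
      unfolding mgf_inner
    proof (rule nn_integral_mono_AE, use Z0 in eventually_elim)
      case (elim u)
      show ?case
      proof (cases "u \<in> space P - B")
        case True
        hence "\<bar>Z v u i\<bar> \<le> 1" if "i \<in> I" for i using that elim by (force simp: B_def)
        hence "\<bar>s i * Z v u i\<bar> \<le> \<bar>s i\<bar>" if "i \<in> I" for i
          using that mult_left_mono[of "\<bar>Z v u i\<bar>" 1 "\<bar>s i\<bar>"] by (simp add: abs_mult)
        hence "\<bar>inner_on I s (Z v u)\<bar> \<le> S"
          unfolding inner_on_def S_def by (intro order_trans[OF sum_abs] sum_mono) auto
        thus ?thesis using True by simp
      qed simp
    qed
    finally show ?thesis .
  qed
  have dpos: "0 < \<delta> / 2" "0 < exp (- S) / 2" using \<delta>(1) by auto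
  have fin: "?\<phi> t = ennreal (exp (t * ln (enn2real (?\<phi> 1))))" if "?\<phi> 1 < \<infinity>"
    using mult zero pos dpos lower that assms(4) by (rule mult_ennreal(1))
  have inf: "?\<phi> t = \<infinity>" if "?\<phi> 1 = \<infinity>" "0 < t"
    using mult zero pos dpos lower that by (rule mult_ennreal(2))
  show ?thesis
  proof (cases "t = 0")
    case True
    thus ?thesis using zero by (simp add: mgf_at_time_def)
  next
    case False
    hence t: "0 < t" using assms(4) by simp
    show ?thesis
    proof (cases "?\<phi> 1 < \<infinity>")
      case True
      thus ?thesis using fin[OF True] t by (simp add: mgf_at_time_def)
    next
      case False
      hence "?\<phi> 1 = \<infinity>" by (simp add: less_top[symmetric])
      thus ?thesis using inf[OF _ t] t by (simp add: mgf_at_time_def)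
    qed
  qed
qed

lemma linear_drift_mgf:
  assumes "prob_space P" "linear_drift P I Z" "finite I"
  shows "Z t \<in> P \<rightarrow>\<^sub>M vec_algebra I" "mgf P I (Z 1) s < \<infinity>"
    "mgf P I (Z t) s = mgf_at_time (mgf P I (Z 1) s) t"
proof -
  interpret prob_space P by fact
  obtain c where c: "\<And>t u. u \<in> space P \<Longrightarrow> Z t u = (\<lambda>i\<in>I. t * c i)"
    using assms(2) unfolding linear_drift_def by blast
  show "Z t \<in> P \<rightarrow>\<^sub>M vec_algebra I"
    by (subst measurable_cong[OF c]) (auto intro!: measurable_restrict)
  have mgf: "mgf P I (Z t) s = ennreal (exp (t * inner_on I s c))" for t
  proof -
    have "mgf P I (Z t) s = (\<integral>\<^sup>+u. ennreal (exp (t * inner_on I s c)) \<partial>P)"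
      unfolding mgf_inner
      by (rule nn_integral_cong) (simp add: c inner_on_def sum_distrib_left mult_ac)
    thus ?thesis by (simp add: emeasure_space_1)
  qed
  show "mgf P I (Z 1) s < \<infinity>" by (simp add: mgf)
  show "mgf P I (Z t) s = mgf_at_time (mgf P I (Z 1) s) t"
    by (simp add: mgf mgf_at_time_def)
qed

lemma compounding_process_mgf:
  assumes "prob_space P" "compounding_process P I T Z" "finite I" "t \<in> T"
  shows "Z t \<in> P \<rightarrow>\<^sub>M vec_algebra I" "mgf P I (Z t) s = mgf_at_time (mgf P I (Z 1) s) t"
  using assms(2) unfolding compounding_process_def
proof safe
  assume T: "T = \<nat>" and Z: "random_walk P I Z"
  then obtain n where n: "t = of_nat n" using assms(4) by (auto elim: Nats_cases)
  show "Z t \<in> P \<rightarrow>\<^sub>M vec_algebra I" "mgf P I (Z t) s = mgf_at_time (mgf P I (Z 1) s) t"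
    unfolding n using random_walk_mgf[OF assms(1) Z assms(3)] by auto
next
  assume T: "T = {0..}" and Z: "levy_process P I Z"
  hence t: "0 \<le> t" using assms(4) by simp
  show "Z t \<in> P \<rightarrow>\<^sub>M vec_algebra I" using Z t unfolding levy_process_def by blast
  show "mgf P I (Z t) s = mgf_at_time (mgf P I (Z 1) s) t" using levy_process_mgf[OF assms(1) Z assms(3) t] .
next
  assume Z: "linear_drift P I Z"
  show "Z t \<in> P \<rightarrow>\<^sub>M vec_algebra I" by (rule linear_drift_mgf(1)[OF assms(1) Z assms(3)])
  show "mgf P I (Z t) s = mgf_at_time (mgf P I (Z 1) s) t" by (rule linear_drift_mgf(3)[OF assms(1) Z assms(3)])
qed

text \<open>The dichotomy behind the exclusion of zero coordinates: where the driving coordinate may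
  be negative, the process is a deterministic drift, whose MGF is finite everywhere.\<close>

lemma compounding_process_cases:
  assumes "prob_space P" "compounding_process P I T Z" "finite I"
  shows "T \<subseteq> {0..} \<or> (\<forall>s. mgf P I (Z 1) s < \<infinity>)"
proof (cases "linear_drift P I Z")
  case True
  thus ?thesis using linear_drift_mgf(2)[OF assms(1) _ assms(3)] by simp
next
  case False
  hence "T = \<nat> \<or> T = {0..}" using assms(2) unfolding compounding_process_def by blast
  thus ?thesis by (auto simp: Nats_def)
qed

section \<open>The recursion for the joint moment generating function\<close>

text \<open>Disintegration for products, obtained in two extensions from rectangles. With
  \<open>D\<close> fixed, two measures on \<open>A\<close> agree on all sets, so indicators of
  \<open>C\<close> may be replaced by \<open>g\<close>. With \<open>g\<close> fixed as a density,
  the law of \<open>V\<close> is the mixture of the kernels, so indicators of \<open>D\<close> may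
  be replaced by \<open>h\<close>.\<close>

lemma conditional_distribution_nn_integral:
  assumes cd: "conditional_distribution M A Y B V \<kappa>"
    and g[measurable]: "g \<in> borel_measurable A" and h: "h \<in> borel_measurable B"
  shows "(\<integral>\<^sup>+w. g (Y w) * h (V w) \<partial>M) = (\<integral>\<^sup>+w. g (Y w) * (\<integral>\<^sup>+v. h v \<partial>\<kappa> (Y w)) \<partial>M)"
proof -
  have Y[measurable]: "Y \<in> M \<rightarrow>\<^sub>M A" and V[measurable]: "V \<in> M \<rightarrow>\<^sub>M B"
    and K: "(\<lambda>w. \<kappa> (Y w)) \<in> M \<rightarrow>\<^sub>M prob_algebra B"
    and eq: "\<And>C D. C \<in> sets A \<Longrightarrow> D \<in> sets B \<Longrightarrow>
        emeasure M {w \<in> space M. Y w \<in> C \<and> V w \<in> D}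
        = (\<integral>\<^sup>+w. indicator C (Y w) * emeasure (\<kappa> (Y w)) D \<partial>M)"
    using cd unfolding conditional_distribution_def by blast+
  have K'[measurable]: "(\<lambda>w. \<kappa> (Y w)) \<in> M \<rightarrow>\<^sub>M subprob_algebra B"
    by (rule measurable_prob_algebraD[OF K])
  have sK: "sets (\<kappa> (Y w)) = sets B" if "w \<in> space M" for w
    using measurable_space[OF K that] by (simp add: space_prob_algebra)
  have int_meas[measurable]: "(\<lambda>w. \<integral>\<^sup>+v. h v \<partial>\<kappa> (Y w)) \<in> borel_measurable M"
    if "h \<in> borel_measurable B" for h
    using measurable_compose[OF K' nn_integral_measurable_subprob_algebra[OF that]] .
  have sets_eq: "(\<integral>\<^sup>+w. g (Y w) * indicator D (V w) \<partial>M) = (\<integral>\<^sup>+w. g (Y w) * emeasure (\<kappa> (Y w)) D \<partial>M)"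
    if D[measurable]: "D \<in> sets B" for D
  proof -
    define \<mu>1 where "\<mu>1 = distr (density M (\<lambda>w. indicator D (V w))) A Y"
    define \<mu>2 where "\<mu>2 = distr (density M (\<lambda>w. emeasure (\<kappa> (Y w)) D)) A Y"
    have eK[measurable]: "(\<lambda>w. emeasure (\<kappa> (Y w)) D) \<in> borel_measurable M"
      using measurable_compose[OF K' measurable_emeasure_subprob_algebra[OF D]] .
    have "\<mu>1 = \<mu>2"
    proof (rule measure_eqI)
      show "sets \<mu>1 = sets \<mu>2" by (simp add: \<mu>1_def \<mu>2_def)
      fix C assume "C \<in> sets \<mu>1"
      hence C[measurable]: "C \<in> sets A" by (simp add: \<mu>1_def)
      have "emeasure \<mu>1 C = (\<integral>\<^sup>+w. indicator D (V w) * indicator (Y -` C \<inter> space M) w \<partial>M)"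
        by (simp add: \<mu>1_def emeasure_distr emeasure_density)
      also have "\<dots> = (\<integral>\<^sup>+w. indicator {w \<in> space M. Y w \<in> C \<and> V w \<in> D} w \<partial>M)"
        by (intro nn_integral_cong) (auto split: split_indicator)
      also have "\<dots> = emeasure M {w \<in> space M. Y w \<in> C \<and> V w \<in> D}"
        by (rule nn_integral_indicator) measurable
      also have "\<dots> = (\<integral>\<^sup>+w. indicator C (Y w) * emeasure (\<kappa> (Y w)) D \<partial>M)"
        by (rule eq[OF C D])
      also have "\<dots> = (\<integral>\<^sup>+w. emeasure (\<kappa> (Y w)) D * indicator (Y -` C \<inter> space M) w \<partial>M)"
        by (intro nn_integral_cong) (auto split: split_indicator)
      also have "\<dots> = emeasure \<mu>2 C"
        by (simp add: \<mu>2_def emeasure_distr emeasure_density)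
      finally show "emeasure \<mu>1 C = emeasure \<mu>2 C" .
    qed
    have "(\<integral>\<^sup>+w. g (Y w) * indicator D (V w) \<partial>M) = (\<integral>\<^sup>+y. g y \<partial>\<mu>1)"
      by (simp add: \<mu>1_def nn_integral_distr nn_integral_density mult.commute)
    also have "\<dots> = (\<integral>\<^sup>+y. g y \<partial>\<mu>2)" by (simp add: \<open>\<mu>1 = \<mu>2\<close>)
    also have "\<dots> = (\<integral>\<^sup>+w. g (Y w) * emeasure (\<kappa> (Y w)) D \<partial>M)"
      by (simp add: \<mu>2_def nn_integral_distr nn_integral_density mult.commute)
    finally show ?thesis .
  qed
  show ?thesis
  \<comment> \<open>\<open>sets_bind\<close> and \<open>emeasure_bind\<close> are applicable only
    over a nonempty space.\<close>
  proof (cases "space M = {}")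
    case True
    thus ?thesis by (simp add: nn_integral_empty)
  next
    case False
    define M\<^sub>g where "M\<^sub>g = density M (\<lambda>w. g (Y w))"
    have K_g: "(\<lambda>w. \<kappa> (Y w)) \<in> M\<^sub>g \<rightarrow>\<^sub>M subprob_algebra B" using K' by (simp add: M\<^sub>g_def)
    have "distr M\<^sub>g B V = M\<^sub>g \<bind> (\<lambda>w. \<kappa> (Y w))"
    proof (rule measure_eqI)
      show "sets (distr M\<^sub>g B V) = sets (M\<^sub>g \<bind> (\<lambda>w. \<kappa> (Y w)))"
        using False by (subst sets_bind[of _ _ B]) (auto simp: M\<^sub>g_def sK)
      fix D assume "D \<in> sets (distr M\<^sub>g B V)"
      hence D[measurable]: "D \<in> sets B" by simp
      have [measurable]: "(\<lambda>w. emeasure (\<kappa> (Y w)) D) \<in> borel_measurable M"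
        using measurable_compose[OF K' measurable_emeasure_subprob_algebra[OF D]] .
      have "emeasure (distr M\<^sub>g B V) D = (\<integral>\<^sup>+w. g (Y w) * indicator (V -` D \<inter> space M) w \<partial>M)"
        by (simp add: M\<^sub>g_def emeasure_distr emeasure_density)
      also have "\<dots> = (\<integral>\<^sup>+w. g (Y w) * indicator D (V w) \<partial>M)"
        by (intro nn_integral_cong) (auto split: split_indicator)
      also have "\<dots> = emeasure (M\<^sub>g \<bind> (\<lambda>w. \<kappa> (Y w))) D"
        unfolding sets_eq[OF D] using False
        by (subst emeasure_bind[OF _ K_g D]) (simp_all add: M\<^sub>g_def nn_integral_density)
      finally show "emeasure (distr M\<^sub>g B V) D = emeasure (M\<^sub>g \<bind> (\<lambda>w. \<kappa> (Y w))) D" .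
    qed
    hence "(\<integral>\<^sup>+v. h v \<partial>distr M\<^sub>g B V) = (\<integral>\<^sup>+w. \<integral>\<^sup>+v. h v \<partial>\<kappa> (Y w) \<partial>M\<^sub>g)"
      using nn_integral_bind[OF h K_g] by simp
    thus ?thesis using int_meas[OF h] measurable_compose[OF V h] by (simp add: M\<^sub>g_def nn_integral_distr nn_integral_density h)
  qed
qed

text \<open>Independence is given for the sigma-algebras generated by whole processes. For fixed
  \<open>y\<close> each of them contains the events of the process at the one time
  \<open>y m i\<close>, so the summands are independent vectors and the MGF is a product.\<close>

lemma compound_map_mgf:
  assumes noise: "compounding_noise N d P \<xi> Z T" and n: "n \<in> {1..N}"
    and y: "\<And>m i. m < n \<Longrightarrow> i < d m \<Longrightarrow> y m i \<in> T n m i"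
  shows "compound_map d \<xi> Z n y \<in> P \<rightarrow>\<^sub>M vec_algebra {..<d n}"
    and "mgf P {..<d n} (compound_map d \<xi> Z n y) s
      = mgf P {..<d n} (\<xi> n) s * (\<Prod>(m, i)\<in>(SIGMA m:{..<n}. {..<d m}). mgf_at_time (mgf P {..<d n} (Z n m i 1) s) (y m i))"
proof -
  let ?B = "vec_algebra {..<d n}" and ?S = "SIGMA m:{..<n}. {..<d m}"
  interpret prob_space P using noise unfolding compounding_noise_def by blast
  have \<xi>: "\<xi> n \<in> P \<rightarrow>\<^sub>M ?B"
    and Z: "\<And>m i. m < n \<Longrightarrow> i < d m \<Longrightarrow> compounding_process P {..<d n} (T n m i) (Z n m i)"
    and indep: "indep_sets
          (\<lambda>k. case k of
                 None \<Rightarrow> generated_events P ?B {()} (\<lambda>_. \<xi> n)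
               | Some (m, i) \<Rightarrow> generated_events P ?B (T n m i) (Z n m i))
          (insert None (Some ` ?S))"
    using noise n unfolding compounding_noise_def by blast+
  define R where "R k = (case k of None \<Rightarrow> \<xi> n | Some (m, i) \<Rightarrow> Z n m i (y m i))" for k
  let ?K = "insert None (Some ` ?S)"
  note Zm = compounding_process_mgf[OF prob_space_axioms Z _ y]
  have Rm: "R k \<in> P \<rightarrow>\<^sub>M ?B" if "k \<in> ?K" for k
    using that \<xi> Zm(1) by (auto simp: R_def)
  have indepR: "indep_vars (\<lambda>_. ?B) R ?K"
    unfolding indep_vars_def2
  proof (intro conjI ballI Rm)
    show "indep_sets (\<lambda>k. {R k -` A \<inter> space P |A. A \<in> sets ?B}) ?K"
    proof (rule indep_sets_mono_sets[OF indep])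
      fix k assume "k \<in> ?K"
      thus "{R k -` A \<inter> space P |A. A \<in> sets ?B} \<subseteq> (case k of
                 None \<Rightarrow> generated_events P ?B {()} (\<lambda>_. \<xi> n)
               | Some (m, i) \<Rightarrow> generated_events P ?B (T n m i) (Z n m i))"
        using y unfolding R_def generated_events_def by (auto intro!: sigma_sets.Basic) blast+
    qed
  qed
  have coord: "(\<lambda>u. R k u j) \<in> borel_measurable P" if "k \<in> ?K" "j < d n" for k j
    using measurable_compose[OF Rm[OF that(1)] measurable_component_singleton[of j "{..<d n}"]] that(2) by simp
  have finS: "finite ?S" by simp
  have cm: "compound_map d \<xi> Z n y u = (\<lambda>j\<in>{..<d n}. \<Sum>k\<in>?K. R k u j)" for u
  proof -
    have "(\<Sum>k\<in>?K. R k u j) = R None u j + (\<Sum>k\<in>Some ` ?S. R k u j)" for j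
      using finS by (subst sum.insert) auto
    also have "\<dots> j = \<xi> n u j + (\<Sum>(m, i)\<in>?S. Z n m i (y m i) u j)" for j
      by (subst sum.reindex) (auto simp: R_def case_prod_beta)
    finally show ?thesis
      unfolding compound_map_def by (simp add: sum.Sigma)
  qed
  show "compound_map d \<xi> Z n y \<in> P \<rightarrow>\<^sub>M ?B"
    unfolding cm[abs_def] by (intro measurable_restrict borel_measurable_sum coord) auto
  have "mgf P {..<d n} (compound_map d \<xi> Z n y) s
      = (\<integral>\<^sup>+u. (\<Prod>k\<in>?K. ennreal (exp (inner_on {..<d n} s (R k u)))) \<partial>P)"
    unfolding mgf_inner
  proof (rule nn_integral_cong)
    fix u
    have "inner_on {..<d n} s (compound_map d \<xi> Z n y u) = (\<Sum>j<d n. \<Sum>k\<in>?K. s j * R k u j)"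
      unfolding inner_on_def by (intro sum.cong refl) (simp add: cm sum_distrib_left del: sum.insert)
    also have "\<dots> = (\<Sum>k\<in>?K. inner_on {..<d n} s (R k u))"
      unfolding inner_on_def by (rule sum.swap)
    finally show "ennreal (exp (inner_on {..<d n} s (compound_map d \<xi> Z n y u)))
        = (\<Prod>k\<in>?K. ennreal (exp (inner_on {..<d n} s (R k u))))"
      using finS by (simp only: exp_sum finite_insert finite_imageI prod_ennreal exp_ge_zero)
  qed
  also have "\<dots> = (\<Prod>k\<in>?K. mgf P {..<d n} (R k) s)"
    by (rule indep_vars_mgf[OF indepR]) (use finS in auto)
  also have "\<dots> = mgf P {..<d n} (\<xi> n) s * (\<Prod>k\<in>Some ` ?S. mgf P {..<d n} (R k) s)"
    using finS by (subst prod.insert) (auto simp: R_def)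
  also have "(\<Prod>k\<in>Some ` ?S. mgf P {..<d n} (R k) s)
      = (\<Prod>(m, i)\<in>?S. mgf_at_time (mgf P {..<d n} (Z n m i 1) s) (y m i))"
    by (subst prod.reindex) (auto simp: R_def Zm(2) intro!: prod.cong)
  finally show "mgf P {..<d n} (compound_map d \<xi> Z n y) s
      = mgf P {..<d n} (\<xi> n) s * (\<Prod>(m, i)\<in>?S. mgf_at_time (mgf P {..<d n} (Z n m i 1) s) (y m i))" .
qed

lemma concat_index_Suc:
  "concat_index (Suc N) d = concat_index N d \<union> {Suc N} \<times> {..<d (Suc N)}"
  "concat_index N d \<inter> {Suc N} \<times> {..<d (Suc N)} = {}"
  by (auto simp: concat_index_def le_Suc_eq)

lemma finite_concat_index: "finite (concat_index N d)"
  by (simp add: concat_index_def)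

lemma sum_concat_index_Suc:
  "(\<Sum>j\<in>concat_index (Suc N) d. f j) = (\<Sum>j\<in>concat_index N d. f j) + (\<Sum>k<d (Suc N). f (Suc N, k))"
proof -
  have "(\<Sum>j\<in>concat_index (Suc N) d. f j) = sum f (concat_index N d) + sum f ({Suc N} \<times> {..<d (Suc N)})"
    unfolding concat_index_Suc by (rule sum.union_disjoint) (auto simp: finite_concat_index concat_index_Suc(2))
  also have "sum f ({Suc N} \<times> {..<d (Suc N)}) = sum f (Pair (Suc N) ` {..<d (Suc N)})"
    by (intro sum.cong) auto
  also have "\<dots> = (\<Sum>k<d (Suc N). f (Suc N, k))"
    by (subst sum.reindex) (auto simp: inj_on_def)
  finally show ?thesis .
qed

lemma inner_concat_vec:
  "inner_on (concat_index N d) s (concat_vec N d y) = (\<Sum>(m, i)\<in>concat_index N d. s (m, i) * y m i)"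
  unfolding inner_on_def by (intro sum.cong) (auto simp: concat_vec_def)

text \<open>The tower property: the last vector is integrated out given the past. Working in
  \<open>ennreal\<close> makes the identity valid also where the MGF is infinite, as the comparison
  of domains requires.\<close>

lemma mgf_concat_Suc:
  assumes rc: "recursively_compounded (Suc N) d P \<xi> Z T M W"
  shows "mgf M (concat_index (Suc N) d) (\<lambda>w. concat_vec (Suc N) d (\<lambda>n. W n w)) s
    = (\<integral>\<^sup>+w. ennreal (exp (inner_on (concat_index N d) s (concat_vec N d (\<lambda>n. W n w))))
        * (mgf P {..<d (Suc N)} (\<xi> (Suc N)) (\<lambda>k. s (Suc N, k))
           * (\<Prod>(m, i)\<in>(SIGMA m:{..<Suc N}. {..<d m}).
                mgf_at_time (mgf P {..<d (Suc N)} (Z (Suc N) m i 1) (\<lambda>k. s (Suc N, k))) (W m w i))) \<partial>M)"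
proof -
  let ?n = "Suc N" and ?\<sigma> = "\<lambda>k. s (Suc N, k)"
  let ?A = "\<Pi>\<^sub>M m\<in>{..<?n}. vec_algebra {..<d m}" and ?B = "vec_algebra {..<d ?n}"
  let ?Y = "\<lambda>w. \<lambda>m\<in>{..<?n}. W m w"
  have n: "?n \<in> {1..Suc N}" by simp
  have noise: "compounding_noise (Suc N) d P \<xi> Z T"
    and T: "\<And>m i w. m < ?n \<Longrightarrow> i < d m \<Longrightarrow> w \<in> space M \<Longrightarrow> W m w i \<in> T ?n m i"
    and cd: "conditional_distribution M ?A ?Y ?B (W ?n)
          (\<lambda>y. distr P ?B (compound_map d \<xi> Z ?n y))"
    using rc n unfolding recursively_compounded_def by blast+
  define g where "g y = ennreal (exp (\<Sum>(m, i)\<in>concat_index N d. s (m, i) * y m i))" for y :: "nat \<Rightarrow> nat \<Rightarrow> real"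
  define h where "h v = ennreal (exp (inner_on {..<d ?n} ?\<sigma> v))" for v
  have h: "h \<in> borel_measurable ?B" unfolding h_def[abs_def] by measurable
  have g: "g \<in> borel_measurable ?A"
  proof -
    have "(\<lambda>y :: nat \<Rightarrow> nat \<Rightarrow> real. y m i) \<in> borel_measurable ?A" if "(m, i) \<in> concat_index N d" for m i
    proof -
      have m: "m \<in> {..<?n}" "i \<in> {..<d m}" using that by (auto simp: concat_index_def)
      show ?thesis
        by (rule measurable_compose[of "\<lambda>y. y m" _ "vec_algebra {..<d m}"])
          (use m in \<open>auto intro!: measurable_component_singleton\<close>)
    qed
    hence "(\<lambda>y. \<Sum>j\<in>concat_index N d. s j * y (fst j) (snd j)) \<in> borel_measurable ?A"
      by (intro borel_measurable_sum borel_measurable_times borel_measurable_const) auto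
    thus ?thesis unfolding g_def[abs_def] by (simp add: case_prod_beta)
  qed
  have gY: "g (?Y w) = ennreal (exp (inner_on (concat_index N d) s (concat_vec N d (\<lambda>n. W n w))))" for w
    unfolding g_def inner_concat_vec
    by (intro arg_cong[of _ _ "\<lambda>x. ennreal (exp x)"] sum.cong) (auto simp: concat_index_def)
  have "mgf M (concat_index (Suc N) d) (\<lambda>w. concat_vec (Suc N) d (\<lambda>n. W n w)) s
      = (\<integral>\<^sup>+w. g (?Y w) * h (W ?n w) \<partial>M)"
    unfolding mgf_inner gY h_def
    by (simp add: inner_concat_vec sum_concat_index_Suc exp_add ennreal_mult) (simp add: inner_on_def)
  also have "\<dots> = (\<integral>\<^sup>+w. g (?Y w) * (\<integral>\<^sup>+v. h v \<partial>distr P ?B (compound_map d \<xi> Z ?n (?Y w))) \<partial>M)"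
    by (rule conditional_distribution_nn_integral[OF cd g h])
  also have "\<dots> = (\<integral>\<^sup>+w. ennreal (exp (inner_on (concat_index N d) s (concat_vec N d (\<lambda>n. W n w))))
        * (mgf P {..<d ?n} (\<xi> ?n) ?\<sigma> * (\<Prod>(m, i)\<in>(SIGMA m:{..<?n}. {..<d m}).
                mgf_at_time (mgf P {..<d ?n} (Z ?n m i 1) ?\<sigma>) (W m w i))) \<partial>M)"
  proof (rule nn_integral_cong)
    fix w assume w: "w \<in> space M"
    have y: "?Y w m i \<in> T ?n m i" if "m < ?n" "i < d m" for m i
      using T[OF that w] that by simp
    have "(\<integral>\<^sup>+v. h v \<partial>distr P ?B (compound_map d \<xi> Z ?n (?Y w))) = mgf P {..<d ?n} (compound_map d \<xi> Z ?n (?Y w)) ?\<sigma>"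
      unfolding h_def using compound_map_mgf(1)[OF noise n y] by (intro mgf_distr[symmetric])
    also have "\<dots> = mgf P {..<d ?n} (\<xi> ?n) ?\<sigma> * (\<Prod>(m, i)\<in>(SIGMA m:{..<?n}. {..<d m}).
                mgf_at_time (mgf P {..<d ?n} (Z ?n m i 1) ?\<sigma>) (?Y w m i))"
      by (rule compound_map_mgf(2)[OF noise n y])
    also have "(\<Prod>(m, i)\<in>(SIGMA m:{..<?n}. {..<d m}). mgf_at_time (mgf P {..<d ?n} (Z ?n m i 1) ?\<sigma>) (?Y w m i))
        = (\<Prod>(m, i)\<in>(SIGMA m:{..<?n}. {..<d m}). mgf_at_time (mgf P {..<d ?n} (Z ?n m i 1) ?\<sigma>) (W m w i))"
      by (intro prod.cong) auto
    finally show "g (?Y w) * (\<integral>\<^sup>+v. h v \<partial>distr P ?B (compound_map d \<xi> Z ?n (?Y w)))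
      = ennreal (exp (inner_on (concat_index N d) s (concat_vec N d (\<lambda>n. W n w))))
        * (mgf P {..<d ?n} (\<xi> ?n) ?\<sigma> * (\<Prod>(m, i)\<in>(SIGMA m:{..<?n}. {..<d m}).
                mgf_at_time (mgf P {..<d ?n} (Z ?n m i 1) ?\<sigma>) (W m w i)))"
      by (rule arg_cong2[where f = "(*)", OF gY])
  qed
  finally show ?thesis .
qed

section \<open>Shearing the argument\<close>

text \<open>\<open>J\<close> and a copy \<open>\<iota> ` K\<close> of \<open>K\<close> index the two blocks of a vector \<open>q\<close>.\<close>

definition tail_part :: "'k set \<Rightarrow> ('k \<Rightarrow> 'i) \<Rightarrow> ('i \<Rightarrow> real) \<Rightarrow> 'k \<Rightarrow> real" where
  "tail_part K \<iota> q = (\<lambda>k\<in>K. q (\<iota> k))"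

text \<open>Only the \<open>J\<close> block is returned. The tail block is left as it is, so
  \<open>shear\<close> and \<open>tail_part\<close> together are the change of variables of one
  step.\<close>

definition shear :: "'i set \<Rightarrow> 'k set \<Rightarrow> ('k \<Rightarrow> 'i) \<Rightarrow> ('i \<Rightarrow> ('k \<Rightarrow> real) \<Rightarrow> real) \<Rightarrow> ('i \<Rightarrow> real) \<Rightarrow> 'i \<Rightarrow> real" where
  "shear J K \<iota> G q = (\<lambda>j\<in>J. q j + G j (tail_part K \<iota> q))"

locale shear_composition =
  fixes J :: "'i set" and K :: "'k set" and \<iota> :: "'k \<Rightarrow> 'i"
  assumes finJ: "finite J" and finK: "finite K" and inj: "inj_on \<iota> K" and disjoint: "J \<inter> \<iota> ` K = {}"
begin

abbreviation \<sigma> where "\<sigma> \<equiv> tail_part K \<iota>"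
abbreviation untail where "untail \<equiv> inv_into K \<iota>"
abbreviation \<phi> where "\<phi> \<equiv> shear J K \<iota>"

lemma sum_blocks: "(\<Sum>j\<in>J \<union> \<iota> ` K. f j) = (\<Sum>j\<in>J. f j) + (\<Sum>k\<in>K. f (\<iota> k))"
  using finJ finK disjoint by (simp add: sum.union_disjoint sum.reindex[OF inj])

lemma tail_notin: "k \<in> K \<Longrightarrow> \<iota> k \<notin> J"
  using disjoint by auto

lemma inv_\<iota> [simp]: "k \<in> K \<Longrightarrow> untail (\<iota> k) = k"
  by (rule inv_into_f_f[OF inj])

context
  fixes c :: "real \<Rightarrow> 'i \<Rightarrow> real" and c' :: "'i \<Rightarrow> real" and t\<^sub>0 :: real and q :: "'i \<Rightarrow> real"
    and G :: "'i \<Rightarrow> ('k \<Rightarrow> real) \<Rightarrow> real" and gG :: "'i \<Rightarrow> 'k \<Rightarrow> ('k \<Rightarrow> real) \<Rightarrow> real"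
  assumes c: "\<forall>i\<in>J \<union> \<iota> ` K. ((\<lambda>t. c t i) has_real_derivative c' i) (at t\<^sub>0) \<and> c t\<^sub>0 i = q i"
begin

lemma tail_part_curve:
  "k \<in> K \<Longrightarrow> ((\<lambda>t. \<sigma> (c t) k) has_real_derivative c' (\<iota> k)) (at t\<^sub>0)"
  "\<sigma> (c t\<^sub>0) = \<sigma> q"
  using c by (auto simp: tail_part_def restrict_def)

lemma tail_hadamard_curve:
  assumes "hadamard K L D (\<sigma> q)"
  shows "((\<lambda>t. L (\<sigma> (c t))) has_real_derivative (\<Sum>k\<in>K. D k * c' (\<iota> k))) (at t\<^sub>0)"
  using tail_part_curve by (intro hadamardD[OF assms]) auto

lemma shear_curve_at: "\<phi> G (c t\<^sub>0) = \<phi> G q"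
  unfolding shear_def tail_part_curve(2) using c by (auto simp: restrict_def)

text \<open>The notion of derivative asks for curves differentiable at a single point, a property
  that the sheared curve inherits. The chain rule is then an application of \<open>hadamardD\<close>
  to that curve.\<close>

lemma shear_hadamard_curve:
  assumes G: "\<And>j. j \<in> J \<Longrightarrow> hadamard K (G j) (\<lambda>k. gG j k (\<sigma> q)) (\<sigma> q)"
    and A: "hadamard J A D (\<phi> G q)"
  shows "((\<lambda>t. A (\<phi> G (c t))) has_real_derivative
    (\<Sum>j\<in>J. D j * (c' j + (\<Sum>k\<in>K. gG j k (\<sigma> q) * c' (\<iota> k))))) (at t\<^sub>0)"
proof (rule hadamardD[OF A])
  fix j assume j: "j \<in> J"
  have "((\<lambda>t. c t j + G j (\<sigma> (c t))) has_real_derivative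
      c' j + (\<Sum>k\<in>K. gG j k (\<sigma> q) * c' (\<iota> k))) (at t\<^sub>0)"
    by (rule DERIV_add[OF _ tail_hadamard_curve[OF G[OF j]]]) (use c j in auto)
  thus "((\<lambda>t. \<phi> G (c t) j) has_real_derivative
      c' j + (\<Sum>k\<in>K. gG j k (\<sigma> q) * c' (\<iota> k))) (at t\<^sub>0)"
    using j by (simp add: shear_def)
qed (simp add: shear_curve_at)

end

definition shear_gradient ::
    "('i \<Rightarrow> ('k \<Rightarrow> real) \<Rightarrow> real) \<Rightarrow> ('i \<Rightarrow> ('i \<Rightarrow> real) \<Rightarrow> real) \<Rightarrow> ('k \<Rightarrow> ('k \<Rightarrow> real) \<Rightarrow> real) \<Rightarrow>
     ('i \<Rightarrow> 'k \<Rightarrow> ('k \<Rightarrow> real) \<Rightarrow> real) \<Rightarrow> 'i \<Rightarrow> ('i \<Rightarrow> real) \<Rightarrow> real" where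
  "shear_gradient G gA gL gG i q = (if i \<in> J then gA i (\<phi> G q)
     else (\<Sum>j\<in>J. gA j (\<phi> G q) * gG j (untail i) (\<sigma> q)) + gL (untail i) (\<sigma> q))"

text \<open>Arranged to fit \<open>det_on_block_congruence\<close>. The second bracket of the tail
  block is the Hessian of \<open>L\<close> plus the Hessians of the \<open>G k\<close>, weighted by
  the gradient of \<open>A\<close> at the sheared point.\<close>

definition shear_hessian ::
    "('i \<Rightarrow> ('k \<Rightarrow> real) \<Rightarrow> real) \<Rightarrow> ('i \<Rightarrow> ('i \<Rightarrow> real) \<Rightarrow> real) \<Rightarrow> ('i \<Rightarrow> 'i \<Rightarrow> real) \<Rightarrow> ('k \<Rightarrow> 'k \<Rightarrow> real) \<Rightarrow>
     ('i \<Rightarrow> 'k \<Rightarrow> ('k \<Rightarrow> real) \<Rightarrow> real) \<Rightarrow> ('i \<Rightarrow> 'k \<Rightarrow> 'k \<Rightarrow> real) \<Rightarrow> ('i \<Rightarrow> real) \<Rightarrow> 'i \<Rightarrow> 'i \<Rightarrow> real" where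
  "shear_hessian G gA hA hL gG hG p i j = (if i \<in> J then
       if j \<in> J then hA i j else (\<Sum>k\<in>J. hA i k * gG k (untail j) (\<sigma> p))
     else if j \<in> J then (\<Sum>k\<in>J. gG k (untail i) (\<sigma> p) * hA k j)
     else (\<Sum>k\<in>J. (\<Sum>l\<in>J. gG l (untail i) (\<sigma> p) * hA l k) * gG k (untail j) (\<sigma> p))
       + ((\<Sum>k\<in>J. gA k (\<phi> G p) * hG k (untail i) (untail j)) + hL (untail i) (untail j)))"

text \<open>The first derivative is needed on a box around \<open>p\<close>. The assumption
  \<open>cont\<close> supplies one that the shear maps into the box where \<open>A\<close> is
  differentiable; the rest is the chain rule, applied once to the function and once to its
  gradient.\<close>

lemma twice_hadamard_shear:
  fixes G :: "'i \<Rightarrow> ('k \<Rightarrow> real) \<Rightarrow> real" and p :: "'i \<Rightarrow> real"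
  assumes A: "twice_hadamard J A gA hA (\<phi> G p)"
    and L: "twice_hadamard K L gL hL (\<sigma> p)"
    and G: "\<And>j. j \<in> J \<Longrightarrow> twice_hadamard K (G j) (gG j) (hG j) (\<sigma> p)"
    and cont: "\<And>e. 0 < e \<Longrightarrow> \<exists>\<delta>>0. \<forall>q\<in>box_on (J \<union> \<iota> ` K) p \<delta>. \<phi> G q \<in> box_on J (\<phi> G p) e"
  shows "twice_hadamard (J \<union> \<iota> ` K) (\<lambda>q. A (\<phi> G q) + L (\<sigma> q))
    (shear_gradient G gA gL gG) (shear_hessian G gA hA hL gG hG p) p"
proof -
  let ?J = "J \<union> \<iota> ` K" and ?gB = "shear_gradient G gA gL gG" and ?hB = "shear_hessian G gA hA hL gG hG p"
  obtain a where a: "a > 0" "\<And>q. q \<in> box_on J (\<phi> G p) a \<Longrightarrow> hadamard J A (\<lambda>i. gA i q) q"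
    using A unfolding twice_hadamard_def by blast
  obtain l where l: "l > 0" "\<And>q. q \<in> box_on K (\<sigma> p) l \<Longrightarrow> hadamard K L (\<lambda>i. gL i q) q"
    using L unfolding twice_hadamard_def by blast
  have "\<forall>j\<in>J. \<exists>e>0. \<forall>q\<in>box_on K (\<sigma> p) e. hadamard K (G j) (\<lambda>k. gG j k q) q"
    using G unfolding twice_hadamard_def by blast
  then obtain e where e: "\<And>j. j \<in> J \<Longrightarrow> e j > 0"
      "\<And>j q. j \<in> J \<Longrightarrow> q \<in> box_on K (\<sigma> p) (e j) \<Longrightarrow> hadamard K (G j) (\<lambda>k. gG j k q) q"
    unfolding bchoice_iff by blast
  obtain r where r: "r > 0" "\<And>q. q \<in> box_on ?J p r \<Longrightarrow> \<phi> G q \<in> box_on J (\<phi> G p) a"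
    using cont[OF a(1)] by blast
  define \<epsilon> where "\<epsilon> = Min (insert r (insert l (e ` J)))"
  have "\<epsilon> > 0" using finJ e(1) r(1) l(1) by (auto simp: \<epsilon>_def)
  moreover have "\<epsilon> \<le> r" "\<epsilon> \<le> l" "\<And>j. j \<in> J \<Longrightarrow> \<epsilon> \<le> e j"
    unfolding \<epsilon>_def using finJ by (auto intro!: Min_le simp del: Min_insert)
  ultimately have \<epsilon>: "\<epsilon> > 0" "\<epsilon> \<le> r" "\<epsilon> \<le> l" "\<And>j. j \<in> J \<Longrightarrow> \<epsilon> \<le> e j" .
  have first: "hadamard ?J (\<lambda>q. A (\<phi> G q) + L (\<sigma> q)) (\<lambda>i. ?gB i q) q" if q: "q \<in> box_on ?J p \<epsilon>" for q
    unfolding hadamard_def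
  proof (intro allI impI)
    fix c c' t\<^sub>0 assume c: "\<forall>i\<in>?J. ((\<lambda>t. c t i) has_real_derivative c' i) (at t\<^sub>0) \<and> c t\<^sub>0 i = q i"
    have \<sigma>q: "\<sigma> q \<in> box_on K (\<sigma> p) \<epsilon>" using q by (auto simp: box_on_def tail_part_def)
    have hG1: "hadamard K (G j) (\<lambda>k. gG j k (\<sigma> q)) (\<sigma> q)" if "j \<in> J" for j
      using \<sigma>q box_on_mono[OF \<epsilon>(4)[OF that]] by (intro e(2)[OF that]) blast
    have hA1: "hadamard J A (\<lambda>i. gA i (\<phi> G q)) (\<phi> G q)"
      using q box_on_mono[OF \<epsilon>(2)] by (intro a(2) r(2)) blast
    have hL1: "hadamard K L (\<lambda>k. gL k (\<sigma> q)) (\<sigma> q)"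
      using \<sigma>q box_on_mono[OF \<epsilon>(3)] by (intro l(2)) blast
    have "((\<lambda>t. A (\<phi> G (c t)) + L (\<sigma> (c t))) has_real_derivative
        (\<Sum>j\<in>J. gA j (\<phi> G q) * (c' j + (\<Sum>k\<in>K. gG j k (\<sigma> q) * c' (\<iota> k)))) + (\<Sum>k\<in>K. gL k (\<sigma> q) * c' (\<iota> k))) (at t\<^sub>0)"
      by (intro DERIV_add shear_hadamard_curve[OF c] tail_hadamard_curve[OF c])
        (use hG1 hA1 hL1 in auto)
    moreover have "(\<Sum>j\<in>J. gA j (\<phi> G q) * (c' j + (\<Sum>k\<in>K. gG j k (\<sigma> q) * c' (\<iota> k)))) + (\<Sum>k\<in>K. gL k (\<sigma> q) * c' (\<iota> k))
        = (\<Sum>i\<in>?J. ?gB i q * c' i)"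
    proof -
      have "(\<Sum>j\<in>J. gA j (\<phi> G q) * (\<Sum>k\<in>K. gG j k (\<sigma> q) * c' (\<iota> k)))
          = (\<Sum>k\<in>K. (\<Sum>j\<in>J. gA j (\<phi> G q) * gG j k (\<sigma> q)) * c' (\<iota> k))"
        unfolding sum_distrib_left sum_distrib_right by (subst sum.swap) (simp add: mult_ac)
      thus ?thesis
        unfolding sum_blocks by (simp add: shear_gradient_def tail_notin distrib_left distrib_right sum.distrib)
    qed
    ultimately show "((\<lambda>t. A (\<phi> G (c t)) + L (\<sigma> (c t))) has_real_derivative (\<Sum>i\<in>?J. ?gB i q * c' i)) (at t\<^sub>0)"
      by simp
  qed
  have hA2: "hadamard J (gA j) (\<lambda>i. hA i j) (\<phi> G p)" if "j \<in> J" for j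
    using A that unfolding twice_hadamard_def by blast
  have hG1: "hadamard K (G j) (\<lambda>k. gG j k (\<sigma> p)) (\<sigma> p)" if "j \<in> J" for j
    using twice_hadamard_first[OF G[OF that]] .
  have hG2: "hadamard K (gG j k) (\<lambda>i. hG j i k) (\<sigma> p)" if "j \<in> J" "k \<in> K" for j k
    using G[OF that(1)] that(2) unfolding twice_hadamard_def by blast
  have hL2: "hadamard K (gL k) (\<lambda>i. hL i k) (\<sigma> p)" if "k \<in> K" for k
    using L that unfolding twice_hadamard_def by blast
  have second: "hadamard ?J (?gB i) (\<lambda>l. ?hB l i) p" if i: "i \<in> ?J" for i
    unfolding hadamard_def
  proof (intro allI impI)
    fix c c' t\<^sub>0 assume c: "\<forall>i\<in>?J. ((\<lambda>t. c t i) has_real_derivative c' i) (at t\<^sub>0) \<and> c t\<^sub>0 i = p i"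
    define v where "v j = c' j + (\<Sum>k\<in>K. gG j k (\<sigma> p) * c' (\<iota> k))" for j
    have dA: "((\<lambda>t. gA j (\<phi> G (c t))) has_real_derivative (\<Sum>l\<in>J. hA l j * v l)) (at t\<^sub>0)" if "j \<in> J" for j
      unfolding v_def
      by (rule shear_hadamard_curve[OF c]) (use hG1 hA2[OF that] in auto)
    have swapA: "(\<Sum>l\<in>J. hA l j * v l) = (\<Sum>l\<in>J. hA l j * c' l) + (\<Sum>k\<in>K. (\<Sum>l\<in>J. gG l k (\<sigma> p) * hA l j) * c' (\<iota> k))" for j
    proof -
      have "(\<Sum>l\<in>J. hA l j * (\<Sum>k\<in>K. gG l k (\<sigma> p) * c' (\<iota> k)))
          = (\<Sum>k\<in>K. (\<Sum>l\<in>J. gG l k (\<sigma> p) * hA l j) * c' (\<iota> k))"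
        unfolding sum_distrib_left sum_distrib_right by (subst sum.swap) (simp add: mult_ac)
      thus ?thesis by (simp add: v_def distrib_left sum.distrib)
    qed
    show "((\<lambda>t. ?gB i (c t)) has_real_derivative (\<Sum>l\<in>?J. ?hB l i * c' l)) (at t\<^sub>0)"
    proof (cases "i \<in> J")
      case True
      have "((\<lambda>t. ?gB i (c t)) has_real_derivative (\<Sum>l\<in>J. hA l i * v l)) (at t\<^sub>0)"
        using dA[OF True] True by (simp add: shear_gradient_def)
      moreover have "(\<Sum>l\<in>?J. ?hB l i * c' l) = (\<Sum>l\<in>J. hA l i * v l)"
        unfolding swapA sum_blocks using True by (simp add: shear_hessian_def tail_notin)
      ultimately show ?thesis by simp
    next
      case False
      then obtain k where k: "k \<in> K" "i = \<iota> k" using i by blast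
      have dG: "((\<lambda>t. gG j k (\<sigma> (c t))) has_real_derivative (\<Sum>l\<in>K. hG j l k * c' (\<iota> l))) (at t\<^sub>0)" if "j \<in> J" for j
        by (rule tail_hadamard_curve[OF c hG2[OF that k(1)]])
      have dL: "((\<lambda>t. gL k (\<sigma> (c t))) has_real_derivative (\<Sum>l\<in>K. hL l k * c' (\<iota> l))) (at t\<^sub>0)"
        by (rule tail_hadamard_curve[OF c hL2[OF k(1)]])
      have at: "\<phi> G (c t\<^sub>0) = \<phi> G p" "\<sigma> (c t\<^sub>0) = \<sigma> p"
        using shear_curve_at[OF c] tail_part_curve(2)[OF c] by auto
      have "((\<lambda>t. ?gB i (c t)) has_real_derivative
          (\<Sum>j\<in>J. (\<Sum>l\<in>J. hA l j * v l) * gG j k (\<sigma> p) + (\<Sum>l\<in>K. hG j l k * c' (\<iota> l)) * gA j (\<phi> G p))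
            + (\<Sum>l\<in>K. hL l k * c' (\<iota> l))) (at t\<^sub>0)"
      proof -
        have "((\<lambda>t. (\<Sum>j\<in>J. gA j (\<phi> G (c t)) * gG j k (\<sigma> (c t))) + gL k (\<sigma> (c t))) has_real_derivative
          (\<Sum>j\<in>J. (\<Sum>l\<in>J. hA l j * v l) * gG j k (\<sigma> (c t\<^sub>0)) + (\<Sum>l\<in>K. hG j l k * c' (\<iota> l)) * gA j (\<phi> G (c t\<^sub>0)))
            + (\<Sum>l\<in>K. hL l k * c' (\<iota> l))) (at t\<^sub>0)"
          by (intro DERIV_add DERIV_sum DERIV_mult dA dG dL)
        thus ?thesis using k False by (simp add: shear_gradient_def at)
      qed
      moreover have "(\<Sum>l\<in>?J. ?hB l i * c' l)
          = (\<Sum>j\<in>J. (\<Sum>l\<in>J. hA l j * v l) * gG j k (\<sigma> p) + (\<Sum>l\<in>K. hG j l k * c' (\<iota> l)) * gA j (\<phi> G p))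
            + (\<Sum>l\<in>K. hL l k * c' (\<iota> l))"
      proof -
        have 1: "(\<Sum>j\<in>J. (\<Sum>l\<in>J. hA l j * c' l) * gG j k (\<sigma> p)) = (\<Sum>l\<in>J. (\<Sum>j\<in>J. hA l j * gG j k (\<sigma> p)) * c' l)"
          unfolding sum_distrib_left sum_distrib_right by (subst sum.swap) (simp add: mult_ac)
        have 2: "(\<Sum>j\<in>J. (\<Sum>k'\<in>K. (\<Sum>l\<in>J. gG l k' (\<sigma> p) * hA l j) * c' (\<iota> k')) * gG j k (\<sigma> p))
            = (\<Sum>k'\<in>K. (\<Sum>j\<in>J. (\<Sum>l\<in>J. gG l k' (\<sigma> p) * hA l j) * gG j k (\<sigma> p)) * c' (\<iota> k'))"
          unfolding sum_distrib_right[of _ K] sum_distrib_right[of "\<lambda>j. (\<Sum>l\<in>J. gG l _ (\<sigma> p) * hA l j) * gG j k (\<sigma> p)"]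
          by (subst sum.swap) (simp add: mult_ac)
        have 3: "(\<Sum>j\<in>J. (\<Sum>l\<in>K. hG j l k * c' (\<iota> l)) * gA j (\<phi> G p)) = (\<Sum>l\<in>K. (\<Sum>j\<in>J. gA j (\<phi> G p) * hG j l k) * c' (\<iota> l))"
          unfolding sum_distrib_left sum_distrib_right by (subst sum.swap) (simp add: mult_ac)
        have "(\<Sum>l\<in>?J. ?hB l i * c' l) = (\<Sum>l\<in>J. (\<Sum>j\<in>J. hA l j * gG j k (\<sigma> p)) * c' l)
            + (\<Sum>k'\<in>K. ((\<Sum>j\<in>J. (\<Sum>l\<in>J. gG l k' (\<sigma> p) * hA l j) * gG j k (\<sigma> p))
                + ((\<Sum>j\<in>J. gA j (\<phi> G p) * hG j k' k) + hL k' k)) * c' (\<iota> k'))"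
          unfolding sum_blocks using k False by (simp add: shear_hessian_def tail_notin)
        thus ?thesis
          unfolding swapA by (simp add: distrib_right sum.distrib 1 2 3)
      qed
      ultimately show ?thesis by simp
    qed
  qed
  show ?thesis unfolding twice_hadamard_def using \<epsilon>(1) first second by blast
qed

end

section \<open>One step of the recursion\<close>

lemma mgf_cong: "(\<And>i. i \<in> I \<Longrightarrow> s i = r i) \<Longrightarrow> mgf P I V s = mgf P I V r"
  unfolding mgf_inner using inner_on_cong[of I s r] by simp

lemma ennreal_top_mult_pos:
  fixes a :: ennreal
  assumes "0 < a"
  shows "\<top> * a = \<top>" "a * \<top> = \<top>"
  using assms by (simp_all add: ennreal_top_mult ennreal_mult_top)

lemma mgf_at_time_pos: "0 < mgf_at_time \<phi> t"
  by (simp add: mgf_at_time_def)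

lemma mgf_at_time_measurable [measurable]: "mgf_at_time \<phi> \<in> borel_measurable borel"
  unfolding mgf_at_time_def[abs_def] by measurable

lemma mgf_at_time_finite:
  "\<phi> < \<infinity> \<Longrightarrow> mgf_at_time \<phi> t = ennreal (exp (t * ln (enn2real \<phi>)))"
  by (simp add: mgf_at_time_def)

lemma real_cgf: "mgf P I V s < \<infinity> \<Longrightarrow> real_of_ereal (cgf P I V s) = ln (enn2real (mgf P I V s))"
  by (simp add: cgf_def)

lemma abs_cgf_finite_iff: "\<bar>cgf P I V s\<bar> \<noteq> \<infinity> \<longleftrightarrow> mgf P I V s < \<infinity>"
  by (simp add: cgf_def)

lemma SIGMA_lessThan_Suc:
  fixes f :: "nat \<times> nat \<Rightarrow> 'a::comm_monoid_add"
  shows "(\<Sum>j\<in>(SIGMA m:{..<Suc N}. {..<d m}). f j) = (\<Sum>i<d 0. f (0, i)) + (\<Sum>j\<in>concat_index N d. f j)"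
proof -
  have eq: "(SIGMA m:{..<Suc N}. {..<d m}) = Pair 0 ` {..<d 0} \<union> concat_index N d"
  proof -
    have "{..<Suc N} = insert 0 {1..N}" by auto
    thus ?thesis by (auto simp: concat_index_def)
  qed
  have "Pair 0 ` {..<d 0} \<inter> concat_index N d = {}" by (auto simp: concat_index_def)
  thus ?thesis unfolding eq
    by (subst sum.union_disjoint) (auto simp: finite_concat_index sum.reindex inj_on_def)
qed

text \<open>The passage from \<open>N\<close> to \<open>Suc N\<close> vectors for the conditioned
  process. Unprimed names refer to the first \<open>N\<close> vectors, primed ones to all
  \<open>Suc N\<close>, and \<open>K\<close> indexes the last vector.\<close>

locale compounding_step = prob_space M for M :: "'v measure" +
  fixes N :: nat and d :: "nat \<Rightarrow> nat" and P :: "'u measure"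
    and \<xi> :: "nat \<Rightarrow> 'u \<Rightarrow> nat \<Rightarrow> real"
    and Z :: "nat \<Rightarrow> nat \<Rightarrow> nat \<Rightarrow> real \<Rightarrow> 'u \<Rightarrow> nat \<Rightarrow> real"
    and T :: "nat \<Rightarrow> nat \<Rightarrow> nat \<Rightarrow> real set"
    and W :: "nat \<Rightarrow> 'v \<Rightarrow> nat \<Rightarrow> real" and x :: "nat \<Rightarrow> nat \<Rightarrow> real"
  assumes rc: "recursively_compounded (Suc N) d P \<xi> Z T M W"
    and start: "\<And>w. w \<in> space M \<Longrightarrow> W 0 w = x 0"
begin

abbreviation K :: "nat set" where "K \<equiv> {..<d (Suc N)}"
abbreviation J :: "(nat \<times> nat) set" where "J \<equiv> concat_index N d"
abbreviation J' :: "(nat \<times> nat) set" where "J' \<equiv> concat_index (Suc N) d"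
abbreviation V :: "'v \<Rightarrow> nat \<times> nat \<Rightarrow> real" where "V \<equiv> \<lambda>w. concat_vec N d (\<lambda>n. W n w)"
abbreviation V' :: "'v \<Rightarrow> nat \<times> nat \<Rightarrow> real" where "V' \<equiv> \<lambda>w. concat_vec (Suc N) d (\<lambda>n. W n w)"
abbreviation Y :: "nat \<times> nat \<Rightarrow> 'u \<Rightarrow> nat \<Rightarrow> real" where "Y j \<equiv> Z (Suc N) (fst j) (snd j) 1"
abbreviation xs :: "nat \<times> nat \<Rightarrow> real" where "xs j \<equiv> x (fst j) (snd j)"
abbreviation past :: "(nat \<times> nat) set" where "past \<equiv> (SIGMA m:{..<Suc N}. {..<d m})"

sublocale shear_composition J K "Pair (Suc N)"
  by unfold_locales (auto simp: finite_concat_index inj_on_def concat_index_def)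

definition nonnull :: "nat \<times> nat \<Rightarrow> bool" where
  "nonnull j \<longleftrightarrow> \<not> (AE w in M. W (fst j) w (snd j) = 0)"

text \<open>A null coordinate contributes the factor \<open>1\<close> almost surely, even where the
  MGF of its process is infinite. Its shift is therefore \<open>0\<close>, without any condition on
  the argument.\<close>

definition shift :: "nat \<times> nat \<Rightarrow> (nat \<Rightarrow> real) \<Rightarrow> real" where
  "shift j r = (if nonnull j then real_of_ereal (cgf P K (Y j) r) else 0)"

text \<open>The vector with number \<open>0\<close> is constant and not an argument of the joint
  CGF, so its contribution joins that of \<open>\<xi>\<close>.\<close>

definition intercept :: "(nat \<Rightarrow> real) \<Rightarrow> real" where
  "intercept r = real_of_ereal (cgf P K (\<xi> (Suc N)) r) + (\<Sum>i<d 0. x 0 i * shift (0, i) r)"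

text \<open>The MGF of \<open>X\<^sub>N\<^sub>+\<^sub>1\<close> given the past is almost surely finite at \<open>r\<close>.\<close>

definition step_finite :: "(nat \<Rightarrow> real) \<Rightarrow> bool" where
  "step_finite r \<longleftrightarrow> mgf P K (\<xi> (Suc N)) r < \<infinity> \<and> (\<forall>j\<in>past. nonnull j \<longrightarrow> mgf P K (Y j) r < \<infinity>)"

lemma noise: "compounding_noise (Suc N) d P \<xi> Z T"
  and W_measurable: "n \<le> Suc N \<Longrightarrow> W n \<in> M \<rightarrow>\<^sub>M vec_algebra {..<d n}"
  and W_in_T: "(m, i) \<in> past \<Longrightarrow> w \<in> space M \<Longrightarrow> W m w i \<in> T (Suc N) m i"
proof -
  have n: "Suc N \<in> {1..Suc N}" by simp
  show "compounding_noise (Suc N) d P \<xi> Z T" using rc unfolding recursively_compounded_def by blast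
  show "W n \<in> M \<rightarrow>\<^sub>M vec_algebra {..<d n}" if "n \<le> Suc N"
    using rc that unfolding recursively_compounded_def by blast
  have "\<forall>m<Suc N. \<forall>i<d m. \<forall>w\<in>space M. W m w i \<in> T (Suc N) m i"
    using rc n unfolding recursively_compounded_def by blast
  thus "(m, i) \<in> past \<Longrightarrow> w \<in> space M \<Longrightarrow> W m w i \<in> T (Suc N) m i" by simp
qed

lemma prob_space_P: "prob_space P"
  and \<xi>_measurable: "\<xi> (Suc N) \<in> P \<rightarrow>\<^sub>M vec_algebra K"
  and compounding: "j \<in> past \<Longrightarrow> compounding_process P K (T (Suc N) (fst j) (snd j)) (Z (Suc N) (fst j) (snd j))"
proof -
  have n: "Suc N \<in> {1..Suc N}" by simp
  show "prob_space P" using noise unfolding compounding_noise_def by blast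
  show "\<xi> (Suc N) \<in> P \<rightarrow>\<^sub>M vec_algebra K" using noise n unfolding compounding_noise_def by blast
  have "\<forall>m<Suc N. \<forall>i<d m. compounding_process P K (T (Suc N) m i) (Z (Suc N) m i)"
    using noise n unfolding compounding_noise_def by blast
  thus "j \<in> past \<Longrightarrow> compounding_process P K (T (Suc N) (fst j) (snd j)) (Z (Suc N) (fst j) (snd j))"
    by auto
qed

lemma Y_measurable: "j \<in> past \<Longrightarrow> Y j \<in> P \<rightarrow>\<^sub>M vec_algebra K"
proof -
  assume j: "j \<in> past"
  have "T (Suc N) (fst j) (snd j) \<in> {\<nat>, {0..}, UNIV}"
    using compounding[OF j] unfolding compounding_process_def by blast
  hence "1 \<in> T (Suc N) (fst j) (snd j)" by (elim insertE emptyE; simp)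
  thus ?thesis by (rule compounding_process_mgf(1)[OF prob_space_P compounding[OF j] finite_lessThan])
qed

lemma W_coord:
  assumes "n \<le> Suc N" "i < d n"
  shows "(\<lambda>w. W n w i) \<in> borel_measurable M"
  by (rule measurable_compose[OF W_measurable[OF assms(1)]])
    (use assms(2) in \<open>auto intro!: measurable_component_singleton\<close>)

lemma rv_V: "random_vec M J V" and rv_V': "random_vec M J' V'"
proof -
  have "(\<lambda>w. concat_vec n d (\<lambda>m. W m w) j) \<in> borel_measurable M" if "n \<le> Suc N" "j \<in> concat_index n d" for n j
  proof -
    have "fst j \<le> Suc N" "snd j < d (fst j)" using that by (auto simp: concat_index_def)
    thus ?thesis using W_coord[of "fst j" "snd j"] that(2) by (simp add: concat_vec_def case_prod_beta)
  qed
  note meas = this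
  show "random_vec M J V"
    by (rule random_vec.intro[OF prob_space_axioms random_vec_axioms.intro[OF finite_concat_index]])
      (rule meas, auto)
  show "random_vec M J' V'"
    by (rule random_vec.intro[OF prob_space_axioms random_vec_axioms.intro[OF finite_concat_index]])
      (rule meas, auto)
qed

lemma rv_\<xi>: "random_vec P K (\<xi> (Suc N))"
  by (rule random_vecI[OF prob_space_P finite_lessThan \<xi>_measurable])

lemma rv_Y: "j \<in> past \<Longrightarrow> random_vec P K (Y j)"
  by (rule random_vecI[OF prob_space_P finite_lessThan Y_measurable])

lemma J_past: "J \<subseteq> past"
  by (auto simp: concat_index_def)

lemma J'_eq: "J' = J \<union> Pair (Suc N) ` K"
  unfolding concat_index_Suc by auto

abbreviation weight :: "(nat \<times> nat \<Rightarrow> real) \<Rightarrow> 'v \<Rightarrow> ennreal" where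
  "weight s w \<equiv> (\<Prod>j\<in>past. mgf_at_time (mgf P K (Y j) (\<sigma> s)) (W (fst j) w (snd j)))"

lemma mgf_step:
  "mgf M J' V' s = (\<integral>\<^sup>+w. ennreal (exp (inner_on J s (V w)))
     * (mgf P K (\<xi> (Suc N)) (\<sigma> s) * weight s w) \<partial>M)"
proof -
  have "mgf P K U (\<lambda>k. s (Suc N, k)) = mgf P K U (\<sigma> s)" for U :: "'u \<Rightarrow> nat \<Rightarrow> real"
    by (rule mgf_cong) (simp add: tail_part_def)
  thus ?thesis unfolding mgf_concat_Suc[OF rc] by (simp add: case_prod_beta)
qed

text \<open>The integrand in \<open>mgf_step\<close> is almost surely finite and all its factors are
  strictly positive, so an infinite factor cannot be compensated. The factor of a nonnull coordinate
  with infinite MGF would be infinite on a set of positive probability.\<close>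

lemma step_finite_if_mgf_finite:
  assumes "mgf M J' V' s < \<infinity>"
  shows "step_finite (\<sigma> s)"
proof -
  let ?f = "\<lambda>w. ennreal (exp (inner_on J s (V w)))
     * (mgf P K (\<xi> (Suc N)) (\<sigma> s) * weight s w)"
  interpret V: random_vec M J V by (rule rv_V)
  have [measurable]: "(\<lambda>w. \<Prod>j\<in>past. mgf_at_time (mgf P K (Y j) (\<sigma> s)) (W (fst j) w (snd j))) \<in> borel_measurable M"
  proof (rule borel_measurable_prod_ennreal)
    fix j assume "j \<in> past"
    hence [measurable]: "(\<lambda>w. W (fst j) w (snd j)) \<in> borel_measurable M" by (intro W_coord) auto
    show "(\<lambda>w. mgf_at_time (mgf P K (Y j) (\<sigma> s)) (W (fst j) w (snd j))) \<in> borel_measurable M" by measurable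
  qed
  have "?f \<in> borel_measurable M" by measurable
  moreover have "(\<integral>\<^sup>+w. ?f w \<partial>M) \<noteq> \<infinity>" using assms unfolding mgf_step by simp
  ultimately have ae: "AE w in M. ?f w \<noteq> \<infinity>" by (rule nn_integral_PInf_AE)
  have factor_pos: "0 < (\<Prod>j\<in>S. mgf_at_time (mgf P K (Y j) (\<sigma> s)) (W (fst j) w (snd j)))" for S w
    by (induction S rule: infinite_finite_induct) (auto simp: mgf_at_time_pos ennreal_zero_less_mult_iff)
  have pos\<xi>: "0 < mgf P K (\<xi> (Suc N)) (\<sigma> s)" by (rule random_vec.mgf_pos[OF rv_\<xi>])
  have "mgf P K (\<xi> (Suc N)) (\<sigma> s) < \<infinity>"
  proof (rule ccontr)
    assume "\<not> mgf P K (\<xi> (Suc N)) (\<sigma> s) < \<infinity>"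
    hence "mgf P K (\<xi> (Suc N)) (\<sigma> s) = \<top>" by (simp add: less_top[symmetric])
    hence "?f w = \<infinity>" for w
      by (simp only: ennreal_top_mult_pos factor_pos infinity_ennreal_def ennreal_less_zero_iff exp_gt_zero)
    thus False using ae by simp
  qed
  moreover have "mgf P K (Y j) (\<sigma> s) < \<infinity>" if j: "j \<in> past" "nonnull j" for j
  proof (rule ccontr)
    assume "\<not> mgf P K (Y j) (\<sigma> s) < \<infinity>"
    hence inf: "mgf P K (Y j) (\<sigma> s) = \<top>" by (simp add: less_top[symmetric])
    have "?f w = \<infinity>" if "W (fst j) w (snd j) \<noteq> 0" for w
    proof -
      have "weight s w
          = mgf_at_time (mgf P K (Y j) (\<sigma> s)) (W (fst j) w (snd j))
            * (\<Prod>j\<in>past - {j}. mgf_at_time (mgf P K (Y j) (\<sigma> s)) (W (fst j) w (snd j)))"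
        using j by (intro prod.remove) auto
      also have "\<dots> = \<top>"
      proof -
        have "mgf_at_time (mgf P K (Y j) (\<sigma> s)) (W (fst j) w (snd j)) = \<top>"
          using that inf by (simp add: mgf_at_time_def)
        thus ?thesis by (simp only: ennreal_top_mult_pos factor_pos)
      qed
      finally show ?thesis
        by (simp only: ennreal_top_mult_pos pos\<xi> infinity_ennreal_def ennreal_less_zero_iff exp_gt_zero)
    qed
    hence "AE w in M. W (fst j) w (snd j) = 0" using ae by (auto elim!: eventually_mono)
    thus False using j(2) by (simp add: nonnull_def)
  qed
  ultimately show ?thesis by (simp add: step_finite_def)
qed

text \<open>Given the past, the MGF of the last vector is almost surely the exponential of an affine
  function of the past. The linear part is absorbed into the argument of the MGF of the past, which
  is where the shear comes from.\<close>

lemma mgf_step_finite: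
  assumes "step_finite (\<sigma> s)"
  shows "mgf M J' V' s = ennreal (exp (intercept (\<sigma> s))) * mgf M J V (\<phi> shift s)"
proof -
  interpret V: random_vec M J V by (rule rv_V)
  interpret X: random_vec P K "\<xi> (Suc N)" by (rule rv_\<xi>)
  have fin\<xi>: "mgf P K (\<xi> (Suc N)) (\<sigma> s) < \<infinity>" using assms by (simp add: step_finite_def)
  let ?k = "real_of_ereal (cgf P K (\<xi> (Suc N)) (\<sigma> s))"
  have mgf\<xi>: "mgf P K (\<xi> (Suc N)) (\<sigma> s) = ennreal (exp ?k)"
    using fin\<xi> X.mgf_pos[of "\<sigma> s"] by (simp add: real_cgf enn2real_positive_iff)
  have "AE w in M. \<forall>j\<in>past. mgf_at_time (mgf P K (Y j) (\<sigma> s)) (W (fst j) w (snd j))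
      = ennreal (exp (W (fst j) w (snd j) * shift j (\<sigma> s)))"
  proof (rule AE_finite_allI)
    show "finite past" by simp
    fix j assume j: "j \<in> past"
    show "AE w in M. mgf_at_time (mgf P K (Y j) (\<sigma> s)) (W (fst j) w (snd j))
      = ennreal (exp (W (fst j) w (snd j) * shift j (\<sigma> s)))"
    proof (cases "nonnull j")
      case True
      hence "mgf P K (Y j) (\<sigma> s) < \<infinity>" using assms j unfolding step_finite_def by blast
      thus ?thesis using True by (simp add: mgf_at_time_finite shift_def real_cgf)
    next
      case False
      hence "AE w in M. W (fst j) w (snd j) = 0" by (simp add: nonnull_def)
      thus ?thesis by eventually_elim (simp add: mgf_at_time_def)
    qed
  qed
  hence "AE w in M. ennreal (exp (inner_on J s (V w)))
     * (mgf P K (\<xi> (Suc N)) (\<sigma> s) * weight s w)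
     = ennreal (exp (intercept (\<sigma> s))) * ennreal (exp (inner_on J (\<phi> shift s) (V w)))" (is "AE w in M. ?l w = ?r w")
    using AE_space
  proof eventually_elim
    case (elim w)
    have "weight s w
        = (\<Prod>j\<in>past. ennreal (exp (W (fst j) w (snd j) * shift j (\<sigma> s))))"
      by (rule prod.cong[OF refl]) (rule bspec[OF elim(1)])
    also have "\<dots> = ennreal (exp (\<Sum>j\<in>past. W (fst j) w (snd j) * shift j (\<sigma> s)))"
      by (simp add: prod_ennreal exp_sum)
    finally have "?l w = ennreal (exp (inner_on J s (V w) + (?k + (\<Sum>j\<in>past. W (fst j) w (snd j) * shift j (\<sigma> s)))))"
      by (simp add: mgf\<xi> exp_add ennreal_mult)
    also have "inner_on J s (V w) + (?k + (\<Sum>j\<in>past. W (fst j) w (snd j) * shift j (\<sigma> s)))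
        = intercept (\<sigma> s) + inner_on J (\<phi> shift s) (V w)"
    proof -
      have "inner_on J (\<phi> shift s) (V w) = inner_on J s (V w) + (\<Sum>j\<in>J. W (fst j) w (snd j) * shift j (\<sigma> s))"
        unfolding inner_concat_vec sum.distrib[symmetric]
        by (intro sum.cong) (auto simp: shear_def algebra_simps)
      moreover have "(\<Sum>j\<in>past. W (fst j) w (snd j) * shift j (\<sigma> s))
          = (\<Sum>i<d 0. x 0 i * shift (0, i) (\<sigma> s)) + (\<Sum>j\<in>J. W (fst j) w (snd j) * shift j (\<sigma> s))"
        unfolding SIGMA_lessThan_Suc using start[OF elim(2)] by simp
      ultimately show ?thesis by (simp add: intercept_def)
    qed
    finally show ?case by (simp add: exp_add ennreal_mult)
  qed
  hence "mgf M J' V' s = (\<integral>\<^sup>+w. ?r w \<partial>M)"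
    unfolding mgf_step by (rule nn_integral_cong_AE)
  also have "\<dots> = ennreal (exp (intercept (\<sigma> s))) * mgf M J V (\<phi> shift s)"
    unfolding mgf_inner by (rule nn_integral_cmult) measurable
  finally show ?thesis .
qed

lemma cgf_step_finite:
  assumes "step_finite (\<sigma> s)"
  shows "mgf M J' V' s < \<infinity> \<longleftrightarrow> mgf M J V (\<phi> shift s) < \<infinity>"
    and "mgf M J V (\<phi> shift s) < \<infinity> \<Longrightarrow>
      real_of_ereal (cgf M J' V' s) = real_of_ereal (cgf M J V (\<phi> shift s)) + intercept (\<sigma> s)"
proof -
  show iff: "mgf M J' V' s < \<infinity> \<longleftrightarrow> mgf M J V (\<phi> shift s) < \<infinity>"
    unfolding mgf_step_finite[OF assms] by (simp add: less_top[symmetric] ennreal_mult_eq_top_iff)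
  assume fin: "mgf M J V (\<phi> shift s) < \<infinity>"
  have "0 < mgf M J V (\<phi> shift s)" by (rule random_vec.mgf_pos[OF rv_V])
  hence "0 < enn2real (mgf M J V (\<phi> shift s))" using fin by (simp add: enn2real_positive_iff)
  moreover have "enn2real (mgf M J' V' s) = exp (intercept (\<sigma> s)) * enn2real (mgf M J V (\<phi> shift s))"
    unfolding mgf_step_finite[OF assms] by (simp add: enn2real_mult)
  ultimately show "real_of_ereal (cgf M J' V' s) = real_of_ereal (cgf M J V (\<phi> shift s)) + intercept (\<sigma> s)"
    using fin iff by (simp add: real_cgf ln_mult)
qed

lemma nonnull_start: "i < d 0 \<Longrightarrow> nonnull (0, i) \<longleftrightarrow> x 0 i \<noteq> 0"
proof -
  have "(AE w in M. W 0 w i = 0) \<longleftrightarrow> (AE w in M. x 0 i = 0)"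
    using start by (intro AE_cong) auto
  thus ?thesis by (simp add: nonnull_def)
qed

text \<open>A compatibility of the support of the past with the given values, which holds as soon as one of the two
  saddlepoint approximations is defined.\<close>

definition nondeg_past :: bool where
  "nondeg_past \<longleftrightarrow>
     (\<forall>j\<in>J. nonnull j \<and> (xs j \<noteq> 0 \<or> (\<forall>r. mgf P K (Y j) r < \<infinity>)))"

text \<open>Finiteness of \<open>cgf_step\<close> depends on which \<open>xs j\<close> are nonzero,
  \<open>step_finite\<close> on which coordinates are nonnull. The two agree for the starting vector
  because it is constant, and on \<open>J\<close> by \<open>nondeg_past\<close>.\<close>

lemma cgf_step_eq:
  assumes nd: nondeg_past
  shows "\<bar>cgf_step d P \<xi> Z (Suc N) x r\<bar> \<noteq> \<infinity> \<longleftrightarrow> step_finite r"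
    and "step_finite r \<Longrightarrow> real_of_ereal (cgf_step d P \<xi> Z (Suc N) x r)
      = intercept r + (\<Sum>j\<in>J. xs j * shift j r)"
proof -
  let ?f = "\<lambda>j. ereal (xs j) * cgf P K (Y j) r"
  have step: "cgf_step d P \<xi> Z (Suc N) x r = cgf P K (\<xi> (Suc N)) r + (\<Sum>j\<in>past. ?f j)"
    unfolding cgf_step_def by (subst sum.Sigma) (auto simp: case_prod_beta)
  have nn: "nonnull j \<longleftrightarrow> xs j \<noteq> 0" if "j \<in> past" "j \<notin> J" for j
  proof -
    have "fst j = 0" using that by (intro ccontr[of "fst j = 0"]) (auto simp: concat_index_def)
    moreover from this have "snd j < d 0" using that(1) by auto
    ultimately
    show ?thesis using nonnull_start[of "snd j"] by (metis prod.collapse)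
  qed
  have f_fin: "\<bar>?f j\<bar> \<noteq> \<infinity> \<longleftrightarrow> (nonnull j \<longrightarrow> mgf P K (Y j) r < \<infinity>)" if j: "j \<in> past" for j
  proof -
    have "\<bar>?f j\<bar> \<noteq> \<infinity> \<longleftrightarrow> (xs j \<noteq> 0 \<longrightarrow> mgf P K (Y j) r < \<infinity>)"
      by (auto simp: cgf_def)
    thus ?thesis using nn[OF j] nd unfolding nondeg_past_def by (cases "j \<in> J") auto
  qed
  have "\<bar>a + b\<bar> \<noteq> \<infinity> \<longleftrightarrow> \<bar>a\<bar> \<noteq> \<infinity> \<and> \<bar>b\<bar> \<noteq> \<infinity>" for a b :: ereal
    by (cases a; cases b) auto
  hence "\<bar>cgf_step d P \<xi> Z (Suc N) x r\<bar> \<noteq> \<infinity>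
      \<longleftrightarrow> \<bar>cgf P K (\<xi> (Suc N)) r\<bar> \<noteq> \<infinity> \<and> (\<forall>j\<in>past. \<bar>?f j\<bar> \<noteq> \<infinity>)"
    unfolding step by (simp add: sum_Inf)
  also have "\<dots> \<longleftrightarrow> step_finite r"
  proof -
    have "(\<forall>j\<in>past. \<bar>?f j\<bar> \<noteq> \<infinity>) \<longleftrightarrow> (\<forall>j\<in>past. nonnull j \<longrightarrow> mgf P K (Y j) r < \<infinity>)"
      by (rule ball_cong[OF refl]) (rule f_fin)
    thus ?thesis unfolding step_finite_def abs_cgf_finite_iff by (simp only:)
  qed
  finally show "\<bar>cgf_step d P \<xi> Z (Suc N) x r\<bar> \<noteq> \<infinity> \<longleftrightarrow> step_finite r" .
  assume fin: "step_finite r"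
  have f_real: "?f j = ereal (xs j * shift j r)" if j: "j \<in> past" for j
  proof (cases "nonnull j")
    case True
    hence "mgf P K (Y j) r < \<infinity>" using fin j unfolding step_finite_def by blast
    thus ?thesis using True by (simp add: shift_def cgf_def)
  next
    case False
    hence "j \<notin> J" using nd unfolding nondeg_past_def by auto
    hence "xs j = 0" using nn[OF j] False by simp
    thus ?thesis by (simp add: zero_ereal_def[symmetric])
  qed
  have "cgf_step d P \<xi> Z (Suc N) x r = ereal (real_of_ereal (cgf P K (\<xi> (Suc N)) r) + (\<Sum>j\<in>past. xs j * shift j r))"
    unfolding step using fin f_real by (simp add: step_finite_def cgf_def)
  thus "real_of_ereal (cgf_step d P \<xi> Z (Suc N) x r) = intercept r + (\<Sum>j\<in>J. xs j * shift j r)"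
    by (simp add: intercept_def SIGMA_lessThan_Suc)
qed

end

section \<open>Saddlepoints of the joint distribution\<close>

definition nondeg_saddlepoint ::
    "'i set \<Rightarrow> (('i \<Rightarrow> real) \<Rightarrow> ereal) \<Rightarrow> ('i \<Rightarrow> real) \<Rightarrow> ('i \<Rightarrow> real) \<Rightarrow> bool" where
  "nondeg_saddlepoint I F x s \<longleftrightarrow> saddlepoint I F x s \<and> det_on I (hessian F s) \<noteq> 0"

definition saddlepoint_value ::
    "'i set \<Rightarrow> (('i \<Rightarrow> real) \<Rightarrow> ereal) \<Rightarrow> ('i \<Rightarrow> real) \<Rightarrow> ('i \<Rightarrow> real) \<Rightarrow> real" where
  "saddlepoint_value I F x s = exp (real_of_ereal (F s) - (\<Sum>i\<in>I. s i * x i))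
     / sqrt (det_on I (\<lambda>i j. 2 * pi * hessian F s i j))"

lemma saddlepoint_approx_Some:
  assumes "nondeg_saddlepoint I F x s" "\<And>r. nondeg_saddlepoint I F x r \<Longrightarrow> r = s"
  shows "saddlepoint_approx I F x = Some (saddlepoint_value I F x s)"
proof -
  have "(SOME r. nondeg_saddlepoint I F x r) = s"
    by (rule some_equality) (fact assms)+
  moreover have "\<exists>r. nondeg_saddlepoint I F x r" using assms(1) by (intro exI[of _ s])
  moreover have "saddlepoint_approx I F x = (if \<exists>r. nondeg_saddlepoint I F x r
      then Some (saddlepoint_value I F x (SOME r. nondeg_saddlepoint I F x r)) else None)"
    unfolding saddlepoint_approx_def nondeg_saddlepoint_def saddlepoint_value_def Let_def ..
  ultimately show ?thesis by (simp only: if_True)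
qed

lemma saddlepoint_approx_None_iff:
  "saddlepoint_approx I F x = None \<longleftrightarrow> (\<nexists>s. nondeg_saddlepoint I F x s)"
  by (simp add: saddlepoint_approx_def nondeg_saddlepoint_def Let_def)

context random_vec
begin

lemma saddlepoint_iff:
  "saddlepoint I (cgf M I V) x s \<longleftrightarrow>
     s \<in> vec_space I \<and> (\<exists>\<epsilon>>0. regular s \<epsilon>) \<and> (\<forall>i\<in>I. tilted_mean i s = x i)"
  unfolding saddlepoint_def interior_cgf_domain using cgf_gradient_hessian(1) by auto

lemma hessian_det:
  assumes "regular s \<epsilon>" "0 < \<epsilon>"
  shows "det_on I (hessian (cgf M I V) s) = det_on I (tilted_cov s)"
  using cgf_gradient_hessian(2)[OF assms] by (intro det_on_cong) auto

text \<open>By \<open>tilted_cov_kernel\<close> the difference of two saddlepoints is in the kernel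
  of the Hessian. Both points are extensional, so if they differ they do so at a coordinate in
  \<open>I\<close>.\<close>

lemma nondeg_saddlepoint_unique:
  assumes p: "nondeg_saddlepoint I (cgf M I V) x p" and q: "nondeg_saddlepoint I (cgf M I V) x q"
  shows "p = q"
proof (rule ccontr)
  assume "p \<noteq> q"
  have pv: "p \<in> vec_space I" "q \<in> vec_space I" and mean: "\<forall>i\<in>I. tilted_mean i p = x i" "\<forall>i\<in>I. tilted_mean i q = x i"
    using p q unfolding nondeg_saddlepoint_def saddlepoint_iff by blast+
  obtain \<epsilon> where \<epsilon>: "0 < \<epsilon>" "regular p \<epsilon>"
    using p unfolding nondeg_saddlepoint_def saddlepoint_iff by blast
  obtain \<delta> where \<delta>: "0 < \<delta>" "regular q \<delta>"
    using q unfolding nondeg_saddlepoint_def saddlepoint_iff by blast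
  have "\<exists>i\<in>I. p i \<noteq> q i"
    using \<open>p \<noteq> q\<close> PiE_ext[OF pv] by blast
  then obtain i where i: "i \<in> I" "q i - p i \<noteq> 0" by force
  have "det_on I (tilted_cov p) = 0"
  proof (rule det_on_kernel[where v = "\<lambda>i. q i - p i", OF finite_index _ i])
    show "(\<Sum>j\<in>I. tilted_cov p i j * (q j - p j)) = 0" if "i \<in> I" for i
      using mean that by (intro tilted_cov_kernel[OF \<epsilon>(2,1) \<delta>(2,1)]) auto
  qed
  thus False using p hessian_det[OF \<epsilon>(2,1)] by (simp add: nondeg_saddlepoint_def)
qed

lemma nondeg_saddlepoint_coord:
  assumes s: "nondeg_saddlepoint I (cgf M I V) x s" and i: "i \<in> I"
  shows "\<not> (AE w in M. V w i = 0)"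
    and "(\<And>w. w \<in> space M \<Longrightarrow> 0 \<le> V w i) \<Longrightarrow> 0 < x i"
proof -
  obtain \<epsilon> where \<epsilon>: "0 < \<epsilon>" "regular s \<epsilon>" and mean: "tilted_mean i s = x i"
    using s i unfolding nondeg_saddlepoint_def saddlepoint_iff by blast
  show nonnull: "\<not> (AE w in M. V w i = 0)"
  proof
    assume "AE w in M. V w i = 0"
    hence "det_on I (tilted_cov s) = 0"
      using i by (intro det_on_zero_row[OF finite_index i] tilted_cov_null) auto
    thus False using s hessian_det[OF \<epsilon>(2,1)] by (simp add: nondeg_saddlepoint_def)
  qed
  show "0 < x i" if "\<And>w. w \<in> space M \<Longrightarrow> 0 \<le> V w i"
    using tilted_mean_pos[OF \<epsilon>(2,1) i that nonnull] mean by simp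
qed

end

lemma finite_uniform_box:
  assumes "finite A" "\<And>a. a \<in> A \<Longrightarrow> \<exists>\<delta>>0. \<forall>q\<in>box_on I p \<delta>. Q a q"
  shows "\<exists>\<delta>>0. \<forall>q\<in>box_on I p \<delta>. \<forall>a\<in>A. Q a q"
  using assms
proof (induction A rule: finite_induct)
  case empty
  show ?case by (auto intro: exI[of _ 1])
next
  case (insert a A)
  obtain \<delta> where \<delta>: "\<delta> > 0" "\<forall>q\<in>box_on I p \<delta>. \<forall>a\<in>A. Q a q" using insert by auto
  obtain \<epsilon> where \<epsilon>: "\<epsilon> > 0" "\<forall>q\<in>box_on I p \<epsilon>. Q a q" using insert.prems by auto
  have "\<forall>q\<in>box_on I p (min \<delta> \<epsilon>). \<forall>a\<in>insert a A. Q a q"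
    using \<delta>(2) \<epsilon>(2) box_on_mono[of "min \<delta> \<epsilon>" \<delta> I p] box_on_mono[of "min \<delta> \<epsilon>" \<epsilon> I p] by auto
  moreover have "min \<delta> \<epsilon> > 0" using \<delta>(1) \<epsilon>(1) by simp
  ultimately show ?case by blast
qed

section \<open>Domains and smoothness under the change of variables of one step\<close>

context compounding_step
begin

interpretation V: random_vec M J V by (rule rv_V)
interpretation V': random_vec M J' V' by (rule rv_V')
interpretation X: random_vec P K "\<xi> (Suc N)" by (rule rv_\<xi>)

abbreviation F where "F \<equiv> cgf M J V"
abbreviation F' where "F' \<equiv> cgf M J' V'"
abbreviation S where "S \<equiv> cgf_step d P \<xi> Z (Suc N) x"

abbreviation int_dom where "int_dom \<equiv> powertop_real J interior_of (cgf_domain J F)"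
abbreviation int_dom' where "int_dom' \<equiv> powertop_real J' interior_of (cgf_domain J' F')"

text \<open>The interior of the domain of the last factor, phrased by \<open>step_finite\<close> and
  so independent of the prescribed values on \<open>J\<close>. It can be used before
  \<open>nondeg_past\<close> is known; \<open>step_interior_iff\<close> links it to
  \<open>cgf_step\<close>.\<close>

definition step_interior :: "(nat \<Rightarrow> real) \<Rightarrow> bool" where
  "step_interior r \<longleftrightarrow> r \<in> vec_space K \<and> (\<exists>\<epsilon>>0. \<forall>q\<in>box_on K r \<epsilon> \<inter> vec_space K. step_finite q)"

text \<open>With first block \<open>u j - shift j r\<close> this inverts the map from
  \<open>s\<close> to its shear and its tail, see \<open>shear_mix\<close> and
  \<open>tail_mix\<close>.\<close>

definition mix :: "(nat \<times> nat \<Rightarrow> real) \<Rightarrow> (nat \<Rightarrow> real) \<Rightarrow> nat \<times> nat \<Rightarrow> real" where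
  "mix u r = (\<lambda>j\<in>J'. if j \<in> J then u j else r (snd j))"

lemma mix_vec_space: "mix u r \<in> vec_space J'"
  by (simp add: mix_def)

lemma tail_in_J': "k \<in> K \<Longrightarrow> (Suc N, k) \<in> J'"
  by (simp add: concat_index_def)

lemma J_subset_J': "J \<subseteq> J'"
  unfolding J'_eq by blast

lemma sum_J': "(\<Sum>j\<in>J'. f j) = (\<Sum>j\<in>J. f j) + (\<Sum>k\<in>K. f (Suc N, k))"
  unfolding J'_eq by (rule sum_blocks)

lemma tail_mix: "r \<in> vec_space K \<Longrightarrow> \<sigma> (mix u r) = r"
  using tail_in_J' tail_notin
  by (auto simp: tail_part_def mix_def fun_eq_iff restrict_def PiE_def extensional_def)

lemma mix_J: "j \<in> J \<Longrightarrow> mix u r j = u j"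
  using J_subset_J' by (auto simp: mix_def)

lemma mix_tail: "k \<in> K \<Longrightarrow> mix u r (Suc N, k) = r k"
  using tail_in_J' tail_notin by (auto simp: mix_def)

lemma tail_vec_space: "\<sigma> s \<in> vec_space K"
  by (simp add: tail_part_def)

lemma shear_vec_space: "\<phi> shift s \<in> vec_space J"
  by (simp add: shear_def)

lemma box_J'_iff:
  "q \<in> box_on J' s \<epsilon> \<longleftrightarrow> q \<in> box_on J s \<epsilon> \<and> (\<forall>k\<in>K. \<bar>q (Suc N, k) - s (Suc N, k)\<bar> < \<epsilon>)"
  unfolding J'_eq box_on_def by auto

lemma tail_box: "q \<in> box_on J' s \<epsilon> \<Longrightarrow> \<sigma> q \<in> box_on K (\<sigma> s) \<epsilon>"
  unfolding box_J'_iff by (simp add: box_on_def tail_part_def)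

lemma shear_mix:
  assumes "u \<in> vec_space J" "r \<in> vec_space K"
  shows "\<phi> shift (mix (\<lambda>j. u j - shift j r) r) = u"
proof (rule PiE_ext[OF shear_vec_space assms(1)])
  fix j assume "j \<in> J"
  thus "\<phi> shift (mix (\<lambda>j. u j - shift j r) r) j = u j"
    by (simp add: shear_def tail_mix[OF assms(2)] mix_J)
qed

lemma interior_iff:
  "s \<in> int_dom' \<longleftrightarrow>
     s \<in> vec_space J' \<and> (\<exists>\<epsilon>>0. \<forall>q\<in>box_on J' s \<epsilon> \<inter> vec_space J'. mgf M J' V' q < \<infinity>)"
  "u \<in> int_dom \<longleftrightarrow>
     u \<in> vec_space J \<and> (\<exists>\<epsilon>>0. \<forall>q\<in>box_on J u \<epsilon> \<inter> vec_space J. mgf M J V q < \<infinity>)"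
proof -
  have dom: "cgf_domain J' F' = {q \<in> vec_space J'. mgf M J' V' q < \<infinity>}"
    "cgf_domain J F = {q \<in> vec_space J. mgf M J V q < \<infinity>}"
    by (simp_all only: cgf_domain_def abs_cgf_finite_iff)
  show "s \<in> int_dom' \<longleftrightarrow>
     s \<in> vec_space J' \<and> (\<exists>\<epsilon>>0. \<forall>q\<in>box_on J' s \<epsilon> \<inter> vec_space J'. mgf M J' V' q < \<infinity>)"
    unfolding dom by (subst interior_of_powertop_real) (auto simp: finite_concat_index)
  show "u \<in> int_dom \<longleftrightarrow>
     u \<in> vec_space J \<and> (\<exists>\<epsilon>>0. \<forall>q\<in>box_on J u \<epsilon> \<inter> vec_space J. mgf M J V q < \<infinity>)"
    unfolding dom by (subst interior_of_powertop_real) (auto simp: finite_concat_index)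
qed

text \<open>Two slices of the joint box suffice. Varying only the tail yields finiteness of the step
  around the tail of \<open>s\<close>. With the tail held fixed the shear is a translation of the
  \<open>J\<close> block, so a box around \<open>s\<close> covers a box of the same radius around
  its image.\<close>

lemma interior_joint_imp:
  assumes "s \<in> int_dom'"
  shows "step_interior (\<sigma> s)" "\<phi> shift s \<in> int_dom"
proof -
  obtain \<epsilon> where \<epsilon>: "\<epsilon> > 0" "\<And>q. q \<in> box_on J' s \<epsilon> \<Longrightarrow> q \<in> vec_space J' \<Longrightarrow> mgf M J' V' q < \<infinity>"
    using assms unfolding interior_iff by blast
  have step: "step_finite q" if q: "q \<in> box_on K (\<sigma> s) \<epsilon>" "q \<in> vec_space K" for q
  proof -
    have "mix s q \<in> box_on J' s \<epsilon>"
      using q(1) \<epsilon>(1) unfolding box_J'_iff by (auto simp: box_on_def mix_J mix_tail tail_part_def)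
    hence "mgf M J' V' (mix s q) < \<infinity>" by (rule \<epsilon>(2)[OF _ mix_vec_space])
    from step_finite_if_mgf_finite[OF this] show ?thesis by (simp add: tail_mix[OF q(2)])
  qed
  thus "step_interior (\<sigma> s)"
    using \<epsilon>(1) tail_vec_space unfolding step_interior_def by blast
  have "mgf M J V u < \<infinity>" if u: "u \<in> box_on J (\<phi> shift s) \<epsilon>" "u \<in> vec_space J" for u
  proof -
    define q where "q = mix (\<lambda>j. u j - shift j (\<sigma> s)) (\<sigma> s)"
    have \<sigma>q: "\<sigma> q = \<sigma> s" unfolding q_def by (rule tail_mix[OF tail_vec_space])
    have \<phi>q: "\<phi> shift q = u" unfolding q_def by (rule shear_mix[OF u(2) tail_vec_space])
    have "\<bar>q j - s j\<bar> = \<bar>u j - \<phi> shift s j\<bar>" if "j \<in> J" for j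
      using that by (simp add: q_def mix_J shear_def)
    hence "q \<in> box_on J' s \<epsilon>"
      using u(1) \<epsilon>(1) unfolding box_J'_iff by (auto simp: box_on_def q_def mix_tail tail_part_def)
    hence "mgf M J' V' q < \<infinity>" unfolding q_def by (rule \<epsilon>(2)[OF _ mix_vec_space])
    moreover have "step_finite (\<sigma> q)"
      unfolding \<sigma>q using \<epsilon>(1) by (intro step box_on_self tail_vec_space)
    ultimately show ?thesis using cgf_step_finite(1)[of q] \<phi>q by simp
  qed
  thus "\<phi> shift s \<in> int_dom"
    unfolding interior_iff using \<epsilon>(1) shear_vec_space by blast
qed

lemma step_interior_regular:
  assumes "step_interior r"
  shows "\<exists>\<epsilon>>0. X.regular r \<epsilon>"
    and "j \<in> past \<Longrightarrow> nonnull j \<Longrightarrow> \<exists>\<epsilon>>0. random_vec.regular P K (Y j) r \<epsilon>"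
proof -
  obtain \<epsilon> where \<epsilon>: "\<epsilon> > 0" "\<And>q. q \<in> box_on K r \<epsilon> \<Longrightarrow> q \<in> vec_space K \<Longrightarrow> step_finite q"
    using assms unfolding step_interior_def by blast
  have "X.regular r (\<epsilon> / 2)"
  proof (rule X.regularI[OF \<epsilon>(1)])
    fix q assume "q \<in> vec_space K" "q \<in> box_on K r \<epsilon>"
    thus "integrable P (\<lambda>u. exp (inner_on K q (\<xi> (Suc N) u)))"
      using \<epsilon>(2)[of q] unfolding step_finite_def X.mgf_finite_iff by blast
  qed
  thus "\<exists>\<epsilon>>0. X.regular r \<epsilon>" using \<epsilon>(1) half_gt_zero by blast
  show "\<exists>\<epsilon>>0. random_vec.regular P K (Y j) r \<epsilon>" if j: "j \<in> past" "nonnull j"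
  proof -
    interpret Y: random_vec P K "Y j" by (rule rv_Y[OF j(1)])
    have "Y.regular r (\<epsilon> / 2)"
    proof (rule Y.regularI[OF \<epsilon>(1)])
      fix q assume "q \<in> vec_space K" "q \<in> box_on K r \<epsilon>"
      hence "step_finite q" by (intro \<epsilon>(2))
      hence "mgf P K (Y j) q < \<infinity>" using j unfolding step_finite_def by blast
      thus "integrable P (\<lambda>u. exp (inner_on K q (Y j u)))" unfolding Y.mgf_finite_iff .
    qed
    thus ?thesis using \<epsilon>(1) half_gt_zero by blast
  qed
qed

lemma shift_smooth:
  assumes "step_interior r" "j \<in> past"
  shows "\<exists>g h. twice_hadamard K (shift j) g h r"
    and "0 < e \<Longrightarrow> \<exists>\<delta>>0. \<forall>q\<in>box_on K r \<delta>. \<bar>shift j q - shift j r\<bar> < e"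
proof -
  interpret Y: random_vec P K "Y j" by (rule rv_Y[OF assms(2)])
  have nonnull_shift: "shift j = (\<lambda>q. real_of_ereal (cgf P K (Y j) q))" if "nonnull j"
    using that by (simp add: shift_def[abs_def])
  have null_shift: "shift j = (\<lambda>_. 0)" if "\<not> nonnull j"
    using that by (simp add: shift_def[abs_def])
  show "\<exists>g h. twice_hadamard K (shift j) g h r"
  proof (cases "nonnull j")
    case True
    then obtain \<epsilon> where "0 < \<epsilon>" "Y.regular r \<epsilon>" using step_interior_regular(2)[OF assms True] by blast
    thus ?thesis unfolding nonnull_shift[OF True] using Y.twice_hadamard_cgf by blast
  next
    case False
    show ?thesis unfolding null_shift[OF False] using twice_hadamard_zero by blast
  qed
  show "\<exists>\<delta>>0. \<forall>q\<in>box_on K r \<delta>. \<bar>shift j q - shift j r\<bar> < e" if e: "0 < e"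
  proof (cases "nonnull j")
    case True
    then obtain \<epsilon> where "0 < \<epsilon>" "Y.regular r \<epsilon>" using step_interior_regular(2)[OF assms True] by blast
    thus ?thesis unfolding nonnull_shift[OF True] using Y.cgf_continuous e by blast
  next
    case False
    show ?thesis unfolding null_shift[OF False] using e by (auto intro: exI[of _ 1])
  qed
qed

lemma intercept_smooth:
  assumes "step_interior r"
  shows "\<exists>g h. twice_hadamard K intercept g h r"
proof -
  obtain \<epsilon> where "0 < \<epsilon>" "X.regular r \<epsilon>" using step_interior_regular(1)[OF assms] by blast
  hence X: "twice_hadamard K (\<lambda>q. real_of_ereal (cgf P K (\<xi> (Suc N)) q)) X.tilted_mean (X.tilted_cov r) r"
    by (intro X.twice_hadamard_cgf)
  have "\<forall>i\<in>{..<d 0}. \<exists>g h. twice_hadamard K (shift (0, i)) g h r"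
    by (intro ballI shift_smooth(1)[OF assms]) auto
  then obtain g h where gh: "\<And>i. i < d 0 \<Longrightarrow> twice_hadamard K (shift (0, i)) (g i) (h i) r"
    by (metis lessThan_iff)
  have "twice_hadamard K (\<lambda>q. real_of_ereal (cgf P K (\<xi> (Suc N)) q) + (\<Sum>i<d 0. x 0 i * shift (0, i) q))
      (\<lambda>k q. X.tilted_mean k q + (\<Sum>i<d 0. x 0 i * g i k q))
      (\<lambda>k l. X.tilted_cov r k l + (\<Sum>i<d 0. x 0 i * h i k l)) r"
    by (intro twice_hadamard_add[OF X] twice_hadamard_sum twice_hadamard_cmult gh) auto
  thus ?thesis unfolding intercept_def[abs_def] by blast
qed

lemma shear_continuous:
  assumes "step_interior (\<sigma> s)" "0 < e"
  shows "\<exists>\<delta>>0. \<forall>q\<in>box_on J' s \<delta>. \<phi> shift q \<in> box_on J (\<phi> shift s) e"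
proof -
  have "\<exists>\<delta>>0. \<forall>r\<in>box_on K (\<sigma> s) \<delta>. \<forall>j\<in>J. \<bar>shift j r - shift j (\<sigma> s)\<bar> < e / 2"
    using assms J_past by (intro finite_uniform_box finite_concat_index shift_smooth(2)) auto
  then obtain \<delta> where \<delta>: "\<delta> > 0"
    "\<And>r j. r \<in> box_on K (\<sigma> s) \<delta> \<Longrightarrow> j \<in> J \<Longrightarrow> \<bar>shift j r - shift j (\<sigma> s)\<bar> < e / 2" by blast
  have "\<phi> shift q \<in> box_on J (\<phi> shift s) e" if q: "q \<in> box_on J' s (min \<delta> (e / 2))" for q
  proof -
    have "q \<in> box_on J' s \<delta>" "q \<in> box_on J' s (e / 2)"
      using subsetD[OF box_on_mono[OF min.cobounded1] q] subsetD[OF box_on_mono[OF min.cobounded2] q] .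
    hence "\<bar>shift j (\<sigma> q) - shift j (\<sigma> s)\<bar> < e / 2" "\<bar>q j - s j\<bar> < e / 2" if "j \<in> J" for j
      using \<delta>(2)[OF tail_box that] J_subset_J' that by (auto simp: box_on_def)
    hence "\<bar>(q j + shift j (\<sigma> q)) - (s j + shift j (\<sigma> s))\<bar> < e" if "j \<in> J" for j
      using that by (smt (verit) field_sum_of_halves)
    thus ?thesis by (simp add: box_on_def shear_def)
  qed
  moreover have "min \<delta> (e / 2) > 0" using \<delta>(1) assms(2) by simp
  ultimately show ?thesis by blast
qed

text \<open>Here both blocks vary at once, so a small box around \<open>s\<close> is kept in the
  domain of the past by continuity of the shear.\<close>

lemma interior_joint_if:
  assumes "step_interior (\<sigma> s)" "\<phi> shift s \<in> int_dom" "s \<in> vec_space J'"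
  shows "s \<in> int_dom'"
proof -
  obtain \<epsilon> where \<epsilon>: "\<epsilon> > 0" "\<And>q. q \<in> box_on J (\<phi> shift s) \<epsilon> \<Longrightarrow> q \<in> vec_space J \<Longrightarrow> mgf M J V q < \<infinity>"
    using assms(2) unfolding interior_iff by blast
  obtain \<eta> where \<eta>: "\<eta> > 0" "\<And>q. q \<in> box_on K (\<sigma> s) \<eta> \<Longrightarrow> q \<in> vec_space K \<Longrightarrow> step_finite q"
    using assms(1) unfolding step_interior_def by blast
  obtain \<delta> where \<delta>: "\<delta> > 0" "\<And>q. q \<in> box_on J' s \<delta> \<Longrightarrow> \<phi> shift q \<in> box_on J (\<phi> shift s) \<epsilon>"
    using shear_continuous[OF assms(1) \<epsilon>(1)] by blast
  have "mgf M J' V' q < \<infinity>" if "q \<in> box_on J' s (min \<delta> \<eta>)" for q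
  proof -
    have q: "q \<in> box_on J' s \<delta>" "q \<in> box_on J' s \<eta>"
      using that box_on_mono[of "min \<delta> \<eta>" \<delta> J' s] box_on_mono[of "min \<delta> \<eta>" \<eta> J' s] by auto
    have "step_finite (\<sigma> q)" by (rule \<eta>(2)[OF tail_box[OF q(2)] tail_vec_space])
    moreover have "mgf M J V (\<phi> shift q) < \<infinity>" by (rule \<epsilon>(2)[OF \<delta>(2)[OF q(1)] shear_vec_space])
    ultimately show ?thesis using cgf_step_finite(1) by blast
  qed
  moreover have "min \<delta> \<eta> > 0" using \<delta>(1) \<eta>(1) by simp
  ultimately show ?thesis unfolding interior_iff using assms(3) by blast
qed


lemma concat_vec_coord:
  "j \<in> concat_index n d \<Longrightarrow> concat_vec n d y j = y (fst j) (snd j)"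
  by (simp add: concat_vec_def case_prod_beta)

text \<open>The vector \<open>U\<close> is left open so that the lemma covers both the past alone
  and the joint vector: a nondegenerate saddlepoint on either side forces the same
  condition.\<close>

lemma nondeg_pastI:
  assumes U: "random_vec M I U" and s: "nondeg_saddlepoint I (cgf M I U) y s"
    and JI: "J \<subseteq> I" and Uj: "\<And>j w. j \<in> J \<Longrightarrow> U w j = W (fst j) w (snd j)"
    and yj: "\<And>j. j \<in> J \<Longrightarrow> y j = xs j"
  shows nondeg_past
  unfolding nondeg_past_def
proof
  interpret U: random_vec M I U by (rule U)
  fix j assume j: "j \<in> J"
  have jI: "j \<in> I" and jp: "j \<in> past" using j JI J_past by auto
  have "nonnull j"
    using U.nondeg_saddlepoint_coord(1)[OF s jI] by (simp add: nonnull_def Uj[OF j])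
  moreover have "xs j \<noteq> 0 \<or> (\<forall>r. mgf P K (Y j) r < \<infinity>)"
    using compounding_process_cases[OF prob_space_P compounding[OF jp] finite_lessThan]
  proof
    assume T: "T (Suc N) (fst j) (snd j) \<subseteq> {0..}"
    have "0 \<le> U w j" if "w \<in> space M" for w
      using W_in_T[of "fst j" "snd j" w] that jp T by (auto simp: Uj[OF j])
    hence "0 < y j" by (rule U.nondeg_saddlepoint_coord(2)[OF s jI])
    thus ?thesis by (simp add: yj[OF j])
  qed simp
  ultimately show "nonnull j \<and> (xs j \<noteq> 0 \<or> (\<forall>r. mgf P K (Y j) r < \<infinity>))" ..
qed

section \<open>Matching of saddlepoints, determinants and values\<close>

context
  assumes nd: nondeg_past
begin

lemma step_interior_iff: "r \<in> powertop_real K interior_of (cgf_domain K S) \<longleftrightarrow> step_interior r"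
proof -
  have dom: "cgf_domain K S = {q \<in> vec_space K. step_finite q}"
    by (simp only: cgf_domain_def cgf_step_eq(1)[OF nd])
  show ?thesis
    unfolding dom step_interior_def by (subst interior_of_powertop_real) auto
qed

text \<open>The tail gradient differs from that of the last factor by the derivatives of the shifts,
  weighted by the error of the past mean. When this mean equals \<open>xs\<close>, the error
  vanishes and the Hessians of the shifts carry the same weights as in \<open>cgf_step\<close>; this
  is the case in which the determinant factors.\<close>

lemma joint_derivatives:
  assumes s: "s \<in> int_dom'"
  shows "\<exists>gG. (\<forall>j\<in>J. gradient F' s j = gradient F (\<phi> shift s) j) \<and>
    (\<forall>k\<in>K. gradient F' s (Suc N, k)
       = gradient S (\<sigma> s) k + (\<Sum>j\<in>J. (gradient F (\<phi> shift s) j - xs j) * gG j k)) \<and>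
    ((\<forall>j\<in>J. gradient F (\<phi> shift s) j = xs j) \<longrightarrow>
       det_on J' (hessian F' s) = det_on J (hessian F (\<phi> shift s)) * det_on K (hessian S (\<sigma> s)))"
proof -
  note int = interior_joint_imp[OF s]
  have "\<exists>\<epsilon>>0. V.regular (\<phi> shift s) \<epsilon>" using int(2) unfolding V.interior_cgf_domain by blast
  then obtain \<epsilon> where "0 < \<epsilon>" "V.regular (\<phi> shift s) \<epsilon>" by blast
  hence A: "twice_hadamard J (\<lambda>q. real_of_ereal (F q)) V.tilted_mean (V.tilted_cov (\<phi> shift s)) (\<phi> shift s)"
    by (intro V.twice_hadamard_cgf)
  obtain gL hL where L: "twice_hadamard K intercept gL hL (\<sigma> s)"
    using intercept_smooth[OF int(1)] by blast
  have "\<forall>j\<in>J. \<exists>g h. twice_hadamard K (shift j) g h (\<sigma> s)"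
    using shift_smooth(1)[OF int(1)] J_past by auto
  hence "\<exists>g. \<forall>j\<in>J. \<exists>h. twice_hadamard K (shift j) (g j) h (\<sigma> s)" by (rule bchoice)
  then obtain gG where "\<forall>j\<in>J. \<exists>h. twice_hadamard K (shift j) (gG j) h (\<sigma> s)" by blast
  hence "\<exists>h. \<forall>j\<in>J. twice_hadamard K (shift j) (gG j) (h j) (\<sigma> s)" by (rule bchoice)
  then obtain hG where G: "\<And>j. j \<in> J \<Longrightarrow> twice_hadamard K (shift j) (gG j) (hG j) (\<sigma> s)" by blast
  have cont: "\<exists>\<delta>>0. \<forall>q\<in>box_on (J \<union> Pair (Suc N) ` K) s \<delta>. \<phi> shift q \<in> box_on J (\<phi> shift s) e" if "0 < e" for e
    using shear_continuous[OF int(1) that] unfolding J'_eq .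
  note B = twice_hadamard_shear[OF A L G cont, folded J'_eq]
  obtain \<eta> where \<eta>: "\<eta> > 0" "\<And>q. q \<in> box_on K (\<sigma> s) \<eta> \<Longrightarrow> q \<in> vec_space K \<Longrightarrow> step_finite q"
    using int(1) unfolding step_interior_def by blast
  obtain \<delta> where \<delta>: "\<delta> > 0" "\<And>q. q \<in> box_on J (\<phi> shift s) \<delta> \<Longrightarrow> q \<in> vec_space J \<Longrightarrow> mgf M J V q < \<infinity>"
    using int(2) unfolding interior_iff by blast
  obtain \<rho> where \<rho>: "\<rho> > 0" "\<And>q. q \<in> box_on J' s \<rho> \<Longrightarrow> \<phi> shift q \<in> box_on J (\<phi> shift s) \<delta>"
    using shear_continuous[OF int(1) \<delta>(1)] by blast
  have joint: "real_of_ereal (F' q) = real_of_ereal (F (\<phi> shift q)) + intercept (\<sigma> q)"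
    if "q \<in> box_on J' s (min \<rho> \<eta>)" for q
  proof -
    have q: "q \<in> box_on J' s \<rho>" "q \<in> box_on J' s \<eta>"
      using subsetD[OF box_on_mono[OF min.cobounded1] that] subsetD[OF box_on_mono[OF min.cobounded2] that] .
    show ?thesis
      by (rule cgf_step_finite(2)[OF \<eta>(2)[OF tail_box[OF q(2)] tail_vec_space] \<delta>(2)[OF \<rho>(2)[OF q(1)] shear_vec_space]])
  qed
  have B': "twice_hadamard J' (\<lambda>q. real_of_ereal (F' q)) (shear_gradient shift V.tilted_mean gL gG)
      (shear_hessian shift V.tilted_mean (V.tilted_cov (\<phi> shift s)) hL gG hG s) s" (is "twice_hadamard J' _ ?g ?h s")
    by (rule twice_hadamard_cong[OF V'.finite_index _ joint B]) (use \<rho>(1) \<eta>(1) in auto)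
  \<comment> \<open>The calculus on boxes allows arbitrary values outside \<open>K\<close>, while
    \<open>\<eta>\<close> controls points of \<open>vec_space K\<close>. The MGFs see only the
    coordinates in \<open>K\<close>, so restricting the point changes nothing.\<close>
  have step_finite_box: "step_finite q" if q: "q \<in> box_on K (\<sigma> s) \<eta>" for q
  proof -
    have "mgf P K U (restrict q K) = mgf P K U q" for U :: "'u \<Rightarrow> nat \<Rightarrow> real"
      by (rule mgf_cong) simp
    moreover have "step_finite (restrict q K)" by (rule \<eta>(2)) (use q in \<open>auto simp: box_on_def\<close>)
    ultimately show ?thesis by (simp add: step_finite_def)
  qed
  have S_twice: "twice_hadamard K (\<lambda>q. real_of_ereal (S q))
      (\<lambda>k q. gL k q + (\<Sum>j\<in>J. xs j * gG j k q))
      (\<lambda>i k. hL i k + (\<Sum>j\<in>J. xs j * hG j i k)) (\<sigma> s)"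
  proof (rule twice_hadamard_cong[OF finite_lessThan \<eta>(1)])
    show "real_of_ereal (S q) = intercept q + (\<Sum>j\<in>J. xs j * shift j q)"
      if "q \<in> box_on K (\<sigma> s) \<eta>" for q
      by (rule cgf_step_eq(2)[OF nd step_finite_box[OF that]])
    show "twice_hadamard K (\<lambda>q. intercept q + (\<Sum>j\<in>J. xs j * shift j q))
      (\<lambda>k q. gL k q + (\<Sum>j\<in>J. xs j * gG j k q))
      (\<lambda>i k. hL i k + (\<Sum>j\<in>J. xs j * hG j i k)) (\<sigma> s)"
      by (rule twice_hadamard_add[OF L twice_hadamard_sum[OF finite_concat_index twice_hadamard_cmult[OF G]]])
  qed
  note dF = twice_hadamard_partials[OF V.finite_index A]
    and dF' = twice_hadamard_partials[OF V'.finite_index B']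
    and dS = twice_hadamard_partials[OF finite_lessThan S_twice]
  have gF: "gradient F (\<phi> shift s) j = V.tilted_mean j (\<phi> shift s)" if "j \<in> J" for j
    unfolding gradient_def by (rule dF(1)[OF that that])
  have gF': "gradient F' s j = ?g j s" if "j \<in> J'" for j
    unfolding gradient_def by (rule dF'(1)[OF that that])
  have gS: "gradient S (\<sigma> s) k = gL k (\<sigma> s) + (\<Sum>j\<in>J. xs j * gG j k (\<sigma> s))" if "k \<in> K" for k
    unfolding gradient_def by (rule dS(1)[OF that that])
  show ?thesis
  proof (intro exI[of _ "\<lambda>j k. gG j k (\<sigma> s)"] conjI ballI impI)
    show "gradient F' s j = gradient F (\<phi> shift s) j" if "j \<in> J" for j
      using gF'[OF subsetD[OF J_subset_J' that]] gF[OF that] that by (simp add: shear_gradient_def)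
    show "gradient F' s (Suc N, k) = gradient S (\<sigma> s) k
        + (\<Sum>j\<in>J. (gradient F (\<phi> shift s) j - xs j) * gG j k (\<sigma> s))" if k: "k \<in> K" for k
    proof -
      have "(\<Sum>j\<in>J. (gradient F (\<phi> shift s) j - xs j) * gG j k (\<sigma> s))
          = (\<Sum>j\<in>J. V.tilted_mean j (\<phi> shift s) * gG j k (\<sigma> s)) - (\<Sum>j\<in>J. xs j * gG j k (\<sigma> s))"
        by (simp add: gF left_diff_distrib sum_subtractf)
      thus ?thesis
        using gF'[OF tail_in_J'[OF k]] gS[OF k] tail_notin[OF k] inv_\<iota>[OF k] by (simp add: shear_gradient_def)
    qed
    assume mean: "\<forall>j\<in>J. gradient F (\<phi> shift s) j = xs j"
    \<comment> \<open>The Hessian of \<open>cgf_step\<close>, carried over to the copy of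
      \<open>K\<close> inside the joint index set. It equals the second bracket of
      \<open>shear_hessian\<close> only because the past has mean \<open>xs\<close>.\<close>
    define B where "B i j = hL (untail i) (untail j)
      + (\<Sum>k\<in>J. xs k * hG k (untail i) (untail j))" for i j
    have nJ: "j \<notin> J" if "j \<in> Pair (Suc N) ` K" for j using that disjoint by auto
    have inJ': "j \<in> J'" if "j \<in> J \<or> j \<in> Pair (Suc N) ` K" for j using that unfolding J'_eq by blast
    have hF': "hessian F' s i j = ?h i j" if "i \<in> J \<or> i \<in> Pair (Suc N) ` K" "j \<in> J \<or> j \<in> Pair (Suc N) ` K" for i j
      unfolding hessian_def by (rule dF'(2)[OF inJ'[OF that(1)] inJ'[OF that(2)]])
    have "det_on J' H = det_on (J \<union> Pair (Suc N) ` K) H" for H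
      by (simp only: J'_eq)
    also have "det_on (J \<union> Pair (Suc N) ` K) (hessian F' s) = det_on J (V.tilted_cov (\<phi> shift s)) * det_on (Pair (Suc N) ` K) B"
    proof (rule det_on_block_congruence[where G = "\<lambda>k j. gG k (untail j) (\<sigma> s)"])
      show "finite J" "finite (Pair (Suc N) ` K)" by (simp_all add: finite_concat_index)
      show "J \<inter> Pair (Suc N) ` K = {}" by (rule disjoint)
      show "hessian F' s i j = V.tilted_cov (\<phi> shift s) i j" if "i \<in> J" "j \<in> J" for i j
        using hF'[of i j] that by (simp add: shear_hessian_def)
      show "hessian F' s i j = (\<Sum>k\<in>J. V.tilted_cov (\<phi> shift s) i k * gG k (untail j) (\<sigma> s))"
        if "i \<in> J" "j \<in> Pair (Suc N) ` K" for i j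
        using hF'[of i j] that nJ[of j] by (simp add: shear_hessian_def)
      show "hessian F' s i j = (\<Sum>k\<in>J. gG k (untail i) (\<sigma> s) * V.tilted_cov (\<phi> shift s) k j)"
        if "i \<in> Pair (Suc N) ` K" "j \<in> J" for i j
        using hF'[of i j] that nJ[of i] by (simp add: shear_hessian_def)
      show "hessian F' s i j = (\<Sum>k\<in>J. (\<Sum>l\<in>J. gG l (untail i) (\<sigma> s) * V.tilted_cov (\<phi> shift s) l k)
          * gG k (untail j) (\<sigma> s)) + B i j"
        if "i \<in> Pair (Suc N) ` K" "j \<in> Pair (Suc N) ` K" for i j
        using hF'[of i j] that nJ[of i] nJ[of j] mean by (simp add: shear_hessian_def B_def gF cong: sum.cong)
    qed
    also have "det_on J (V.tilted_cov (\<phi> shift s)) = det_on J (hessian F (\<phi> shift s))"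
      by (rule det_on_cong) (simp add: hessian_def dF(2))
    also have "det_on (Pair (Suc N) ` K) B = det_on K (\<lambda>i j. B (Suc N, i) (Suc N, j))"
      by (rule det_on_image[OF finK inj])
    also have "\<dots> = det_on K (hessian S (\<sigma> s))"
      by (rule det_on_cong) (simp add: hessian_def dS(2) B_def inv_\<iota>)
    finally show "det_on J' (hessian F' s) = det_on J (hessian F (\<phi> shift s)) * det_on K (hessian S (\<sigma> s))" .
  qed
qed

text \<open>The conditions of lying in the interior are equivalent, so outside the joint interior
  both sides fail. Inside, the gradient equations are triangular: those on \<open>J\<close> make the
  correction in the tail equations vanish and also unlock the factorization of the
  determinant.\<close>

lemma nondeg_saddlepoint_step:
  assumes s: "s \<in> vec_space J'"
  shows "nondeg_saddlepoint J' F' (concat_vec (Suc N) d x) s \<longleftrightarrow>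
    nondeg_saddlepoint J F (concat_vec N d x) (\<phi> shift s) \<and> nondeg_saddlepoint K S (x (Suc N)) (\<sigma> s)"
proof (cases "s \<in> int_dom'")
  case False
  hence "\<not> (step_interior (\<sigma> s) \<and> \<phi> shift s \<in> int_dom)"
    using interior_joint_if s by blast
  thus ?thesis
    using False unfolding nondeg_saddlepoint_def saddlepoint_def step_interior_iff by blast
next
  case True
  note int = interior_joint_imp[OF True]
  obtain gG where grad: "\<forall>j\<in>J. gradient F' s j = gradient F (\<phi> shift s) j"
    "\<forall>k\<in>K. gradient F' s (Suc N, k)
       = gradient S (\<sigma> s) k + (\<Sum>j\<in>J. (gradient F (\<phi> shift s) j - xs j) * gG j k)"
    and det: "(\<forall>j\<in>J. gradient F (\<phi> shift s) j = xs j) \<longrightarrow>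
       det_on J' (hessian F' s) = det_on J (hessian F (\<phi> shift s)) * det_on K (hessian S (\<sigma> s))"
    using joint_derivatives[OF True] by (elim exE conjE)
  have "(\<forall>j\<in>J'. gradient F' s j = concat_vec (Suc N) d x j) \<longleftrightarrow>
      (\<forall>j\<in>J. gradient F' s j = xs j) \<and> (\<forall>k\<in>K. gradient F' s (Suc N, k) = x (Suc N) k)"
    unfolding J'_eq by (simp add: ball_Un concat_vec_coord[of _ "Suc N"] J'_eq)
  also have "\<dots> \<longleftrightarrow> (\<forall>j\<in>J. gradient F (\<phi> shift s) j = xs j) \<and> (\<forall>k\<in>K. gradient S (\<sigma> s) k = x (Suc N) k)"
    by (auto simp: grad)
  finally have gr: "(\<forall>j\<in>J'. gradient F' s j = concat_vec (Suc N) d x j) \<longleftrightarrow>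
      (\<forall>j\<in>J. gradient F (\<phi> shift s) j = xs j) \<and> (\<forall>k\<in>K. gradient S (\<sigma> s) k = x (Suc N) k)" .
  have gr': "(\<forall>j\<in>J. gradient F (\<phi> shift s) j = concat_vec N d x j) \<longleftrightarrow> (\<forall>j\<in>J. gradient F (\<phi> shift s) j = xs j)"
    by (simp add: concat_vec_coord)
  show ?thesis
    unfolding nondeg_saddlepoint_def saddlepoint_def step_interior_iff gr gr'
    using True int det by auto
qed

text \<open>The sum of \<open>xs j * shift j\<close> enters the value of \<open>cgf_step\<close>
  positively and the sheared pairing negatively, and cancels in the exponent. The powers of
  \<open>2 * pi\<close> split because the numbers of coordinates add.\<close>

lemma saddlepoint_value_step:
  assumes "nondeg_saddlepoint J' F' (concat_vec (Suc N) d x) s"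
  shows "saddlepoint_value J' F' (concat_vec (Suc N) d x) s
    = saddlepoint_value J F (concat_vec N d x) (\<phi> shift s) * saddlepoint_value K S (x (Suc N)) (\<sigma> s)"
proof -
  have sint: "s \<in> int_dom'" and mean: "\<forall>j\<in>J'. gradient F' s j = concat_vec (Suc N) d x j"
    using assms unfolding nondeg_saddlepoint_def saddlepoint_def by blast+
  note int = interior_joint_imp[OF sint]
  obtain gG where grad: "\<forall>j\<in>J. gradient F' s j = gradient F (\<phi> shift s) j"
    "\<forall>k\<in>K. gradient F' s (Suc N, k)
       = gradient S (\<sigma> s) k + (\<Sum>j\<in>J. (gradient F (\<phi> shift s) j - xs j) * gG j k)"
    and det_eq: "(\<forall>j\<in>J. gradient F (\<phi> shift s) j = xs j) \<longrightarrow>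
       det_on J' (hessian F' s) = det_on J (hessian F (\<phi> shift s)) * det_on K (hessian S (\<sigma> s))"
    using joint_derivatives[OF sint] by (elim exE conjE)
  have mean': "gradient F (\<phi> shift s) j = xs j" if "j \<in> J" for j
  proof -
    have "gradient F (\<phi> shift s) j = gradient F' s j" by (rule bspec[OF grad(1) that, symmetric])
    also have "\<dots> = concat_vec (Suc N) d x j" by (rule bspec[OF mean subsetD[OF J_subset_J' that]])
    finally show ?thesis by (simp only: concat_vec_coord[OF subsetD[OF J_subset_J' that]])
  qed
  have det: "det_on J' (hessian F' s) = det_on J (hessian F (\<phi> shift s)) * det_on K (hessian S (\<sigma> s))"
    using det_eq mean' by blast
  have "card J' = card J + card K"
    unfolding J'_eq using finJ finK disjoint by (simp add: card_Un_disjoint card_image[OF inj])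
  hence det2: "det_on J' (\<lambda>i j. 2 * pi * hessian F' s i j)
      = det_on J (\<lambda>i j. 2 * pi * hessian F (\<phi> shift s) i j) * det_on K (\<lambda>i j. 2 * pi * hessian S (\<sigma> s) i j)"
    unfolding det_on_scale det \<open>card J' = card J + card K\<close> power_add by (simp only: mult_ac)
  have fin: "step_finite (\<sigma> s)" "mgf M J V (\<phi> shift s) < \<infinity>"
  proof -
    show "step_finite (\<sigma> s)"
      using int(1) box_on_self unfolding step_interior_def by blast
    show "mgf M J V (\<phi> shift s) < \<infinity>"
      using int(2) box_on_self unfolding interior_iff by blast
  qed
  have "real_of_ereal (F' s) - (\<Sum>j\<in>J'. s j * concat_vec (Suc N) d x j)
      = (real_of_ereal (F (\<phi> shift s)) - (\<Sum>j\<in>J. \<phi> shift s j * concat_vec N d x j))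
        + (real_of_ereal (S (\<sigma> s)) - (\<Sum>k\<in>K. \<sigma> s k * x (Suc N) k))"
  proof -
    have "(\<Sum>j\<in>J'. s j * concat_vec (Suc N) d x j) = (\<Sum>j\<in>J. s j * xs j) + (\<Sum>k\<in>K. \<sigma> s k * x (Suc N) k)"
      unfolding sum_J' using J_subset_J' tail_in_J'
      by (intro arg_cong2[where f = "(+)"] sum.cong) (auto simp: concat_vec_coord tail_part_def)
    moreover have "(\<Sum>j\<in>J. \<phi> shift s j * concat_vec N d x j)
        = (\<Sum>j\<in>J. s j * xs j) + (\<Sum>j\<in>J. xs j * shift j (\<sigma> s))"
      unfolding sum.distrib[symmetric]
      by (intro sum.cong) (auto simp: concat_vec_coord shear_def algebra_simps)
    ultimately show ?thesis
      using cgf_step_finite(2)[OF fin] cgf_step_eq(2)[OF nd fin(1)] by simp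
  qed
  thus ?thesis
    unfolding saddlepoint_value_def det2 by (simp only: exp_add real_sqrt_mult times_divide_times_eq)
qed

end

theorem saddlepoint_approx_step:
  "saddlepoint_approx J' F' (concat_vec (Suc N) d x)
   = (if saddlepoint_approx J F (concat_vec N d x) \<noteq> None \<and> saddlepoint_approx K S (x (Suc N)) \<noteq> None
      then Some (the (saddlepoint_approx J F (concat_vec N d x)) * the (saddlepoint_approx K S (x (Suc N))))
      else None)"
proof -
  let ?x = "concat_vec N d x" and ?x' = "concat_vec (Suc N) d x"
  have vec: "s \<in> vec_space I" if "nondeg_saddlepoint I H y s" for I :: "'i set" and H y s
  proof -
    have "s \<in> powertop_real I interior_of cgf_domain I H"
      using that unfolding nondeg_saddlepoint_def saddlepoint_def by blast
    hence "s \<in> cgf_domain I H" by (rule subsetD[OF interior_of_subset])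
    thus ?thesis by (simp add: cgf_domain_def)
  qed
  \<comment> \<open>\<open>nondeg_past\<close> is available as soon as one side has a saddlepoint.
    Without any, both sides are undefined and there is nothing to match.\<close>
  have past: nondeg_past if "nondeg_saddlepoint J F ?x u" for u
    by (rule nondeg_pastI[OF rv_V that]) (auto simp: concat_vec_coord)
  have past': nondeg_past if "nondeg_saddlepoint J' F' ?x' s" for s
    by (rule nondeg_pastI[OF rv_V' that J_subset_J'])
      (use J_subset_J' in \<open>auto simp: concat_vec_coord\<close>)
  have combine: "nondeg_saddlepoint J' F' ?x' (mix (\<lambda>j. u j - shift j r) r)"
    if u: "nondeg_saddlepoint J F ?x u" and r: "nondeg_saddlepoint K S (x (Suc N)) r" for u r
    using nondeg_saddlepoint_step[OF past[OF u] mix_vec_space, of "\<lambda>j. u j - shift j r" r]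
    by (simp add: shear_mix[OF vec[OF u] vec[OF r]] tail_mix[OF vec[OF r]] u r)
  show ?thesis
  proof (cases "\<exists>s. nondeg_saddlepoint J' F' ?x' s")
    case True
    then obtain s where s: "nondeg_saddlepoint J' F' ?x' s" by blast
    have parts: "nondeg_saddlepoint J F ?x (\<phi> shift s)" "nondeg_saddlepoint K S (x (Suc N)) (\<sigma> s)"
      using nondeg_saddlepoint_step[OF past'[OF s] vec[OF s]] s by blast+
    have "saddlepoint_approx J' F' ?x' = Some (saddlepoint_value J' F' ?x' s)"
      using V'.nondeg_saddlepoint_unique[OF _ s] by (rule saddlepoint_approx_Some[OF s])
    moreover have "saddlepoint_approx J F ?x = Some (saddlepoint_value J F ?x (\<phi> shift s))"
      using V.nondeg_saddlepoint_unique[OF _ parts(1)] by (rule saddlepoint_approx_Some[OF parts(1)])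
    moreover have "saddlepoint_approx K S (x (Suc N)) = Some (saddlepoint_value K S (x (Suc N)) (\<sigma> s))"
    \<comment> \<open>Uniqueness for the last factor is borrowed from the joint CGF: another
      saddlepoint \<open>r\<close>, joined with that of the past, gives a second joint saddlepoint,
      which must be \<open>s\<close>.\<close>
    proof (rule saddlepoint_approx_Some[OF parts(2)])
      fix r assume r: "nondeg_saddlepoint K S (x (Suc N)) r"
      have "mix (\<lambda>j. \<phi> shift s j - shift j r) r = s"
        by (rule V'.nondeg_saddlepoint_unique[OF combine[OF parts(1) r] s])
      thus "r = \<sigma> s" using tail_mix[OF vec[OF r], of "\<lambda>j. \<phi> shift s j - shift j r"] by simp
    qed
    ultimately show ?thesis
      using saddlepoint_value_step[OF past'[OF s] s] by simp
  next
    case False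
    hence "saddlepoint_approx J' F' ?x' = None" unfolding saddlepoint_approx_None_iff .
    moreover have "\<not> (saddlepoint_approx J F ?x \<noteq> None \<and> saddlepoint_approx K S (x (Suc N)) \<noteq> None)"
      unfolding saddlepoint_approx_None_iff using combine False by blast
    ultimately show ?thesis by simp
  qed
qed

end

section \<open>Induction on the number of vectors\<close>

lemma recursively_compounded_Suc:
  assumes "recursively_compounded (Suc N) d P \<xi> Z T M W"
  shows "recursively_compounded N d P \<xi> Z T M W"
proof -
  have "{1..N} \<subseteq> {1..Suc N}" by auto
  thus ?thesis
    using assms unfolding recursively_compounded_def compounding_noise_def by (auto simp: subset_iff)
qed

lemma saddlepoint_approx_empty:
  assumes "prob_space M"
  shows "saddlepoint_approx {} (cgf M {} V) y = Some 1"
proof -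
  interpret random_vec M "{}" V
    by (rule random_vec.intro[OF assms]) (simp add: random_vec_axioms_def)
  interpret prob_space M by fact
  have mgf: "mgf M {} V s = 1" for s by (simp add: mgf_def emeasure_space_1)
  have det: "det_on {} A = 1" for A :: "'b \<Rightarrow> 'b \<Rightarrow> real" by (simp add: det_on_def)
  \<comment> \<open>The only point of \<open>vec_space {}\<close>. With MGF, determinant and
    exponential all equal to \<open>1\<close>, the value matches the empty product.\<close>
  have "nondeg_saddlepoint {} (cgf M {} V) y (\<lambda>_. undefined)"
    unfolding nondeg_saddlepoint_def saddlepoint_def det
    by (subst interior_of_powertop_real) (auto simp: cgf_domain_def cgf_def mgf intro: exI[of _ 1])
  from saddlepoint_approx_Some[OF this nondeg_saddlepoint_unique[OF _ this]]
  show ?thesis by (simp add: saddlepoint_value_def det cgf_def mgf)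
qed

lemma prod_option_Suc:
  "prod_option f {1..Suc N} = (if prod_option f {1..N} \<noteq> None \<and> f (Suc N) \<noteq> None
     then Some (the (prod_option f {1..N}) * the (f (Suc N))) else None)"
proof -
  have "{1..Suc N} = insert (Suc N) {1..N}" by auto
  thus ?thesis by (auto simp: prod_option_def mult.commute)
qed

text \<open>A recursively compounded process stays so when its last vector is dropped, hence the
  same \<open>M\<close>, \<open>W\<close> and \<open>x\<close> serve at every stage of the
  induction.\<close>

lemma saddlepoint_approx_recursively_compounded:
  assumes "recursively_compounded N d P \<xi> Z T M W" "\<And>w. w \<in> space M \<Longrightarrow> W 0 w = x 0"
  shows "saddlepoint_approx (concat_index N d)
      (cgf M (concat_index N d) (\<lambda>w. concat_vec N d (\<lambda>n. W n w))) (concat_vec N d x)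
    = prod_option (\<lambda>n. saddlepoint_approx {..<d n} (cgf_step d P \<xi> Z n x) (x n)) {1..N}"
  using assms(1)
proof (induction N)
  case 0
  have "prob_space M" using 0 unfolding recursively_compounded_def by blast
  moreover have "concat_index 0 d = {}" by (simp add: concat_index_def)
  ultimately show ?case by (simp add: saddlepoint_approx_empty prod_option_def)
next
  case (Suc N)
  have "prob_space M" using Suc.prems unfolding recursively_compounded_def by blast
  then interpret compounding_step M N d P \<xi> Z T W x
    using Suc.prems assms(2) by (intro compounding_step.intro compounding_step_axioms.intro)
  show ?case
    unfolding saddlepoint_approx_step Suc.IH[OF recursively_compounded_Suc[OF Suc.prems]] prod_option_Suc ..
qed

theorem theorem3:
  fixes N :: nat and d :: "nat \<Rightarrow> nat"
    and P :: "'u measure" and \<xi> :: "nat \<Rightarrow> 'u \<Rightarrow> nat \<Rightarrow> real"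
    and Z :: "nat \<Rightarrow> nat \<Rightarrow> nat \<Rightarrow> real \<Rightarrow> 'u \<Rightarrow> nat \<Rightarrow> real"
    and T :: "nat \<Rightarrow> nat \<Rightarrow> nat \<Rightarrow> real set"
    and M :: "'w measure" and X :: "nat \<Rightarrow> 'w \<Rightarrow> nat \<Rightarrow> real"
    and M' :: "'v measure" and W :: "nat \<Rightarrow> 'v \<Rightarrow> nat \<Rightarrow> real"
    and x :: "nat \<Rightarrow> nat \<Rightarrow> real"
  assumes "recursively_compounded N d P \<xi> Z T M X"
    and "\<forall>n\<le>N. x n \<in> vec_space {..<d n}"
    and "conditioned_process N d P \<xi> Z T (x 0) M' W"
  shows "saddlepoint_approx (concat_index N d)
           (cgf M' (concat_index N d) (\<lambda>\<omega>. concat_vec N d (\<lambda>n. W n \<omega>)))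
           (concat_vec N d x)
         = prod_option (\<lambda>n. saddlepoint_approx {..<d n} (cgf_step d P \<xi> Z n x) (x n)) {1..N}"
  using assms(3) unfolding conditioned_process_def
  by (intro saddlepoint_approx_recursively_compounded) auto

end
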